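(* Let $K$ be the distribution function of a probability measure on $([0,1],\mathcal{B}([0,1]))$. Let $X_1,X_2,\dots$ be identically distributed real random variables on a probability space $(\Omega,\mathcal{F},\mathbb{P})$ with distribution function $F\in\mathbb{F}_K$, and let $\overline F:=1-F$ and $\widehat F_n:=\frac1n\sum_{i=1}^n\mathbf{1}_{[X_i,\infty)}$. Let $0\le\beta'<\gamma\le1$, and assume that (a) $K$ is locally Lipschitz continuous at $x$ with local Lipschitz constant $L(x)>0$ for all $x\in(0,1)$, and $L(x)\le C'x^{-\beta'}(1-x)^{-\beta'}$ for all $x\in(0,1)$ and some constant $C'>0$; (b) $\int_{-\infty}^0F(x)^{\gamma-\beta'}\,dx+\int_0^\infty\overline F(x)^{\gamma-\beta'}\,dx<\infty$. Let $\phi_{\gamma,F}$ be the weight function $$\phi_{\gamma,F}(x):=F(x)^{-\gamma}\mathbf{1}_{(-\infty,0)}(x)+\overline F(x)^{-\gamma}\mathbf{1}_{[0,\infty)}(x),\qquad x\in\mathbb{R}$$ (if $F$ reaches $0$ or $1$, $\phi_{\gamma,F}$ is to be modified in the obvious way). (i) If the $X_i$ are independent and, for some $r\in[0,\frac12)$, $\int_{-\infty}^\infty\phi_{\gamma,F}(x)^{1/(1-r)}\,dF(x)<\infty$, then $n^r|\mathcal{L}(\widehat F_n)-\mathcal{L}(F)|\to0$ $\mathbb{P}$-a.s. (for this $r$). (ii) If the sequence $(X_i)$ is $\alpha$-mixing with mixing coefficients $(\alpha(n))$, $\int_{-\infty}^\infty\phi_{\gamma,F}\,dF<\infty$, and $$\int_0^1\log\big(1+\alpha^{\rightarrow}(s/2)\big)\,\overline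 G^{\rightarrow}(s)\,ds<\infty,$$ where $\alpha(t):=\alpha(\lfloor t\rfloor)$ is the c\`adl\`ag extension of $\alpha(\cdot)$ from $\mathbb{N}$ to $\mathbb{R}_+$, $\overline G:=1-G$ and $G$ is the distribution function of $\phi_{\gamma,F}(X_1)$, then at least $|\mathcal{L}(\widehat F_n)-\mathcal{L}(F)|\to0$ $\mathbb{P}$-a.s.
   Context: $\mathbb{F}_K$ is the class of all distribution functions $F$ on $\mathbb{R}$ with $\int_{-\infty}^\infty|x|\,dK(F(x))<\infty$, and the L-functional associated with $K$ is $\mathcal{L}(F)=\mathcal{L}_K(F):=\int_{-\infty}^\infty x\,dK(F(x))$, $F\in\mathbb{F}_K$. A weight function is a continuous function $\phi:\mathbb{R}\to\mathbb{R}_+$ which is bounded away from zero (i.e. $\phi(\cdot)\ge\varepsilon$ for some $\varepsilon>0$) and u-shaped (i.e. nonincreasing on $(-\infty,x_\phi]$ and nondecreasing on $[x_\phi,\infty)$ for some $x_\phi\in\mathbb{R}$). The displayed formula for $\phi_{\gamma,F}$ is for the case $F(x)\in(0,1)$ for all $x\in\mathbb{R}$, which is assumed without loss of generality when $\phi_{\gamma,F}$ is introduced. The mixing coefficients are $\alpha(n):=\sup_{k\ge1}\sup_{A,B}|\mathbb{P}[A\cap B]-\mathbb{P}[A]\mathbb{P}[B]|$, where the second supremum ranges over all $A\in\sigma(X_1,\dots,X_k)$ and $B\in\sigma(X_{k+n},X_{k+n+1},\dots)$; the value $\alpha(0)$ is given by the same formula with $n=0$. The sequence $(X_i)$ is $\alpha$-mixing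 if $\alpha(n)\to0$ as $n\to\infty$. For a nonincreasing function $h:\mathbb{R}_+\to[0,1]$, its right-continuous inverse is $h^{\rightarrow}(y):=\sup\{x\in\mathbb{R}_+:h(x)>y\}$, $y\in[0,1]$, with the convention $\sup\emptyset:=0$.
   Formalization: It is additionally assumed that the measure of K has no mass at 1 (K = Dirac at 1 with normal F is a counterexample otherwise); where F reaches 0 or 1, φ is set to 1 in place of 0^(-γ), and its branches meet at the median if F(0) is 0 or 1. *)

theory Defs
  imports "HOL-Probability.Probability"
begin

text \<open>The measure \<open>dK(F(x))\<close> is the Lebesgue--Stieltjes measure of \<open>x \<mapsto> K(F(x))\<close> on the real line.
  The class of distribution functions on which the L-functional is finite:\<close>

definition L_class :: "(real \<Rightarrow> real) \<Rightarrow> (real \<Rightarrow> real) set" where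
  "L_class K = {F. (\<exists>D. real_distribution D \<and> F = cdf D) \<and>
                   integrable (interval_measure (\<lambda>x. K (F x))) (\<lambda>x. \<bar>x\<bar>)}"

definition L_functional :: "(real \<Rightarrow> real) \<Rightarrow> (real \<Rightarrow> real) \<Rightarrow> real" where
  "L_functional K F = (\<integral>x. x \<partial>interval_measure (\<lambda>x. K (F x)))"

definition emp_cdf :: "(nat \<Rightarrow> 'a \<Rightarrow> real) \<Rightarrow> nat \<Rightarrow> 'a \<Rightarrow> real \<Rightarrow> real" where
  "emp_cdf X n \<omega> x = (\<Sum>i=1..n. indicator {X i \<omega>..} x) / real n"

definition locally_lipschitz_at :: "real \<Rightarrow> (real \<Rightarrow> real) \<Rightarrow> real \<Rightarrow> bool" where
  "locally_lipschitz_at L f x \<longleftrightarrow> (\<exists>U. open U \<and> x \<in> U \<and> L-lipschitz_on U f)"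

text \<open>If \<open>0 < F < 1\<close> everywhere, \<open>phi_weight \<gamma> F\<close> is \<open>F\<^sup>-\<^sup>\<gamma>\<close> on \<open>(-\<infinity>,0)\<close> and \<open>(1-F)\<^sup>-\<^sup>\<gamma>\<close> on
  \<open>[0,\<infinity>)\<close>. Two modifications take effect only when \<open>F\<close> reaches 0 or 1.
  Where the formula would read \<open>0\<^sup>-\<^sup>\<gamma>\<close> the value is 1, the lower bound of the formula elsewhere; this
  concerns only points \<open>x\<close> at which the empirical distribution function agrees with \<open>F\<close> almost
  surely, and any other positive value would do.
  If the support lies on one side of the origin (\<open>F(0)\<close> is 0 or 1), the two branches meet at the
  median instead of 0. Splitting at 0 would leave a continuous endpoint of the support
  without a weight.\<close>

definition split_point :: "(real \<Rightarrow> real) \<Rightarrow> real" where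
  "split_point F = (if 0 < F 0 \<and> F 0 < 1 then 0 else Inf {x. 1 / 2 \<le> F x})"

definition phi_weight :: "real \<Rightarrow> (real \<Rightarrow> real) \<Rightarrow> real \<Rightarrow> real" where
  "phi_weight \<gamma> F x =
     (if x < split_point F
      then (if F x = 0 then 1 else F x powr (- \<gamma>))
      else (if F x = 1 then 1 else (1 - F x) powr (- \<gamma>)))"

definition sigma_gen_by :: "'a measure \<Rightarrow> (nat \<Rightarrow> 'a \<Rightarrow> real) \<Rightarrow> nat set \<Rightarrow> 'a set set" where
  "sigma_gen_by M X I =
     sigma_sets (space M) (\<Union>i\<in>I. {X i -` A \<inter> space M | A. A \<in> sets borel})"

definition alpha_coeff :: "'a measure \<Rightarrow> (nat \<Rightarrow> 'a \<Rightarrow> real) \<Rightarrow> nat \<Rightarrow> real" where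
  "alpha_coeff M X n =
     (SUP k\<in>{1..}. SUP (A, B) \<in> sigma_gen_by M X {1..k} \<times> sigma_gen_by M X {k + n..}.
        \<bar>measure M (A \<inter> B) - measure M A * measure M B\<bar>)"

definition alpha_mixing :: "'a measure \<Rightarrow> (nat \<Rightarrow> 'a \<Rightarrow> real) \<Rightarrow> bool" where
  "alpha_mixing M X \<longleftrightarrow> alpha_coeff M X \<longlonglongrightarrow> 0"

definition alpha_ext :: "'a measure \<Rightarrow> (nat \<Rightarrow> 'a \<Rightarrow> real) \<Rightarrow> real \<Rightarrow> real" where
  "alpha_ext M X t = alpha_coeff M X (nat \<lfloor>t\<rfloor>)"

text \<open>For \<open>h\<close> tending to 0 at infinity the set below is bounded for every \<open>y > 0\<close>; the (unspecified)
  value of \<open>Sup\<close> on an unbounded set is then only possible at \<open>y = 0\<close>, a Lebesgue null set.\<close>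

definition right_inv :: "(real \<Rightarrow> real) \<Rightarrow> real \<Rightarrow> real" where
  "right_inv h y =
     (if {x. 0 \<le> x \<and> h x > y} = {} then 0 else Sup {x. 0 \<le> x \<and> h x > y})"

end

theory Submission
  imports Defs "HOL-Real_Asymp.Real_Asymp"
begin

text \<open>
  Integration by parts turns a difference of L-functionals into
  \<open>\<integral> (K (F x) - K (F\<^sub>n x)) dx\<close>. The local Lipschitz constants of \<open>K\<close> are dominated by the
  derivative of \<open>u \<mapsto> u\<^bsup>1-\<beta>'\<^esup> - (1-u)\<^bsup>1-\<beta>'\<^esup>\<close> (up to a factor), and concavity of
  \<open>u\<^bsup>1-\<beta>'\<^esup>\<close> gives \<open>\<bar>K s - K t\<bar> \<le> B \<bar>s - t\<bar> (t\<^bsup>-\<beta>'\<^esup> + (1-t)\<^bsup>-\<beta>'\<^esup>)\<close>, where only \<open>t\<close> enters the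
  weight (\<open>kernel_increment_bound\<close>). With \<open>t = F x\<close> the weight is not random, so the nonlinear
  problem becomes a weighted \<open>L\<^sup>1\<close> problem: left of the median \<open>\<bar>F\<^sub>n - F\<bar>\<close> is integrated against
  \<open>F\<^bsup>-\<beta>'\<^esup> dx\<close>, right of it against \<open>(1-F)\<^bsup>-\<beta>'\<^esup> dx\<close>. Replacing \<open>X\<close> by \<open>-X\<close> exchanges the two
  sides, so it is enough to show \<open>n\<^sup>r \<integral> \<bar>F\<^sub>n - F\<bar> dN \<rightarrow> 0\<close> almost surely for every
  \<open>\<sigma>\<close>-finite \<open>N\<close> with \<open>\<integral> F\<^sup>\<gamma> dN < \<infinity>\<close>. Assumption (b) provides this integral.

  The moment of the weight function matters through one consequence. The integral of \<open>1/F\<close> with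
  respect to \<open>dF\<close> over a half-line \<open>(-\<infinity>, y]\<close> is at least 1, so it can only be finite if the
  positive values of \<open>F\<close> are bounded below. Hence either \<open>\<gamma> < 1 - r\<close>, or both endpoints of the
  support are atoms and \<open>\<gamma>\<close> can be exchanged for \<open>1/2\<close> (\<open>exponent_below_moment_order\<close>).

  For independent observations (\<open>independent_weighted_rate\<close>) a Borel-Cantelli argument shows that
  \<open>F\<^sub>n\<close> eventually vanishes where \<open>F < n\<^bsup>-1-\<rho>\<^esup>\<close>. On the complement, \<open>n\<^bsup>r+\<rho>\<^esup> \<bar>F\<^sub>n - F\<bar> F\<^bsup>-\<gamma>\<^esup>\<close> has an
  exponential moment that is bounded uniformly in \<open>x\<close> and \<open>n\<close>. Integrating in \<open>x\<close> before
  taking the expectation avoids any supremum over \<open>x\<close>.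

  Under mixing (\<open>mixing_weighted_slln\<close>), \<open>\<integral> F\<^sub>n dN\<close> is the average of the variables \<open>N [X\<^sub>i, \<infinity>)\<close>,
  which are at most a multiple of \<open>F(X\<^sub>i)\<^bsup>-\<gamma>\<^esup>\<close>. A strong law for these variables and for the
  indicators of \<open>X\<^sub>i \<le> x\<close>, followed by the lemma of Scheffe, gives convergence in \<open>L\<^sup>1(N)\<close>. The
  strong law is \<open>mixing_slln\<close>. Since the sequence need not be stationary, ergodic theorems do not
  apply; instead the deviation probabilities of truncated sums are bounded by testing with
  \<open>sqrt (1 + x\<^sup>2)\<close>. Its bounded derivative makes the covariance terms linear in the
  variables, of the form \<open>\<integral> min(\<alpha>(q), P(V > t)) dt\<close> instead of the second moments that the
  variance would produce, and linear terms are what a logarithmic mixing rate can sum.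
\<close>

section \<open>Increments of the kernel\<close>

text \<open>  By homogeneity \<open>t = 1\<close> may be assumed, and \<open>u\<^sup>a\<close> lies between 1 and \<open>u\<close>. The right-hand side is
  singular in \<open>t\<close> only, however small \<open>s\<close> is; this keeps the empirical distribution function out of
  the weight.\<close>
lemma abs_powr_diff_le:
  fixes s t a :: real
  assumes "0 \<le> s" "0 < t" "0 < a" "a \<le> 1"
  shows "\<bar>s powr a - t powr a\<bar> \<le> \<bar>s - t\<bar> * t powr (a - 1)"
proof -
  define u where "u = s / t"
  have u: "0 \<le> u" "s = u * t" using assms by (auto simp: u_def)
  have "\<bar>u powr a - 1\<bar> \<le> \<bar>u - 1\<bar>"
  proof (cases "1 \<le> u")
    case True
    then have "1 \<le> u powr a" "u powr a \<le> u powr 1"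
      using assms by (auto intro!: ge_one_powr_ge_zero simp del: powr_one powr_one' intro: powr_mono)
    then show ?thesis using True by simp
  next
    case False
    then have "u powr a \<le> 1" "u \<le> u powr a"
      using assms u powr_mono'[of a 1 u] by (auto simp: powr_le1)
    then show ?thesis using False by simp
  qed
  then have "\<bar>u powr a - 1\<bar> * t powr a \<le> \<bar>u - 1\<bar> * t powr a"
    by (intro mult_right_mono) auto
  moreover have "\<bar>u powr a - 1\<bar> * t powr a = \<bar>s powr a - t powr a\<bar>"
  proof -
    have "s powr a - t powr a = (u powr a - 1) * t powr a"
      using u assms by (simp add: powr_mult algebra_simps)
    then show ?thesis by (simp add: abs_mult)
  qed
  moreover have "\<bar>u - 1\<bar> * t powr a = \<bar>s - t\<bar> * t powr (a - 1)"
  proof -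
    have "s - t = (u - 1) * t" using u by (simp add: algebra_simps)
    then have "\<bar>s - t\<bar> = \<bar>u - 1\<bar> * t" using assms by (simp add: abs_mult)
    moreover have "t * t powr (a - 1) = t powr a" using assms by (simp add: powr_mult_base)
    ultimately show ?thesis by (simp add: mult.assoc)
  qed
  ultimately show ?thesis by simp
qed

text \<open>  A mean value inequality for a function that may fail to be differentiable: near each point the
  increments of \<open>g\<close> dominate those of \<open>k\<close> up to a slope \<open>e\<close>, and by bisection a comparison of
  increments that holds locally holds on the whole interval.\<close>
lemma increment_le_of_local_lipschitz:
  fixes k g g' L :: "real \<Rightarrow> real"
  assumes st: "s \<le> t"
    and lip: "\<And>x. s \<le> x \<Longrightarrow> x \<le> t \<Longrightarrow> locally_lipschitz_at (L x) k x"
    and der: "\<And>x. s \<le> x \<Longrightarrow> x \<le> t \<Longrightarrow> (g has_real_derivative g' x) (at x)"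
    and le: "\<And>x. s \<le> x \<Longrightarrow> x \<le> t \<Longrightarrow> L x \<le> g' x"
  shows "\<bar>k t - k s\<bar> \<le> g t - g s"
proof -
  have "\<bar>k t - k s\<bar> \<le> g t - g s + e * (t - s)" if e: "0 < e" for e
  proof (rule Bolzano[where P = "\<lambda>a b. \<bar>k b - k a\<bar> \<le> g b - g a + e * (b - a)" and a = s and b = t])
    fix a b c
    assume "\<bar>k b - k a\<bar> \<le> g b - g a + e * (b - a)" "\<bar>k c - k b\<bar> \<le> g c - g b + e * (c - b)"
    then show "\<bar>k c - k a\<bar> \<le> g c - g a + e * (c - a)" by (auto simp: algebra_simps)
  next
    fix x assume local: "s \<le> x" "x \<le> t"
    obtain U where U: "open U" "x \<in> U" and kl: "(L x)-lipschitz_on U k"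
      using lip[OF local] by (auto simp: locally_lipschitz_at_def)
    obtain d1 where d1: "0 < d1" "\<And>y. \<bar>y - x\<bar> < d1 \<Longrightarrow> y \<in> U"
      using U by (auto simp: open_dist dist_real_def)
    have "((\<lambda>y. (g y - g x) / (y - x)) \<longlongrightarrow> g' x) (at x)"
      using der[OF local] by (simp add: has_field_derivative_iff)
    then obtain d2 where d2: "0 < d2"
      "\<And>y. y \<noteq> x \<Longrightarrow> \<bar>y - x\<bar> < d2 \<Longrightarrow> \<bar>(g y - g x) / (y - x) - g' x\<bar> < e"
      using e by (auto simp: tendsto_iff eventually_at dist_real_def)
    have up: "(g' x - e) * (y - x) \<le> g y - g x" if "x \<le> y" "y - x < d2" for y
    proof (cases "y = x")
      case False
      then have "g' x - e \<le> (g y - g x) / (y - x)" using d2(2)[of y] that by (auto simp: abs_if split: if_splits)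
      then show ?thesis using False that by (simp add: pos_le_divide_eq)
    qed auto
    have dn: "(g' x - e) * (x - y) \<le> g x - g y" if "y \<le> x" "x - y < d2" for y
    proof (cases "y = x")
      case False
      then have "g' x - e \<le> (g y - g x) / (y - x)" using d2(2)[of y] that by (auto simp: abs_if split: if_splits)
      also have "\<dots> = (g x - g y) / (x - y)" by (metis minus_diff_eq minus_divide_divide)
      finally show ?thesis using False that by (simp add: pos_le_divide_eq)
    qed auto
    show "\<exists>d>0. \<forall>a b. a \<le> x \<and> x \<le> b \<and> b - a < d \<longrightarrow> \<bar>k b - k a\<bar> \<le> g b - g a + e * (b - a)"
    proof (intro exI[of _ "min d1 d2"] conjI allI impI)
      show "0 < min d1 d2" using d1 d2 by simp
    next
      fix a b assume ab: "a \<le> x \<and> x \<le> b \<and> b - a < min d1 d2"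
      then have "a \<in> U" "b \<in> U" using d1(2)[of a] d1(2)[of b] by auto
      then have "\<bar>k b - k a\<bar> \<le> L x * (b - a)"
        using lipschitz_onD[OF kl, of b a] ab by (auto simp: dist_real_def)
      also have "\<dots> \<le> g' x * (b - a)"
        using le[OF local] ab by (intro mult_right_mono) auto
      also have "\<dots> \<le> g b - g a + e * (b - a)"
        using up[of b] dn[of a] ab by (auto simp: algebra_simps)
      finally show "\<bar>k b - k a\<bar> \<le> g b - g a + e * (b - a)" .
    qed
  qed (use st in auto)
  note bound = this
  have "((\<lambda>e. g t - g s + e * (t - s)) \<longlongrightarrow> g t - g s + 0 * (t - s)) (at_right 0)"
    by (intro tendsto_intros)
  moreover have "\<forall>\<^sub>F e in at_right 0. \<bar>k t - k s\<bar> \<le> g t - g s + e * (t - s)"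
    using bound by (auto simp: eventually_at_right_field intro!: exI[of _ 1])
  ultimately show ?thesis
    by (intro tendsto_lowerbound[where F = "at_right 0" and f = "\<lambda>e. g t - g s + e * (t - s)"]) auto
qed

text \<open>  The comparison function \<open>g\<close> is an antiderivative of \<open>2 C (u\<^bsup>-b\<^esup> + (1-u)\<^bsup>-b\<^esup>)\<close>. This sum dominates the
  product \<open>u\<^bsup>-b\<^esup> (1-u)\<^bsup>-b\<^esup>\<close>, which has no elementary antiderivative, because one of \<open>u\<close> and \<open>1-u\<close>
  is at least \<open>1/2\<close>.\<close>
lemma kernel_increment_bound:
  fixes K L :: "real \<Rightarrow> real" and b C :: real
  assumes b: "0 \<le> b" "b < 1" and C: "0 < C"
    and K0: "continuous (at_right 0) K" and K1: "continuous (at_left 1) K"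
    and lip: "\<And>x. 0 < x \<Longrightarrow> x < 1 \<Longrightarrow> locally_lipschitz_at (L x) K x"
    and le: "\<And>x. 0 < x \<Longrightarrow> x < 1 \<Longrightarrow> L x \<le> C * x powr (- b) * (1 - x) powr (- b)"
    and s: "0 \<le> s" "s \<le> 1" and t: "0 < t" "t < 1"
  shows "\<bar>K s - K t\<bar> \<le> 2 * C / (1 - b) * \<bar>s - t\<bar> * (t powr (- b) + (1 - t) powr (- b))"
proof -
  define D where "D = 2 * C / (1 - b)"
  define g where "g = (\<lambda>u::real. D * (u powr (1 - b) - (1 - u) powr (1 - b)))"
  have D: "0 < D" "D * (1 - b) = 2 * C" using b C by (auto simp: D_def)
  have der: "(g has_real_derivative 2 * C * (u powr (- b) + (1 - u) powr (- b))) (at u)"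
    if "0 < u" "u < 1" for u
  proof -
    have "(g has_real_derivative D * ((1 - b) * u powr (1 - b - 1) - (1 - b) * (1 - u) powr (1 - b - 1) * (- 1))) (at u)"
      unfolding g_def using that by (auto intro!: derivative_eq_intros)
    moreover have "D * ((1 - b) * u powr (1 - b - 1) - (1 - b) * (1 - u) powr (1 - b - 1) * (- 1))
       = (D * (1 - b)) * (u powr (- b) + (1 - u) powr (- b))" by (simp add: algebra_simps)
    ultimately show ?thesis using D by simp
  qed
  have le2: "L u \<le> 2 * C * (u powr (- b) + (1 - u) powr (- b))" if u: "0 < u" "u < 1" for u
  proof -
    have half: "v powr (- b) \<le> 2" if "1/2 \<le> v" "v < 1" for v :: real
    proof -
      have "v powr (- b) \<le> (1/2) powr (- b)" using that b by (intro powr_mono2') auto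
      also have "\<dots> = 2 powr b" by (simp add: powr_minus powr_divide)
      also have "\<dots> \<le> 2 powr 1" using b by (intro powr_mono) auto
      finally show ?thesis by simp
    qed
    have "u powr (- b) * (1 - u) powr (- b) \<le> 2 * (u powr (- b) + (1 - u) powr (- b))"
    proof (cases "u \<le> 1/2")
      case True
      then have "u powr (- b) * (1 - u) powr (- b) \<le> u powr (- b) * 2"
        using half[of "1 - u"] u by (intro mult_left_mono) auto
      then show ?thesis by (simp add: add_increasing2)
    next
      case False
      then have "u powr (- b) * (1 - u) powr (- b) \<le> 2 * (1 - u) powr (- b)"
        using half[of u] u by (intro mult_right_mono) auto
      then show ?thesis by (simp add: add_increasing)
    qed
    then have "C * (u powr (- b) * (1 - u) powr (- b)) \<le> C * (2 * (u powr (- b) + (1 - u) powr (- b)))"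
      using C by (intro mult_left_mono) auto
    then show ?thesis using le[OF u] by (simp add: algebra_simps)
  qed
  have gdiff: "\<bar>g v - g t\<bar> \<le> D * \<bar>v - t\<bar> * (t powr (- b) + (1 - t) powr (- b))" if v: "0 \<le> v" "v \<le> 1" for v
  proof -
    have "\<bar>v powr (1 - b) - t powr (1 - b)\<bar> \<le> \<bar>v - t\<bar> * t powr (- b)"
      using abs_powr_diff_le[of v t "1 - b"] v t b by simp
    moreover have "\<bar>(1 - v) powr (1 - b) - (1 - t) powr (1 - b)\<bar> \<le> \<bar>v - t\<bar> * (1 - t) powr (- b)"
      using abs_powr_diff_le[of "1 - v" "1 - t" "1 - b"] v t b by (simp add: abs_minus_commute)
    ultimately have "\<bar>(v powr (1 - b) - t powr (1 - b)) - ((1 - v) powr (1 - b) - (1 - t) powr (1 - b))\<bar>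
       \<le> \<bar>v - t\<bar> * (t powr (- b) + (1 - t) powr (- b))"
      by (simp add: algebra_simps)
    moreover have "g v - g t = D * ((v powr (1 - b) - t powr (1 - b)) - ((1 - v) powr (1 - b) - (1 - t) powr (1 - b)))"
      by (simp add: g_def algebra_simps)
    ultimately show ?thesis using D by (simp add: abs_mult)
  qed
  have inner: "\<bar>K v - K t\<bar> \<le> D * \<bar>v - t\<bar> * (t powr (- b) + (1 - t) powr (- b))"
    if v: "0 < v" "v < 1" for v
  proof -
    have "\<bar>K v - K t\<bar> \<le> \<bar>g v - g t\<bar>"
    proof (cases "v \<le> t")
      case True
      then have "\<bar>K t - K v\<bar> \<le> g t - g v"
        using v t by (intro increment_le_of_local_lipschitz[where L=L, OF _ lip der le2]) auto
      then show ?thesis by simp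
    next
      case False
      then have "\<bar>K v - K t\<bar> \<le> g v - g t"
        using v t by (intro increment_le_of_local_lipschitz[where L=L, OF _ lip der le2]) auto
      then show ?thesis by simp
    qed
    then show ?thesis using gdiff[of v] v by simp
  qed
  have "\<bar>K s - K t\<bar> \<le> D * \<bar>s - t\<bar> * (t powr (- b) + (1 - t) powr (- b))"
  proof (cases "s = 0 \<or> s = 1")
    case False
    then show ?thesis using inner[of s] s by simp
  next
    case True
    then show ?thesis
    proof
      assume s0: "s = 0"
      have "((\<lambda>v. \<bar>K v - K t\<bar>) \<longlongrightarrow> \<bar>K 0 - K t\<bar>) (at_right 0)"
        using K0 by (auto simp: continuous_within intro!: tendsto_intros)
      moreover have "((\<lambda>v. D * \<bar>v - t\<bar> * (t powr (- b) + (1 - t) powr (- b))) \<longlongrightarrow>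
          D * \<bar>0 - t\<bar> * (t powr (- b) + (1 - t) powr (- b))) (at_right 0)"
        by (intro tendsto_intros)
      moreover have "\<forall>\<^sub>F v in at_right 0. \<bar>K v - K t\<bar> \<le> D * \<bar>v - t\<bar> * (t powr (- b) + (1 - t) powr (- b))"
        using inner by (auto simp: eventually_at_right_field intro!: exI[of _ 1])
      ultimately show ?thesis unfolding s0
        by (intro tendsto_le[OF trivial_limit_at_right_real]) auto
    next
      assume s1: "s = 1"
      have "((\<lambda>v. \<bar>K v - K t\<bar>) \<longlongrightarrow> \<bar>K 1 - K t\<bar>) (at_left 1)"
        using K1 by (auto simp: continuous_within intro!: tendsto_intros)
      moreover have "((\<lambda>v. D * \<bar>v - t\<bar> * (t powr (- b) + (1 - t) powr (- b))) \<longlongrightarrow>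
          D * \<bar>1 - t\<bar> * (t powr (- b) + (1 - t) powr (- b))) (at_left 1)"
        by (intro tendsto_intros)
      moreover have "\<forall>\<^sub>F v in at_left 1. \<bar>K v - K t\<bar> \<le> D * \<bar>v - t\<bar> * (t powr (- b) + (1 - t) powr (- b))"
        using inner by (auto simp: eventually_at_left_field intro!: exI[of _ 0])
      ultimately show ?thesis unfolding s1
        by (intro tendsto_le[OF trivial_limit_at_left_real]) auto
    qed
  qed
  then show ?thesis by (simp add: D_def)
qed

section \<open>Differences of L-functionals as integrals\<close>

text \<open>  Fubini applied to \<open>x = \<integral> (1[0 \<le> t] - 1[x \<le> t]) dt\<close>, whose integrand has absolute integral
  \<open>\<bar>x\<bar>\<close>.\<close>
lemma (in finite_borel_measure) first_moment_layer_cake: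
  assumes int: "integrable M (\<lambda>x. x)"
  defines "h \<equiv> (\<lambda>t. measure M (space M) * indicator {0..} t - cdf M t)"
  shows "integrable lborel h" and "(\<integral>x. x \<partial>M) = (\<integral>t. h t \<partial>lborel)"
proof -
  have [measurable_cong]: "sets M = sets borel" by (rule M_is_borel)
  interpret pair_sigma_finite M lborel ..
  define f where "f = (\<lambda>(x::real, t::real). (indicator {0..} t - (if x \<le> t then 1 else 0) :: real))"
  have [measurable]: "f \<in> borel_measurable (M \<Otimes>\<^sub>M lborel)" unfolding f_def by measurable
  have fx: "has_bochner_integral lborel (\<lambda>t. f (x, t)) x" "(\<integral>\<^sup>+ t. norm (f (x, t)) \<partial>lborel) = \<bar>x\<bar>" for x
  proof -
    have *: "f (x, t) = indicator {0..<x} t - indicator {x..<0} t" for t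
      by (auto simp: f_def indicator_def)
    have "has_bochner_integral lborel (\<lambda>t. indicator {0..<x} t - indicator {x..<0} t :: real)
        (measure lborel {0..<x} - measure lborel {x..<0})"
      by (intro has_bochner_integral_diff has_bochner_integral_real_indicator) (cases "0 \<le> x"; simp)+
    moreover have "measure lborel {0..<x} - measure lborel {x..<0} = x"
      by (cases "0 \<le> x") (auto simp: measure_def)
    ultimately show "has_bochner_integral lborel (\<lambda>t. f (x, t)) x" unfolding * by simp
    have "ennreal (norm (f (x, t))) = indicator {min 0 x..<max 0 x} t" for t
      by (auto simp: f_def indicator_def)
    then show "(\<integral>\<^sup>+ t. norm (f (x, t)) \<partial>lborel) = \<bar>x\<bar>" by (simp add: max_def min_def)
  qed
  have intf: "integrable (M \<Otimes>\<^sub>M lborel) f"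
  proof (rule integrableI_bounded)
    have "(\<integral>\<^sup>+ z. norm (f z) \<partial>(M \<Otimes>\<^sub>M lborel)) = (\<integral>\<^sup>+ x. (\<integral>\<^sup>+ t. norm (f (x, t)) \<partial>lborel) \<partial>M)"
      by (subst lborel.nn_integral_fst[symmetric]) auto
    also have "\<dots> = (\<integral>\<^sup>+ x. norm x \<partial>M)" using fx(2) by simp
    also have "\<dots> < \<infinity>" using int by (simp add: integrable_iff_bounded)
    finally show "(\<integral>\<^sup>+ z. norm (f z) \<partial>(M \<Otimes>\<^sub>M lborel)) < \<infinity>" .
  qed simp
  have ft: "(\<integral>x. f (x, t) \<partial>M) = h t" for t
  proof -
    have "(\<integral>x. f (x, t) \<partial>M) = (\<integral>x. indicator {0..} t - indicator {..t} x \<partial>M)"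
      by (intro Bochner_Integration.integral_cong) (auto simp: f_def indicator_def)
    also have "\<dots> = h t"
      by (subst Bochner_Integration.integral_diff) (auto simp: h_def cdf_def emeasure_eq_measure)
    finally show ?thesis .
  qed
  show "integrable lborel h"
    using integrable_snd[of "\<lambda>x t. f (x, t)"] intf by (simp add: ft)
  have "(\<integral>t. h t \<partial>lborel) = (\<integral>t. (\<integral>x. f (x, t) \<partial>M) \<partial>lborel)" by (simp add: ft)
  also have "\<dots> = (\<integral>x. (\<integral>t. f (x, t) \<partial>lborel) \<partial>M)"
    using Fubini_integral[of "\<lambda>x t. f (x, t)"] intf by simp
  also have "\<dots> = (\<integral>x. x \<partial>M)" using has_bochner_integral_integral_eq[OF fx(1)] by simp
  finally show "(\<integral>x. x \<partial>M) = (\<integral>t. h t \<partial>lborel)" by simp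
qed

lemma first_moment_diff_le:
  assumes "finite_borel_measure P" "finite_borel_measure Q"
    and mass: "measure P (space P) = measure Q (space Q)"
    and int: "integrable P (\<lambda>x. x)" "integrable Q (\<lambda>x. x)"
  shows "ennreal \<bar>(\<integral>x. x \<partial>P) - (\<integral>x. x \<partial>Q)\<bar> \<le> (\<integral>\<^sup>+ t. ennreal \<bar>cdf P t - cdf Q t\<bar> \<partial>lborel)"
proof -
  note P = finite_borel_measure.first_moment_layer_cake[OF assms(1) int(1)]
  note Q = finite_borel_measure.first_moment_layer_cake[OF assms(2) int(2)]
  have "(\<integral>x. x \<partial>P) - (\<integral>x. x \<partial>Q) = (\<integral>t. cdf Q t - cdf P t \<partial>lborel)"
    unfolding P(2) Q(2) by (subst Bochner_Integration.integral_diff[OF P(1) Q(1), symmetric]) (simp add: mass)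
  also have "ennreal \<bar>\<dots>\<bar> \<le> (\<integral>\<^sup>+ t. norm (cdf Q t - cdf P t) \<partial>lborel)"
    using integral_norm_bound_ennreal[of lborel "\<lambda>t. cdf Q t - cdf P t"]
      Bochner_Integration.integrable_diff[OF P(1) Q(1)] mass by simp
  finally show ?thesis by (simp add: abs_minus_commute)
qed

text \<open>  The value \<open>f x = g\<close> is allowed, so a composition rule for punctured neighbourhoods does not
  apply; distribution functions are constant on intervals.\<close>
lemma tendsto_compose_right_continuous:
  fixes K :: "real \<Rightarrow> real" and f :: "'b \<Rightarrow> real"
  assumes K: "continuous (at_right g) K" and f: "(f \<longlongrightarrow> g) Fl" and ge: "\<forall>\<^sub>F x in Fl. g \<le> f x"
  shows "((\<lambda>x. K (f x)) \<longlongrightarrow> K g) Fl"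
proof (rule tendstoI)
  fix e :: real assume e: "0 < e"
  have "(K \<longlongrightarrow> K g) (at_right g)" using K by (simp add: continuous_within)
  from tendstoD[OF this e] obtain b where b: "g < b" "\<And>y. g < y \<Longrightarrow> y < b \<Longrightarrow> dist (K y) (K g) < e"
    by (auto simp: eventually_at_right_field)
  show "\<forall>\<^sub>F x in Fl. dist (K (f x)) (K g) < e"
    using order_tendstoD(2)[OF f b(1)] ge
  proof eventually_elim
    case (elim x)
    then show ?case using b(2)[of "f x"] e by (cases "f x = g") auto
  qed
qed

lemma tendsto_compose_left_continuous:
  fixes K :: "real \<Rightarrow> real" and f :: "'b \<Rightarrow> real"
  assumes K: "continuous (at_left g) K" and f: "(f \<longlongrightarrow> g) Fl" and le: "\<forall>\<^sub>F x in Fl. f x \<le> g"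
  shows "((\<lambda>x. K (f x)) \<longlongrightarrow> K g) Fl"
proof (rule tendstoI)
  fix e :: real assume e: "0 < e"
  have "(K \<longlongrightarrow> K g) (at_left g)" using K by (simp add: continuous_within)
  from tendstoD[OF this e] obtain b where b: "b < g" "\<And>y. b < y \<Longrightarrow> y < g \<Longrightarrow> dist (K y) (K g) < e"
    by (auto simp: eventually_at_left_field)
  show "\<forall>\<^sub>F x in Fl. dist (K (f x)) (K g) < e"
    using order_tendstoD(1)[OF f b(1)] le
  proof eventually_elim
    case (elim x)
    then show ?case using b(2)[of "f x"] e by (cases "f x = g") auto
  qed
qed

lemma
  assumes "real_distribution \<kappa>" and "measure \<kappa> {0..1} = 1" and "measure \<kappa> {1} = 0"
  shows cdf_at_1_of_unit_interval: "cdf \<kappa> 1 = 1"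
    and continuous_at_left_1_of_no_atom: "continuous (at_left 1) (cdf \<kappa>)"
proof -
  interpret \<kappa>: real_distribution \<kappa> by fact
  have "measure \<kappa> {0..1} \<le> measure \<kappa> {..1}" by (intro \<kappa>.finite_measure_mono) auto
  then show "cdf \<kappa> 1 = 1" using assms(2) \<kappa>.cdf_bounded_prob[of 1] unfolding cdf_def by linarith
  show "continuous (at_left 1) (cdf \<kappa>)"
    using assms(3) \<kappa>.isCont_cdf[of 1] by (simp add: continuous_at_imp_continuous_at_within)
qed

text \<open>  \<open>K \<circ> G\<close> decreases to \<open>K 0\<close>, which is positive if \<open>\<kappa>\<close> has an atom at 0. Since
  \<open>interval_measure\<close> depends on increments only, \<open>K \<circ> G\<close> can be lowered by \<open>K 0\<close>. The absence of an
  atom at 1 ensures that no mass escapes to infinity when \<open>G\<close> stays below 1, so that all these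
  measures have the same mass.\<close>
lemma
  fixes \<kappa> D :: "real measure"
  assumes kap: "real_distribution \<kappa>" and one: "measure \<kappa> {0..1} = 1" and K: "K = cdf \<kappa>"
    and atom: "measure \<kappa> {1} = 0" and D: "real_distribution D" and G: "G = cdf D"
  shows finite_borel_measure_kernel_cdf: "finite_borel_measure (interval_measure (\<lambda>x. K (G x)))"
    and measure_kernel_cdf_UNIV: "measure (interval_measure (\<lambda>x. K (G x))) UNIV = 1 - K 0"
    and cdf_kernel_cdf: "cdf (interval_measure (\<lambda>x. K (G x))) x = K (G x) - K 0"
proof -
  interpret \<kappa>: real_distribution \<kappa> by fact
  interpret D: real_distribution D by fact
  have K1: "K 1 = 1" unfolding K by (rule cdf_at_1_of_unit_interval[OF kap one atom])
  have Kr: "continuous (at_right x) K" for x unfolding K by (rule \<kappa>.cdf_is_right_cont)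
  have Kl: "continuous (at_left 1) K"
    unfolding K by (rule continuous_at_left_1_of_no_atom[OF kap one atom])
  have Km: "K x \<le> K y" if "x \<le> y" for x y unfolding K using that by (rule \<kappa>.cdf_nondecreasing)
  have Gm: "G x \<le> G y" if "x \<le> y" for x y unfolding G using that by (rule D.cdf_nondecreasing)
  define H where "H = (\<lambda>x. K (G x) - K 0)"
  have eq: "interval_measure (\<lambda>x. K (G x)) = interval_measure H"
    by (simp add: interval_measure_def H_def)
  have mono: "\<And>x y. x \<le> y \<Longrightarrow> H x \<le> H y" unfolding H_def by (intro diff_right_mono Km Gm)
  have rc: "\<And>a. continuous (at_right a) H"
  proof -
    fix a
    have "(G \<longlongrightarrow> G a) (at_right a)" using D.cdf_is_right_cont[of a] by (simp add: G continuous_within)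
    moreover have "\<forall>\<^sub>F x in at_right a. G a \<le> G x"
      using eventually_at_right_less by eventually_elim (intro Gm, simp)
    ultimately have "((\<lambda>x. K (G x)) \<longlongrightarrow> K (G a)) (at_right a)"
      by (rule tendsto_compose_right_continuous[OF Kr])
    then show "continuous (at_right a) H" unfolding H_def continuous_within by (intro tendsto_intros)
  qed
  have "((\<lambda>x. K (G x)) \<longlongrightarrow> K 0) at_bot"
    using D.cdf_lim_at_bot D.cdf_nonneg by (intro tendsto_compose_right_continuous[OF Kr]) (auto simp: G)
  then have "(H \<longlongrightarrow> K 0 - K 0) at_bot" unfolding H_def by (intro tendsto_intros)
  then have bot: "(H \<longlongrightarrow> 0) at_bot" by simp
  have "((\<lambda>x. K (G x)) \<longlongrightarrow> K 1) at_top"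
    using D.cdf_lim_at_top_prob D.cdf_bounded_prob by (intro tendsto_compose_left_continuous[OF Kl]) (auto simp: G)
  then have top: "(H \<longlongrightarrow> 1 - K 0) at_top" unfolding H_def K1 by (intro tendsto_intros)
  have m: "0 \<le> 1 - K 0" using Km[of 0 1] K1 by simp
  show "finite_borel_measure (interval_measure (\<lambda>x. K (G x)))"
    unfolding eq by (rule finite_borel_measure_interval_measure[OF mono rc bot top m])
  show "measure (interval_measure (\<lambda>x. K (G x))) UNIV = 1 - K 0"
    using interval_measure_UNIV[OF mono rc bot top m] m by (simp add: eq measure_def)
  show "cdf (interval_measure (\<lambda>x. K (G x))) x = K (G x) - K 0"
    unfolding eq using cdf_interval_measure[OF mono rc bot] by (simp add: H_def)
qed

lemma emp_cdf_is_cdf: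
  assumes n: "1 \<le> n"
  shows "\<exists>D. real_distribution D \<and> emp_cdf X n \<omega> = cdf D"
proof (intro exI conjI)
  let ?p = "measure_pmf (pmf_of_set {1..n})"
  let ?D = "distr ?p borel (\<lambda>i. X i \<omega>)"
  show "real_distribution ?D" by (rule prob_space.real_distribution_distr[OF measure_pmf.prob_space_axioms]) simp
  show "emp_cdf X n \<omega> = cdf ?D"
  proof
    fix x
    have "cdf ?D x = measure ?p {i. X i \<omega> \<le> x}"
      unfolding cdf_def by (subst measure_distr) (auto intro!: arg_cong[where f="measure _"])
    also have "\<dots> = card ({1..n} \<inter> {i. X i \<omega> \<le> x}) / real n"
      using n by (subst measure_pmf_of_set) auto
    also have "real (card ({1..n} \<inter> {i. X i \<omega> \<le> x})) = (\<Sum>i=1..n. indicator {X i \<omega>..} x)"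
    proof -
      have "real (card ({1..n} \<inter> {i. X i \<omega> \<le> x})) = (\<Sum>i\<in>{1..n} \<inter> {i. X i \<omega> \<le> x}. 1)" by simp
      also have "\<dots> = (\<Sum>i=1..n. if i \<in> {i. X i \<omega> \<le> x} then 1 else 0)" by (rule sum.inter_restrict) simp
      also have "\<dots> = (\<Sum>i=1..n. indicator {X i \<omega>..} x)" by (intro sum.cong) (auto simp: indicator_def)
      finally show ?thesis .
    qed
    finally show "emp_cdf X n \<omega> x = cdf ?D x" by (simp add: emp_cdf_def)
  qed
qed

text \<open>  The measure that belongs to the empirical distribution function lives on a bounded interval
  containing the observations, so it has a first moment.\<close>
lemma L_functional_diff_le:
  fixes \<kappa> :: "real measure"
  assumes kap: "real_distribution \<kappa>" and one: "measure \<kappa> {0..1} = 1" and K: "K = cdf \<kappa>"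
    and atom: "measure \<kappa> {1} = 0" and F: "F \<in> L_class K" and n: "1 \<le> n"
  shows "ennreal \<bar>L_functional K (emp_cdf X n \<omega>) - L_functional K F\<bar>
    \<le> (\<integral>\<^sup>+ x. ennreal \<bar>K (emp_cdf X n \<omega> x) - K (F x)\<bar> \<partial>lborel)"
proof -
  obtain D where D: "real_distribution D" "F = cdf D" using F by (auto simp: L_class_def)
  obtain E where E: "real_distribution E" "emp_cdf X n \<omega> = cdf E" using emp_cdf_is_cdf[OF n, of X \<omega>] by blast
  define \<mu> where "\<mu> = interval_measure (\<lambda>x. K (F x))"
  define \<nu> where "\<nu> = interval_measure (\<lambda>x. K (emp_cdf X n \<omega> x))"
  note k\<mu> = finite_borel_measure_kernel_cdf[OF kap one K atom D] measure_kernel_cdf_UNIV[OF kap one K atom D]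
    cdf_kernel_cdf[OF kap one K atom D]
  note k\<nu> = finite_borel_measure_kernel_cdf[OF kap one K atom E] measure_kernel_cdf_UNIV[OF kap one K atom E]
    cdf_kernel_cdf[OF kap one K atom E]
  interpret \<mu>: finite_borel_measure \<mu> unfolding \<mu>_def by (rule k\<mu>)
  interpret \<nu>: finite_borel_measure \<nu> unfolding \<nu>_def by (rule k\<nu>)
  have "integrable \<mu> (\<lambda>x. \<bar>x\<bar>)" using F by (simp add: L_class_def \<mu>_def)
  then have int\<mu>: "integrable \<mu> (\<lambda>x. x)" by (rule Bochner_Integration.integrable_bound) (auto simp: \<mu>_def)
  define B where "B = 1 + (\<Sum>i=1..n. \<bar>X i \<omega>\<bar>)"
  have XB: "\<bar>X i \<omega>\<bar> < B" if "i \<in> {1..n}" for i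
    using member_le_sum[of i "{1..n}" "\<lambda>i. \<bar>X i \<omega>\<bar>"] that by (simp add: B_def)
  have lo: "emp_cdf X n \<omega> (- B) = 0"
  proof -
    have "(\<Sum>i=1..n. indicator {X i \<omega>..} (- B) :: real) = 0"
    proof (intro sum.neutral ballI)
      fix i assume "i \<in> {1..n}"
      then show "indicator {X i \<omega>..} (- B) = (0::real)" using XB[of i] by (auto simp: abs_less_iff)
    qed
    then show ?thesis by (simp add: emp_cdf_def)
  qed
  have hi: "emp_cdf X n \<omega> B = 1"
  proof -
    have "(\<Sum>i=1..n. indicator {X i \<omega>..} B :: real) = (\<Sum>i=1..n. 1)"
    proof (intro sum.cong refl)
      fix i assume "i \<in> {1..n}"
      then show "indicator {X i \<omega>..} B = (1::real)" using XB[of i] by (auto simp: abs_less_iff)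
    qed
    then show ?thesis using n by (simp add: emp_cdf_def)
  qed
  have K1: "K 1 = 1" unfolding K by (rule cdf_at_1_of_unit_interval[OF kap one atom])
  have int\<nu>: "integrable \<nu> (\<lambda>x. x)"
  proof (rule \<nu>.integrable_const_bound[where B=B])
    have m1: "measure \<nu> {..- B} = 0" using k\<nu>(3)[of "- B"] lo by (simp add: \<nu>_def cdf_def)
    have m2: "measure \<nu> {..B} = measure \<nu> UNIV" using k\<nu>(3)[of B] k\<nu>(2) hi K1 by (simp add: \<nu>_def cdf_def)
    have "measure \<nu> (UNIV - {..B}) = 0"
      using \<nu>.finite_measure_compl[of "{..B}"] m2 by (simp add: \<nu>_def)
    moreover have "UNIV - {..B} = {B<..}" by auto
    ultimately have m3: "measure \<nu> {B<..} = 0" by simp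
    have "{..- B} \<in> null_sets \<nu>" "{B<..} \<in> null_sets \<nu>"
    proof -
      have "emeasure \<nu> {..- B} = 0" "emeasure \<nu> {B<..} = 0" using m1 m3 by (simp_all add: \<nu>.emeasure_eq_measure)
      then show "{..- B} \<in> null_sets \<nu>" "{B<..} \<in> null_sets \<nu>" by (auto simp: null_sets_def \<nu>_def)
    qed
    from this[THEN AE_not_in] have "AE x in \<nu>. x \<notin> {..- B}" "AE x in \<nu>. x \<notin> {B<..}" .
    then show "AE x in \<nu>. norm x \<le> B" by eventually_elim (auto simp: abs_le_iff)
  qed (simp add: \<nu>_def)
  have "ennreal \<bar>(\<integral>x. x \<partial>\<nu>) - (\<integral>x. x \<partial>\<mu>)\<bar> \<le> (\<integral>\<^sup>+ t. ennreal \<bar>cdf \<nu> t - cdf \<mu> t\<bar> \<partial>lborel)"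
    by (intro first_moment_diff_le k\<mu>(1)[folded \<mu>_def] k\<nu>(1)[folded \<nu>_def] int\<mu> int\<nu>)
      (simp add: \<mu>_def \<nu>_def k\<mu>(2) k\<nu>(2))
  then show ?thesis
    unfolding \<mu>_def \<nu>_def k\<mu>(3) k\<nu>(3) by (simp add: L_functional_def)
qed

section \<open>Random variables and their distribution functions\<close>

text \<open>  Borel-Cantelli for each of the levels \<open>1 / (m + 1)\<close>.\<close>
lemma AE_tendsto_0_of_summable_tails:
  fixes Y :: "nat \<Rightarrow> 'a \<Rightarrow> real"
  assumes fin: "finite_measure M" and [measurable]: "\<And>n. Y n \<in> borel_measurable M"
    and sum: "\<And>e. 0 < e \<Longrightarrow> summable (\<lambda>n. measure M {\<omega> \<in> space M. e \<le> \<bar>Y n \<omega>\<bar>})"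
  shows "AE \<omega> in M. (\<lambda>n. Y n \<omega>) \<longlonglongrightarrow> 0"
proof -
  interpret finite_measure M by fact
  have "AE \<omega> in M. \<forall>m::nat. eventually (\<lambda>n. \<omega> \<in> space M - {\<omega> \<in> space M. 1 / Suc m \<le> \<bar>Y n \<omega>\<bar>}) sequentially"
    unfolding AE_all_countable
    by (intro allI borel_cantelli_AE1 sum) (auto simp: emeasure_eq_measure)
  then show ?thesis
  proof (rule AE_mp, intro AE_I2 impI)
    fix \<omega> assume \<omega>: "\<omega> \<in> space M"
      and ev: "\<forall>m::nat. eventually (\<lambda>n. \<omega> \<in> space M - {\<omega> \<in> space M. 1 / Suc m \<le> \<bar>Y n \<omega>\<bar>}) sequentially"
    show "(\<lambda>n. Y n \<omega>) \<longlonglongrightarrow> 0"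
    proof (rule tendstoI)
      fix e :: real assume "0 < e"
      then obtain m where m: "1 / Suc m < e" using nat_approx_posE by metis
      show "\<forall>\<^sub>F n in sequentially. dist (Y n \<omega>) 0 < e"
        using ev[rule_format, of m] by eventually_elim (use m \<omega> in auto)
    qed
  qed
qed

lemma AE_tendsto_0_of_summable_expectations:
  fixes Y :: "nat \<Rightarrow> 'a \<Rightarrow> ennreal"
  assumes [measurable]: "\<And>n. Y n \<in> borel_measurable M"
    and fin: "(\<Sum>n. \<integral>\<^sup>+ \<omega>. Y n \<omega> \<partial>M) < \<infinity>"
  shows "AE \<omega> in M. (\<lambda>n. Y n \<omega>) \<longlonglongrightarrow> 0"
proof -
  have "(\<integral>\<^sup>+ \<omega>. (\<Sum>n. Y n \<omega>) \<partial>M) < \<infinity>" using fin by (subst nn_integral_suminf) auto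
  then have "AE \<omega> in M. (\<Sum>n. Y n \<omega>) \<noteq> \<infinity>" by (intro nn_integral_PInf_AE) auto
  then show ?thesis
  proof (rule AE_mp, intro AE_I2 impI)
    fix \<omega> assume s: "(\<Sum>n. Y n \<omega>) \<noteq> \<infinity>"
    then have ne: "Y n \<omega> < \<top>" for n
      using ennreal_suminf_lessD[of "\<lambda>n. Y n \<omega>" \<top> n] by (simp add: less_top)
    then have eq: "ennreal (enn2real (Y n \<omega>)) = Y n \<omega>" for n by simp
    have "summable (\<lambda>n. enn2real (Y n \<omega>))"
      using s by (intro summable_suminf_not_top) (simp_all add: eq)
    then have "(\<lambda>n. ennreal (enn2real (Y n \<omega>))) \<longlonglongrightarrow> ennreal 0"
      by (intro tendsto_ennrealI summable_LIMSEQ_zero)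
    then show "(\<lambda>n. Y n \<omega>) \<longlonglongrightarrow> 0" by (simp add: eq)
  qed
qed

text \<open>  The set is an interval \<open>{..s}\<close> or \<open>{..<s}\<close>. Its measure is \<open>cdf M s\<close> in the first case and the
  left limit of \<open>cdf M\<close> at \<open>s\<close> in the second.\<close>
lemma (in real_distribution) measure_cdf_le:
  assumes u: "0 \<le> u"
  shows "measure M {x. cdf M x \<le> u} \<le> u"
proof (cases "{x. cdf M x \<le> u} = {}")
  case True
  then show ?thesis using u by simp
next
  case ne: False
  show ?thesis
  proof (cases "u < 1")
    case False
    then show ?thesis using prob_le_1[of "{x. cdf M x \<le> u}"] by linarith
  next
    case True
    let ?S = "{x. cdf M x \<le> u}"
    have "\<forall>\<^sub>F x in at_top. u < cdf M x"
      using cdf_lim_at_top_prob True by (rule order_tendstoD)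
    then obtain b where b: "u < cdf M b" by (auto simp: eventually_at_top_linorder)
    have bdd: "bdd_above ?S"
    proof (rule bdd_aboveI[of _ b])
      fix x assume "x \<in> ?S"
      then show "x \<le> b" using b cdf_nondecreasing[of b x] by (cases "x \<le> b") auto
    qed
    define s where "s = Sup ?S"
    have below: "x \<in> ?S" if x: "x < s" for x
    proof -
      obtain y where "y \<in> ?S" "x < y" using x less_cSup_iff[OF ne bdd, of x] unfolding s_def by blast
      then show ?thesis using cdf_nondecreasing[of x y] by auto
    qed
    have le: "x \<le> s" if "x \<in> ?S" for x using that bdd unfolding s_def by (rule cSup_upper)
    show ?thesis
    proof (cases "s \<in> ?S")
      case True
      have eq: "?S = {..s}"
      proof (intro set_eqI iffI)
        fix x assume "x \<in> {..s}"
        then show "x \<in> ?S" using True cdf_nondecreasing[of x s] by auto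
      qed (use le in auto)
      have "measure M {..s} \<le> u" using True by (simp add: cdf_def)
      then show ?thesis by (simp only: eq)
    next
      case False
      have eq: "?S = {..<s}"
      proof (intro set_eqI iffI)
        fix x assume "x \<in> ?S"
        then show "x \<in> {..<s}" using le[of x] False by (cases "x = s") auto
      qed (use below in auto)
      have "(cdf M \<longlongrightarrow> measure M {..<s}) (at_left s)" by (rule cdf_at_left)
      moreover have "\<forall>\<^sub>F x in at_left s. cdf M x \<le> u"
        using below by (auto simp: eventually_at_left_field intro!: exI[of _ "s - 1"])
      ultimately show ?thesis unfolding eq by (intro tendsto_upperbound) auto
    qed
  qed
qed

lemma (in prob_space)
  assumes [measurable]: "Z \<in> borel_measurable M" and cdf: "cdf (distr M borel Z) = F"
  shows prob_cdf_le: "0 \<le> u \<Longrightarrow> prob {\<omega> \<in> space M. F (Z \<omega>) \<le> u} \<le> u"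
    and AE_cdf_pos: "AE \<omega> in M. 0 < F (Z \<omega>)"
    and prob_le_eq_cdf: "prob {\<omega> \<in> space M. Z \<omega> \<le> x} = F x"
    and borel_measurable_cdf_of: "F \<in> borel_measurable borel"
    and cdf_of_bounds: "0 \<le> F x" "F x \<le> 1" "mono F"
proof -
  interpret D: real_distribution "distr M borel Z" by simp
  show mono: "mono F" unfolding cdf[symmetric] by (auto simp: mono_def intro!: D.cdf_nondecreasing)
  then show F[measurable]: "F \<in> borel_measurable borel" by (rule borel_measurable_mono)
  show "0 \<le> F x" "F x \<le> 1" unfolding cdf[symmetric]
    by (auto simp: D.cdf_nonneg D.cdf_bounded_prob)
  show le: "prob {\<omega> \<in> space M. F (Z \<omega>) \<le> u} \<le> u" if "0 \<le> u" for u
    using D.measure_cdf_le[OF that] unfolding cdf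
    by (subst (asm) measure_distr) (auto simp: vimage_def Int_def conj_commute)
  have "prob {\<omega> \<in> space M. F (Z \<omega>) \<le> 0} = 0" using le[of 0] by (simp add: antisym)
  then have "AE \<omega> in M. \<not> F (Z \<omega>) \<le> 0" by (subst (asm) prob_Collect_eq_0) auto
  then show "AE \<omega> in M. 0 < F (Z \<omega>)" by eventually_elim auto
  show "prob {\<omega> \<in> space M. Z \<omega> \<le> x} = F x" unfolding cdf[symmetric] cdf_def
    by (subst measure_distr) (auto simp: vimage_def Int_def conj_commute)
qed

section \<open>Weighted rates for independent observations\<close>

lemma exp_le_quadratic:
  fixes u :: real
  assumes "\<bar>u\<bar> \<le> 1"
  shows "exp u \<le> 1 + u + u\<^sup>2"
proof (cases "0 \<le> u")
  case True
  then show ?thesis using assms exp_bound[of u] by simp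
next
  case False
  define v where "v = - u"
  have v: "0 < v" "v \<le> 1" using False assms by (auto simp: v_def)
  have "1 \<le> 1 + v ^ 3" using v by simp
  also have "1 + v ^ 3 = (1 - v + v\<^sup>2) * (1 + v)" by (simp add: algebra_simps power2_eq_square power3_eq_cube)
  also have "\<dots> \<le> (1 - v + v\<^sup>2) * exp v"
    using v by (intro mult_left_mono exp_ge_add_one_self) (auto simp: add_increasing2)
  finally have "1 / exp v \<le> 1 - v + v\<^sup>2" by (simp add: pos_divide_le_eq)
  moreover have "exp u = 1 / exp v" by (simp add: v_def exp_minus field_simps)
  ultimately show ?thesis by (simp add: v_def)
qed

text \<open>  A bound in terms of the probability of the event, in contrast to the inequality of Hoeffding; in
  the tails of \<open>F\<close> this makes the deviations proportional to \<open>F\<close>.\<close>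
lemma (in prob_space) mgf_centred_indicator_le:
  assumes [measurable]: "A \<in> events" and u: "\<bar>u\<bar> \<le> 1"
  shows "(\<integral>\<^sup>+ \<omega>. exp (u * (indicator A \<omega> - prob A)) \<partial>M) \<le> exp (prob A * u\<^sup>2)"
proof -
  let ?p = "prob A"
  have "exp (u * (indicator A \<omega> - ?p)) = exp (- u * ?p) * (1 + (exp u - 1) * indicator A \<omega>)" for \<omega>
    by (auto simp: indicator_def algebra_simps exp_add[symmetric])
  then have "(\<integral>\<^sup>+ \<omega>. exp (u * (indicator A \<omega> - ?p)) \<partial>M)
      = (\<integral>\<^sup>+ \<omega>. ennreal (exp (- u * ?p) * (1 + (exp u - 1) * indicator A \<omega>)) \<partial>M)" by simp
  also have "\<dots> = ennreal (\<integral> \<omega>. exp (- u * ?p) * (1 + (exp u - 1) * indicator A \<omega>) \<partial>M)"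
  proof (rule nn_integral_eq_integral)
    show "integrable M (\<lambda>\<omega>. exp (- u * ?p) * (1 + (exp u - 1) * indicator A \<omega>))"
      by (intro integrable_mult_right Bochner_Integration.integrable_add integrable_const
          integrable_real_indicator) (auto simp: emeasure_eq_measure)
  qed (auto simp: indicator_def)
  also have "(\<integral> \<omega>. exp (- u * ?p) * (1 + (exp u - 1) * indicator A \<omega>) \<partial>M) = exp (- u * ?p) * (1 + (exp u - 1) * ?p)"
  proof -
    have "(\<integral> \<omega>. 1 + (exp u - 1) * indicator A \<omega> \<partial>M) = (\<integral> \<omega>. 1 \<partial>M) + (\<integral> \<omega>. (exp u - 1) * indicator A \<omega> \<partial>M)"
      by (intro Bochner_Integration.integral_add integrable_mult_right integrable_const
          integrable_real_indicator) (auto simp: emeasure_eq_measure)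
    then show ?thesis by (simp add: prob_space)
  qed
  also have "\<dots> \<le> exp (- u * ?p) * exp ((exp u - 1) * ?p)"
    by (intro mult_left_mono exp_ge_add_one_self) auto
  also have "\<dots> = exp (?p * (exp u - 1 - u))" by (simp add: exp_add[symmetric] algebra_simps)
  also have "\<dots> \<le> exp (?p * u\<^sup>2)"
    using exp_le_quadratic[OF u] by (auto intro!: mult_left_mono)
  finally show ?thesis by (simp add: ennreal_leI)
qed

lemma (in prob_space) mgf_empirical_count_le:
  fixes X :: "nat \<Rightarrow> 'a \<Rightarrow> real"
  assumes indep: "indep_vars (\<lambda>_. borel) X {1..}"
    and cdf: "\<And>i. 1 \<le> i \<Longrightarrow> cdf (distr M borel (X i)) = F"
    and u: "\<bar>u\<bar> \<le> 1" and n: "1 \<le> n"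
  shows "(\<integral>\<^sup>+ \<omega>. exp (u * real n * (emp_cdf X n \<omega> x - F x)) \<partial>M) \<le> exp (real n * F x * u\<^sup>2)"
proof -
  have X[measurable]: "\<And>i. 1 \<le> i \<Longrightarrow> X i \<in> borel_measurable M"
    using indep by (auto simp: indep_vars_def)
  define Y where "Y = (\<lambda>(i::nat) y::real. exp (u * (indicator {y..} x - F x)))"
  have Yeq: "Y i y = exp (u * (indicator {..x} y - F x))" for i y by (auto simp: Y_def indicator_def)
  have "real n * (emp_cdf X n \<omega> x - F x) = (\<Sum>i=1..n. indicator {X i \<omega>..} x - F x)" for \<omega>
    using n by (simp add: emp_cdf_def sum_subtractf right_diff_distrib)
  then have "exp (u * real n * (emp_cdf X n \<omega> x - F x)) = (\<Prod>i=1..n. Y i (X i \<omega>))" for \<omega>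
    unfolding Y_def by (simp add: exp_sum[symmetric] sum_distrib_left mult.assoc)
  then have "(\<integral>\<^sup>+ \<omega>. exp (u * real n * (emp_cdf X n \<omega> x - F x)) \<partial>M)
      = (\<integral>\<^sup>+ \<omega>. (\<Prod>i=1..n. ennreal (Y i (X i \<omega>))) \<partial>M)"
    by (simp add: prod_ennreal Y_def)
  also have "\<dots> = (\<Prod>i=1..n. \<integral>\<^sup>+ \<omega>. ennreal (Y i (X i \<omega>)) \<partial>M)"
  proof (rule indep_vars_nn_integral)
    have "indep_vars (\<lambda>_. borel) X {1..n}" using indep by (rule indep_vars_subset) auto
    then show "indep_vars (\<lambda>_. borel) (\<lambda>i \<omega>. ennreal (Y i (X i \<omega>))) {1..n}"
      by (rule indep_vars_compose2) (auto simp: Yeq)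
  qed auto
  also have "\<dots> \<le> (\<Prod>i=1..n. ennreal (exp (F x * u\<^sup>2)))"
  proof (rule prod_mono_ennreal)
    fix i assume i: "i \<in> {1..n}"
    let ?A = "{\<omega> \<in> space M. X i \<omega> \<le> x}"
    have A: "?A \<in> events" "prob ?A = F x" using X[of i] i cdf[of i] prob_le_eq_cdf[of "X i" F x] by auto
    have "(\<integral>\<^sup>+ \<omega>. ennreal (Y i (X i \<omega>)) \<partial>M) = (\<integral>\<^sup>+ \<omega>. exp (u * (indicator ?A \<omega> - prob ?A)) \<partial>M)"
      unfolding A(2) by (intro nn_integral_cong) (auto simp: Y_def indicator_def)
    then show "(\<integral>\<^sup>+ \<omega>. ennreal (Y i (X i \<omega>)) \<partial>M) \<le> ennreal (exp (F x * u\<^sup>2))"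
      using mgf_centred_indicator_le[OF A(1) u] by (simp add: A(2))
  qed
  also have "\<dots> = ennreal (exp (real n * F x * u\<^sup>2))"
    by (simp add: ennreal_power exp_of_nat_mult[symmetric] mult.assoc)
  finally show ?thesis .
qed

text \<open>  By Borel-Cantelli \<open>F(X\<^sub>n) > n\<^bsup>-\<tau>\<^esup>\<close> for all large \<open>n\<close>. The finitely many other values are positive
  almost surely and so exceed \<open>n\<^bsup>-\<tau>\<^esup>\<close> as soon as \<open>n\<close> is large enough.\<close>
lemma (in prob_space) AE_eventually_min_cdf_gt:
  fixes X :: "nat \<Rightarrow> 'a \<Rightarrow> real"
  assumes X[measurable]: "\<And>i. 1 \<le> i \<Longrightarrow> X i \<in> borel_measurable M"
    and cdf: "\<And>i. 1 \<le> i \<Longrightarrow> cdf (distr M borel (X i)) = F"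
    and tau: "1 < \<tau>"
  shows "AE \<omega> in M. \<forall>\<^sub>F n in sequentially. \<forall>i\<in>{1..n}. real n powr (- \<tau>) < F (X i \<omega>)"
proof -
  let ?A = "\<lambda>n. {\<omega> \<in> space M. F (X (Suc n) \<omega>) \<le> real (Suc n) powr (- \<tau>)}"
  have [measurable]: "F \<in> borel_measurable borel"
    using borel_measurable_cdf_of[OF X[of 1] cdf[of 1]] by simp
  have "AE \<omega> in M. eventually (\<lambda>n. \<omega> \<in> space M - ?A n) sequentially"
  proof (rule borel_cantelli_AE1)
    show "summable (\<lambda>n. prob (?A n))"
    proof (rule summable_comparison_test')
      show "summable (\<lambda>n. real (Suc n) powr (- \<tau>))"
        using tau by (subst summable_Suc_iff) (simp add: summable_real_powr_iff)
      show "norm (prob (?A n)) \<le> real (Suc n) powr (- \<tau>)" for n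
        using prob_cdf_le[OF X[of "Suc n"] cdf[of "Suc n"]] by simp
    qed
  qed (auto simp: emeasure_eq_measure)
  moreover have "AE \<omega> in M. \<forall>i. 0 < F (X (Suc i) \<omega>)"
    unfolding AE_all_countable using AE_cdf_pos[OF X cdf] by auto
  ultimately show ?thesis
  proof eventually_elim
    case (elim \<omega>)
    then obtain N where N: "\<And>n. N \<le> n \<Longrightarrow> \<omega> \<in> space M - ?A n"
      by (auto simp: eventually_sequentially)
    have lim: "(\<lambda>n. real n powr (- \<tau>)) \<longlonglongrightarrow> 0"
      using tau by (intro tendsto_neg_powr filterlim_real_sequentially) auto
    have "\<forall>\<^sub>F n in sequentially. \<forall>i\<in>{1..N}. real n powr (- \<tau>) < F (X i \<omega>)"
    proof (intro eventually_ball_finite ballI)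
      fix i assume "i \<in> {1..N}"
      then have "0 < F (X i \<omega>)" using elim(2)[rule_format, of "i - 1"] by simp
      then show "\<forall>\<^sub>F n in sequentially. real n powr (- \<tau>) < F (X i \<omega>)"
        using order_tendstoD(2)[OF lim] by blast
    qed simp
    then show ?case
    proof eventually_elim
      case (elim n)
      show ?case
      proof
        fix i assume i: "i \<in> {1..n}"
        show "real n powr (- \<tau>) < F (X i \<omega>)"
        proof (cases "i \<le> N")
          case False
          then obtain j where "i = Suc j" "N \<le> j" by (cases i) auto
          then have "real i powr (- \<tau>) < F (X i \<omega>)" using N[of j] by auto
          moreover have "real n powr (- \<tau>) \<le> real i powr (- \<tau>)"
            using i tau by (intro powr_mono2') auto
          ultimately show ?thesis by simp
        qed (use i elim in auto)
      qed
    qed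
  qed
qed

text \<open>  \<open>s\<close> is the argument of the moment generating function that turns \<open>n (F\<^sub>n - F)\<close> into
  \<open>n\<^bsup>r+\<rho>\<^esup> (F\<^sub>n - F) F\<^bsup>-\<gamma>\<^esup>\<close>, with \<open>p\<close> in the role of \<open>F x\<close>. The first bound makes the argument
  admissible, the second keeps the exponent \<open>n p s\<^sup>2\<close> bounded. In the second bound \<open>p\<close> has the
  exponent \<open>1 - 2 \<gamma>\<close>: for \<open>\<gamma> \<le> 1/2\<close> the restriction is \<open>\<rho> \<le> 1/2 - r\<close>, otherwise the lower bound
  on \<open>p\<close> is used and the restriction is \<open>2 \<rho> \<le> 1 - r - \<gamma>\<close>.\<close>
lemma rate_exponent_bounds:
  fixes n p r \<gamma> \<rho> :: real
  assumes n: "1 \<le> n" and p: "n powr (- (1 + \<rho>)) \<le> p" "p \<le> 1"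
    and g: "0 < \<gamma>" and rho: "0 < \<rho>" "2 * \<rho> \<le> 1 - r - \<gamma>" "\<rho> \<le> 1/2 - r" and r: "0 \<le> r"
  defines "s \<equiv> n powr (r + \<rho> - 1) * p powr (- \<gamma>)"
  shows "s \<le> 1" "n * p * s\<^sup>2 \<le> 1"
proof -
  have p0: "0 < p" using p(1) n by (smt (verit) powr_gt_zero)
  have g1: "\<gamma> < 1" using rho r by linarith
  have pw: "p powr (- c) \<le> n powr ((1 + \<rho>) * c)" if "0 \<le> c" for c
  proof -
    have "p powr (- c) \<le> (n powr (- (1 + \<rho>))) powr (- c)"
      using that p n by (intro powr_mono2') auto
    then show ?thesis by (simp add: powr_powr algebra_simps)
  qed
  have le1: "n powr c \<le> 1" if "c \<le> 0" for c using powr_mono[OF that n] n by simp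
  have "s \<le> n powr (r + \<rho> - 1) * n powr ((1 + \<rho>) * \<gamma>)"
    unfolding s_def using pw[of \<gamma>] g by (intro mult_left_mono) auto
  also have "\<dots> = n powr (r + \<rho> - 1 + (1 + \<rho>) * \<gamma>)" by (simp add: powr_add)
  also have "\<dots> \<le> 1"
  proof (rule le1)
    have "\<rho> * \<gamma> \<le> \<rho>" using rho g1 by (simp add: mult_left_le)
    moreover have "r + \<rho> - 1 + (1 + \<rho>) * \<gamma> = (r + \<gamma> - 1) + \<rho> + \<rho> * \<gamma>" by (simp add: algebra_simps)
    ultimately show "r + \<rho> - 1 + (1 + \<rho>) * \<gamma> \<le> 0" using rho by linarith
  qed
  finally show "s \<le> 1" .
  have "n * p * s\<^sup>2 = (n * n powr (2 * (r + \<rho> - 1))) * (p * p powr (- 2 * \<gamma>))"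
    using n p0 by (simp add: s_def power_mult_distrib powr_power mult_ac)
  also have "n * n powr (2 * (r + \<rho> - 1)) = n powr (1 + 2 * (r + \<rho> - 1))"
    using n by (simp add: powr_mult_base)
  also have "p * p powr (- 2 * \<gamma>) = p powr (- (2 * \<gamma> - 1))"
    using p0 by (simp add: powr_mult_base)
  finally have eq: "n * p * s\<^sup>2 = n powr (1 + 2 * (r + \<rho> - 1)) * p powr (- (2 * \<gamma> - 1))" .
  have "n powr (1 + 2 * (r + \<rho> - 1)) * p powr (- (2 * \<gamma> - 1)) \<le> 1"
  proof (cases "\<gamma> \<le> 1/2")
    case True
    have "p powr (- (2 * \<gamma> - 1)) \<le> 1" using True p p0 by (intro powr_le1) auto
    moreover have "n powr (1 + 2 * (r + \<rho> - 1)) \<le> 1" using rho by (intro le1) auto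
    ultimately show ?thesis using mult_le_one[OF _ powr_ge_zero, of "n powr (1 + 2 * (r + \<rho> - 1))" p "- (2 * \<gamma> - 1)"] by blast
  next
    case False
    have "n powr (1 + 2 * (r + \<rho> - 1)) * p powr (- (2 * \<gamma> - 1)) 
      \<le> n powr (1 + 2 * (r + \<rho> - 1)) * n powr ((1 + \<rho>) * (2 * \<gamma> - 1))"
      using pw[of "2 * \<gamma> - 1"] False by (intro mult_left_mono) auto
    also have "\<dots> = n powr (1 + 2 * (r + \<rho> - 1) + (1 + \<rho>) * (2 * \<gamma> - 1))" by (simp add: powr_add)
    also have "\<dots> \<le> 1"
    proof (rule le1)
      have "\<rho> * \<gamma> \<le> \<rho>" using rho g1 by (simp add: mult_left_le)
      moreover have "2 * (r + \<gamma> - 1) + \<rho> + 2 * c \<le> 0" if "c \<le> \<rho>" for c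
        using that rho by argo
      ultimately have "2 * (r + \<gamma> - 1) + \<rho> + 2 * (\<rho> * \<gamma>) \<le> 0" by blast
      also have "2 * (r + \<gamma> - 1) + \<rho> + 2 * (\<rho> * \<gamma>) = 1 + 2 * (r + \<rho> - 1) + (1 + \<rho>) * (2 * \<gamma> - 1)"
        by (simp add: algebra_simps)
      finally show "1 + 2 * (r + \<rho> - 1) + (1 + \<rho>) * (2 * \<gamma> - 1) \<le> 0" .
    qed
    finally show ?thesis .
  qed
  then show "n * p * s\<^sup>2 \<le> 1" unfolding eq .
qed

lemma emp_cdf_bounds: "0 \<le> emp_cdf X n \<omega> x" "emp_cdf X n \<omega> x \<le> 1"
proof -
  show "0 \<le> emp_cdf X n \<omega> x" by (auto simp: emp_cdf_def intro!: divide_nonneg_nonneg sum_nonneg)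
  have "(\<Sum>i=1..n. indicator {X i \<omega>..} x :: real) \<le> real (card {1..n}) * 1"
    by (intro sum_bounded_above) (auto simp: indicator_def)
  then show "emp_cdf X n \<omega> x \<le> 1" by (cases "n = 0") (auto simp: emp_cdf_def)
qed

lemma measurable_emp_cdf_pair:
  assumes [measurable]: "\<And>i. 1 \<le> i \<Longrightarrow> X i \<in> borel_measurable M"
    and [measurable_cong]: "sets N = sets (borel :: real measure)"
  shows "(\<lambda>(\<omega>, x). emp_cdf X n \<omega> x) \<in> borel_measurable (M \<Otimes>\<^sub>M N)"
proof -
  have "(\<lambda>(\<omega>, x). emp_cdf X n \<omega> x) = (\<lambda>z. (\<Sum>i=1..n. if X i (fst z) \<le> snd z then 1 else 0) / real n)"
    unfolding emp_cdf_def indicator_def fun_eq_iff split_beta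
    by (intro allI arg_cong2[where f = "(/)"] refl sum.cong) auto
  moreover have "\<dots> \<in> borel_measurable (M \<Otimes>\<^sub>M N)"
  proof (intro borel_measurable_divide borel_measurable_sum)
    fix i assume "i \<in> {1..n}"
    then have [measurable]: "X i \<in> borel_measurable M" by simp
    show "(\<lambda>z. if X i (fst z) \<le> snd z then 1 else 0 :: real) \<in> borel_measurable (M \<Otimes>\<^sub>M N)" by measurable
  qed simp
  ultimately show ?thesis by simp
qed

text \<open>  Where \<open>F \<ge> a\<^sub>n = n\<^bsup>-1-\<rho>\<^esup>\<close>, the inequality \<open>y \<le> t + exp (y - t)\<close> is applied to
  \<open>y = n\<^bsup>r+\<rho>\<^esup> \<bar>F\<^sub>n - F\<bar> F\<^bsup>-\<gamma>\<^esup>\<close> and \<open>t = n\<^bsup>\<rho>/2\<^esup>\<close>. The first summand contributes \<open>n\<^bsup>-\<rho>/2\<^esup>\<close> to the result. The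
  second has expectation \<open>O(exp (-n\<^bsup>\<rho>/2\<^esup>))\<close>, which is summable. Where \<open>F < a\<^sub>n\<close>, \<open>F\<^sub>n\<close> is eventually 0
  and \<open>n\<^sup>r F \<le> n\<^sup>r a\<^sub>n\<^bsup>1-\<gamma>\<^esup> F\<^sup>\<gamma>\<close> tends to 0 relative to \<open>F\<^sup>\<gamma>\<close>.\<close>
lemma (in prob_space) independent_weighted_rate:
  fixes X :: "nat \<Rightarrow> 'a \<Rightarrow> real"
  assumes indep: "indep_vars (\<lambda>_. borel) X {1..}"
    and cdf: "\<And>i. 1 \<le> i \<Longrightarrow> cdf (distr M borel (X i)) = F"
    and N: "sigma_finite_measure N" "sets N = sets borel"
    and r: "0 \<le> r" "r < 1/2" and g: "0 < \<gamma>" "\<gamma> < 1 - r"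
    and fin: "(\<integral>\<^sup>+ x. F x powr \<gamma> \<partial>N) < \<infinity>"
  shows "AE \<omega> in M. (\<lambda>n. ennreal (real n powr r) * (\<integral>\<^sup>+ x. \<bar>emp_cdf X n \<omega> x - F x\<bar> \<partial>N)) \<longlonglongrightarrow> 0"
proof -
  have X: "\<And>i. 1 \<le> i \<Longrightarrow> X i \<in> borel_measurable M"
    using indep by (auto simp: indep_vars_def)
  note X[measurable] N(2)[measurable_cong]
  interpret N: sigma_finite_measure N by fact
  interpret P: pair_sigma_finite M N ..
  note F01 = cdf_of_bounds[OF X[OF order_refl] cdf[OF order_refl]]
  have [measurable]: "F \<in> borel_measurable borel"
    using borel_measurable_cdf_of[OF X[of 1] cdf[of 1]] by simp
  define \<rho> where "\<rho> = min ((1 - r - \<gamma>) / 2) (1/2 - r)"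
  have rho: "0 < \<rho>" "2 * \<rho> \<le> 1 - r - \<gamma>" "\<rho> \<le> 1/2 - r" using r g unfolding \<rho>_def by (auto simp: min_def field_simps)
  define \<Lambda> where "\<Lambda> = (\<integral>\<^sup>+ x. F x powr \<gamma> \<partial>N)"
  define t where "t = (\<lambda>n::nat. real n powr (\<rho> / 2))"
  define a where "a = (\<lambda>n::nat. real n powr (- (1 + \<rho>)))"
  define y where "y = (\<lambda>n \<omega> x. real n powr (r + \<rho>) * \<bar>emp_cdf X n \<omega> x - F x\<bar> * F x powr (- \<gamma>))"
  define W where "W = (\<lambda>n \<omega> x. indicator {x. a n \<le> F x} x * exp (y n \<omega> x - t n))"
  define R where "R = (\<lambda>n \<omega>. \<integral>\<^sup>+ x. ennreal (F x powr \<gamma> * W n \<omega> x) \<partial>N)"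
  have [measurable]: "(\<lambda>(\<omega>, x). emp_cdf X n \<omega> x) \<in> borel_measurable (M \<Otimes>\<^sub>M N)" for n
    using X N(2) by (rule measurable_emp_cdf_pair)
  have emx[measurable]: "(\<lambda>x. emp_cdf X n \<omega> x) \<in> borel_measurable borel" for n \<omega>
    unfolding emp_cdf_def by measurable
  have emw[measurable]: "(\<lambda>\<omega>. emp_cdf X n \<omega> x) \<in> borel_measurable M" for n x
  proof -
    have [measurable]: "x \<in> space N" using sets_eq_imp_space_eq[OF N(2)] by simp
    have "(\<lambda>\<omega>. (\<lambda>(\<omega>, x). emp_cdf X n \<omega> x) (\<omega>, x)) \<in> borel_measurable M" by measurable
    then show ?thesis by simp
  qed
  have mW[measurable]: "(\<lambda>(\<omega>, x). ennreal (F x powr \<gamma> * W n \<omega> x)) \<in> borel_measurable (M \<Otimes>\<^sub>M N)" for n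
    unfolding W_def y_def by measurable
  have ER: "(\<integral>\<^sup>+ \<omega>. R n \<omega> \<partial>M) \<le> ennreal (2 * exp 1 * exp (- t n)) * \<Lambda>" if n: "1 \<le> n" for n
  proof -
    have inner: "(\<integral>\<^sup>+ \<omega>. ennreal (W n \<omega> x) \<partial>M) \<le> ennreal (2 * exp 1 * exp (- t n))" for x
    proof (cases "a n \<le> F x")
      case False
      then show ?thesis by (simp add: W_def)
    next
      case True
      define s where "s = real n powr (r + \<rho> - 1) * F x powr (- \<gamma>)"
      have s: "0 \<le> s" "s \<le> 1" "real n * F x * s\<^sup>2 \<le> 1"
        using rate_exponent_bounds[of "real n" \<rho> "F x" \<gamma> r] n True F01 rho g r by (auto simp: s_def a_def)
      have ys: "y n \<omega> x = \<bar>s * real n * (emp_cdf X n \<omega> x - F x)\<bar>" for \<omega>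
      proof -
        have "real n powr (r + \<rho> - 1) * real n = real n powr (r + \<rho>)"
          using n by (simp add: powr_mult_base[symmetric] mult.commute powr_diff)
        then show ?thesis using n by (simp add: y_def s_def abs_mult mult_ac)
      qed
      have "ennreal (W n \<omega> x) \<le> ennreal (exp (- t n)) * (ennreal (exp (s * real n * (emp_cdf X n \<omega> x - F x)))
         + ennreal (exp ((- s) * real n * (emp_cdf X n \<omega> x - F x))))" for \<omega>
      proof -
        have "W n \<omega> x = exp (- t n) * exp (y n \<omega> x)" using True by (simp add: W_def exp_diff exp_minus field_simps)
        moreover have "exp (y n \<omega> x) \<le> exp (s * real n * (emp_cdf X n \<omega> x - F x)) + exp ((- s) * real n * (emp_cdf X n \<omega> x - F x))"
          unfolding ys by (cases "0 \<le> s * real n * (emp_cdf X n \<omega> x - F x)") (auto simp: abs_if)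
        ultimately show ?thesis by (simp add: ennreal_mult[symmetric] ennreal_plus[symmetric] del: ennreal_plus)
      qed
      then have "(\<integral>\<^sup>+ \<omega>. ennreal (W n \<omega> x) \<partial>M) \<le> (\<integral>\<^sup>+ \<omega>. ennreal (exp (- t n)) * (ennreal (exp (s * real n * (emp_cdf X n \<omega> x - F x)))
         + ennreal (exp ((- s) * real n * (emp_cdf X n \<omega> x - F x)))) \<partial>M)"
        by (intro nn_integral_mono) auto
      also have "\<dots> = ennreal (exp (- t n)) * ((\<integral>\<^sup>+ \<omega>. ennreal (exp (s * real n * (emp_cdf X n \<omega> x - F x))) \<partial>M) 
         + (\<integral>\<^sup>+ \<omega>. ennreal (exp ((- s) * real n * (emp_cdf X n \<omega> x - F x))) \<partial>M))"
        by (subst nn_integral_cmult, measurable, subst nn_integral_add) auto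
      also have "\<dots> \<le> ennreal (exp (- t n)) * (ennreal (exp 1) + ennreal (exp 1))"
      proof (intro mult_left_mono add_mono)
        show "(\<integral>\<^sup>+ \<omega>. ennreal (exp (s * real n * (emp_cdf X n \<omega> x - F x))) \<partial>M) \<le> ennreal (exp 1)"
          using order_trans[OF mgf_empirical_count_le[OF indep cdf, of "s" n x], of "ennreal (exp 1)"] s n
            by (auto intro!: ennreal_leI)
        show "(\<integral>\<^sup>+ \<omega>. ennreal (exp ((- s) * real n * (emp_cdf X n \<omega> x - F x))) \<partial>M) \<le> ennreal (exp 1)"
          using order_trans[OF mgf_empirical_count_le[OF indep cdf, of "- s" n x], of "ennreal (exp 1)"] s n
            by (auto intro!: ennreal_leI)
      qed auto
      also have "\<dots> = ennreal (2 * exp 1 * exp (- t n))"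
        by (simp add: ennreal_mult[symmetric] ennreal_plus[symmetric] mult_ac del: ennreal_plus)
      finally show ?thesis .
    qed
    have "(\<integral>\<^sup>+ \<omega>. R n \<omega> \<partial>M) = (\<integral>\<^sup>+ x. (\<integral>\<^sup>+ \<omega>. ennreal (F x powr \<gamma> * W n \<omega> x) \<partial>M) \<partial>N)"
      unfolding R_def by (rule P.Fubini'[symmetric]) simp
    also have "\<dots> = (\<integral>\<^sup>+ x. ennreal (F x powr \<gamma>) * (\<integral>\<^sup>+ \<omega>. ennreal (W n \<omega> x) \<partial>M) \<partial>N)"
    proof (intro nn_integral_cong)
      fix x
      have [measurable]: "(\<lambda>\<omega>. W n \<omega> x) \<in> borel_measurable M" unfolding W_def y_def by measurable
      show "(\<integral>\<^sup>+ \<omega>. ennreal (F x powr \<gamma> * W n \<omega> x) \<partial>M) = ennreal (F x powr \<gamma>) * (\<integral>\<^sup>+ \<omega>. ennreal (W n \<omega> x) \<partial>M)"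
        by (subst nn_integral_cmult[symmetric]) (auto simp: ennreal_mult' )
    qed
    also have "\<dots> \<le> (\<integral>\<^sup>+ x. ennreal (F x powr \<gamma>) * ennreal (2 * exp 1 * exp (- t n)) \<partial>N)"
      by (intro nn_integral_mono mult_left_mono inner) auto
    also have "\<dots> = ennreal (2 * exp 1 * exp (- t n)) * \<Lambda>"
      unfolding \<Lambda>_def by (subst nn_integral_multc) (auto simp: mult.commute)
    finally show ?thesis .
  qed
  have "AE \<omega> in M. (\<lambda>n. R (Suc n) \<omega>) \<longlonglongrightarrow> 0"
  proof (rule AE_tendsto_0_of_summable_expectations)
    show "R (Suc n) \<in> borel_measurable M" for n unfolding R_def by measurable
    have sm: "summable (\<lambda>n. 2 * exp 1 * exp (- t (Suc n)))"
    proof (intro summable_mult)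
      have "(\<lambda>n. exp (- t (Suc n))) \<in> O(\<lambda>n. real n powr (-2))"
        unfolding t_def using rho(1) by real_asymp
      then show "summable (\<lambda>n. exp (- t (Suc n)))"
        by (rule summable_comparison_test_bigo[rotated]) (simp add: summable_real_powr_iff)
    qed
    have "(\<Sum>n. \<integral>\<^sup>+ \<omega>. R (Suc n) \<omega> \<partial>M) \<le> (\<Sum>n. ennreal (2 * exp 1 * exp (- t (Suc n))) * \<Lambda>)"
      by (intro suminf_le ER) auto
    also have "\<dots> = ennreal (\<Sum>n. 2 * exp 1 * exp (- t (Suc n))) * \<Lambda>"
      by (subst ennreal_suminf_multc, subst suminf_ennreal2[OF _ sm]) auto
    also have "\<dots> < \<infinity>" using fin by (simp add: \<Lambda>_def ennreal_mult_less_top)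
    finally show "(\<Sum>n. \<integral>\<^sup>+ \<omega>. R (Suc n) \<omega> \<partial>M) < \<infinity>" .
  qed
  moreover have "AE \<omega> in M. \<forall>\<^sub>F n in sequentially. \<forall>i\<in>{1..n}. a n < F (X i \<omega>)"
    unfolding a_def using rho(1) by (intro AE_eventually_min_cdf_gt X cdf) auto
  ultimately show ?thesis
  proof eventually_elim
    case (elim \<omega>)
    have R0: "(\<lambda>n. R n \<omega>) \<longlonglongrightarrow> 0" using elim(1) by (rule LIMSEQ_imp_Suc)
    define q where "q = (\<lambda>n::nat. real n powr (- (\<rho> / 2)) + real n powr (r - (1 + \<rho>) * (1 - \<gamma>)))"
    have bound: "\<forall>\<^sub>F n in sequentially. ennreal (real n powr r) * (\<integral>\<^sup>+ x. \<bar>emp_cdf X n \<omega> x - F x\<bar> \<partial>N)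
        \<le> ennreal (q n) * \<Lambda> + R n \<omega>"
      using elim(2) eventually_ge_at_top[of 1]
    proof eventually_elim
      case (elim n)
      have pt: "real n powr r * \<bar>emp_cdf X n \<omega> x - F x\<bar> \<le> q n * F x powr \<gamma> + F x powr \<gamma> * W n \<omega> x" for x
      proof (cases "a n \<le> F x")
        case True
        then have Fx: "0 < F x" using elim(2) by (smt (verit) a_def powr_gt_zero of_nat_0_less_iff less_le_trans zero_less_one)
        have n0: "0 < real n" using elim(2) by simp
        have "real n powr r * \<bar>emp_cdf X n \<omega> x - F x\<bar> = real n powr (- \<rho>) * F x powr \<gamma> * y n \<omega> x"
        proof -
          have "real n powr (- \<rho>) * real n powr (r + \<rho>) = real n powr r" "F x powr \<gamma> * F x powr (- \<gamma>) = 1"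
            using Fx by (auto simp: powr_add[symmetric])
          then show ?thesis by (simp add: y_def mult_ac)
        qed
        also have "\<dots> \<le> real n powr (- \<rho>) * F x powr \<gamma> * (t n + exp (y n \<omega> x - t n))"
          using exp_ge_add_one_self[of "y n \<omega> x - t n"] by (intro mult_left_mono) (linarith, simp)
        also have "\<dots> = real n powr (- (\<rho> / 2)) * F x powr \<gamma> + real n powr (- \<rho>) * (F x powr \<gamma> * W n \<omega> x)"
        proof -
          have "real n powr (- \<rho>) * t n = real n powr (- (\<rho> / 2))" by (simp add: t_def powr_add[symmetric])
          moreover have "W n \<omega> x = exp (y n \<omega> x - t n)" using True by (simp add: W_def)
          ultimately show ?thesis by (simp add: algebra_simps)
        qed
        also have "\<dots> \<le> q n * F x powr \<gamma> + 1 * (F x powr \<gamma> * W n \<omega> x)"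
        proof (intro add_mono mult_right_mono)
          show "real n powr (- \<rho>) \<le> 1" using powr_mono[of "- \<rho>" 0 "real n"] rho elim(2) by simp
        qed (auto simp: q_def W_def)
        finally show ?thesis by simp
      next
        case False
        then have "F x < F (X i \<omega>)" if "i \<in> {1..n}" for i using elim(1) that by force
        then have lt: "x < X i \<omega>" if "i \<in> {1..n}" for i using that monoD[OF F01(3), of "X i \<omega>" x] by (meson not_le)
        have "(\<Sum>i=1..n. indicator {X i \<omega>..} x :: real) = 0"
        proof (intro sum.neutral ballI)
          fix i assume "i \<in> {1..n}"
          then show "indicator {X i \<omega>..} x = (0 :: real)" using lt[of i] by simp
        qed
        then have e0: "emp_cdf X n \<omega> x = 0" by (simp add: emp_cdf_def)
        have "real n powr r * F x \<le> real n powr r * (F x powr \<gamma> * a n powr (1 - \<gamma>))"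
        proof (cases "F x = 0")
          case False
          then have "F x = F x powr \<gamma> * F x powr (1 - \<gamma>)" using F01(1)[of x] by (simp add: powr_add[symmetric])
          also have "\<dots> \<le> F x powr \<gamma> * a n powr (1 - \<gamma>)"
            using \<open>\<not> a n \<le> F x\<close> F01(1)[of x] g r by (intro mult_left_mono powr_mono2) auto
          finally show ?thesis by (intro mult_left_mono) auto
        qed auto
        also have "\<dots> = real n powr (r - (1 + \<rho>) * (1 - \<gamma>)) * F x powr \<gamma>"
        proof -
          have "real n powr r * a n powr (1 - \<gamma>) = real n powr (r - (1 + \<rho>) * (1 - \<gamma>))"
            by (simp add: a_def powr_powr powr_add[symmetric] algebra_simps)
          then show ?thesis by (simp add: mult_ac)
        qed
        also have "\<dots> \<le> q n * F x powr \<gamma>" by (intro mult_right_mono) (auto simp: q_def)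
        finally show ?thesis using e0 F01(1)[of x] False by (simp add: W_def)
      qed
      have "ennreal (real n powr r) * (\<integral>\<^sup>+ x. \<bar>emp_cdf X n \<omega> x - F x\<bar> \<partial>N)
        = (\<integral>\<^sup>+ x. ennreal (real n powr r * \<bar>emp_cdf X n \<omega> x - F x\<bar>) \<partial>N)"
        by (subst nn_integral_cmult[symmetric]) (auto simp: ennreal_mult')
      also have "\<dots> \<le> (\<integral>\<^sup>+ x. ennreal (q n) * ennreal (F x powr \<gamma>) + ennreal (F x powr \<gamma> * W n \<omega> x) \<partial>N)"
        using pt by (intro nn_integral_mono)
          (auto simp: ennreal_mult[symmetric] ennreal_plus[symmetric] q_def W_def simp del: ennreal_plus)
      also have "\<dots> = ennreal (q n) * \<Lambda> + R n \<omega>"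
        unfolding R_def \<Lambda>_def
        by (subst nn_integral_add, simp, simp add: W_def y_def, subst nn_integral_cmult) auto
      finally show ?case .
    qed
    have "(1 + \<rho>) * (1 - \<gamma>) > 1 - \<gamma>" using rho(1) g r by simp
    then have "q \<longlonglongrightarrow> 0 + 0" unfolding q_def
      using rho(1) g by (intro tendsto_add tendsto_neg_powr filterlim_real_sequentially) auto
    then have "(\<lambda>n. ennreal (q n) * \<Lambda> + R n \<omega>) \<longlonglongrightarrow> ennreal 0 * \<Lambda> + 0"
      using fin by (intro tendsto_add R0 tendsto_mult_ennreal tendsto_ennrealI tendsto_const) (auto simp: \<Lambda>_def)
    then show ?case
      using bound by (intro tendsto_sandwich[OF _ bound tendsto_const]) auto
  qed
qed

section \<open>Deviations of weakly dependent sums\<close>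

lemma (in prob_space) expectation_mult_layer_cake:
  fixes Z V :: "'a \<Rightarrow> real"
  assumes [measurable]: "Z \<in> borel_measurable M" "V \<in> borel_measurable M"
    and Z: "\<And>\<omega>. \<bar>Z \<omega>\<bar> \<le> B" and V: "\<And>\<omega>. 0 \<le> V \<omega>" "\<And>\<omega>. V \<omega> \<le> T"
  shows "integrable lborel (\<lambda>t. indicator {0..T} t * expectation (\<lambda>\<omega>. Z \<omega> * indicator {\<omega>. t < V \<omega>} \<omega>))"
    and "expectation (\<lambda>\<omega>. Z \<omega> * V \<omega>) =
      (\<integral>t. indicator {0..T} t * expectation (\<lambda>\<omega>. Z \<omega> * indicator {\<omega>. t < V \<omega>} \<omega>) \<partial>lborel)"
proof -
  interpret pair_sigma_finite M lborel ..
  define f where "f = (\<lambda>(\<omega>, t). Z \<omega> * (if 0 \<le> t \<and> t < V \<omega> then 1 else 0 :: real))"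
  have [measurable]: "f \<in> borel_measurable (M \<Otimes>\<^sub>M lborel)" unfolding f_def by measurable
  have B: "0 \<le> B" using Z[of undefined] by linarith
  have int: "integrable (M \<Otimes>\<^sub>M lborel) f"
  proof (rule Bochner_Integration.integrable_bound)
    show "integrable (M \<Otimes>\<^sub>M lborel) (\<lambda>z. B * indicator (space M \<times> {0..T}) z)"
      by (intro integrable_mult_right integrable_real_indicator)
        (auto simp: lborel.emeasure_pair_measure_Times emeasure_space_1 emeasure_lborel_Icc_eq)
    show "AE z in M \<Otimes>\<^sub>M lborel. norm (f z) \<le> norm (B * indicator (space M \<times> {0..T}) z)"
    proof (rule AE_I2)
      fix z :: "'a \<times> real" assume "z \<in> space (M \<Otimes>\<^sub>M lborel)"
      then obtain \<omega> t where z: "z = (\<omega>, t)" "\<omega> \<in> space M" by (auto simp: space_pair_measure)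
      show "norm (f z) \<le> norm (B * indicator (space M \<times> {0..T}) z)"
        using z Z[of \<omega>] V(2)[of \<omega>] B by (auto simp: f_def indicator_def)
    qed
  qed simp
  have ft: "(\<integral>\<omega>. f (\<omega>, t) \<partial>M) = indicator {0..T} t * expectation (\<lambda>\<omega>. Z \<omega> * indicator {\<omega>. t < V \<omega>} \<omega>)" for t
  proof -
    have "f (\<omega>, t) = indicator {0..T} t * (Z \<omega> * indicator {\<omega>. t < V \<omega>} \<omega>)" for \<omega>
      using V(2)[of \<omega>] by (auto simp: f_def indicator_def)
    then show ?thesis by simp
  qed
  have fo: "(\<integral>t. f (\<omega>, t) \<partial>lborel) = Z \<omega> * V \<omega>" for \<omega>
  proof -
    have "f (\<omega>, t) = Z \<omega> * indicator {0..<V \<omega>} t" for t by (auto simp: f_def indicator_def)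
    then show ?thesis using V(1)[of \<omega>] by simp
  qed
  show "integrable lborel (\<lambda>t. indicator {0..T} t * expectation (\<lambda>\<omega>. Z \<omega> * indicator {\<omega>. t < V \<omega>} \<omega>))"
    using integrable_snd[of "\<lambda>\<omega> t. f (\<omega>, t)"] int by (simp add: ft)
  show "expectation (\<lambda>\<omega>. Z \<omega> * V \<omega>) =
      (\<integral>t. indicator {0..T} t * expectation (\<lambda>\<omega>. Z \<omega> * indicator {\<omega>. t < V \<omega>} \<omega>) \<partial>lborel)"
    using Fubini_integral[of "\<lambda>\<omega> t. f (\<omega>, t)"] int by (simp add: ft fo)
qed

text \<open>  Both variables are written as integrals of indicators of their level sets. For an event \<open>E\<close> of
  the form \<open>t < V\<close> the covariance of \<open>Z\<close> and the indicator of \<open>E\<close> is at most the mixing coefficient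
  and trivially at most the probability of \<open>E\<close>; the smaller bound is integrated over \<open>t\<close>.\<close>
lemma (in prob_space) covariance_le_of_level_sets:
  fixes Z V :: "'a \<Rightarrow> real"
  assumes [measurable]: "Z \<in> borel_measurable M" "V \<in> borel_measurable M"
    and Z: "\<And>\<omega>. 0 \<le> Z \<omega>" "\<And>\<omega>. Z \<omega> \<le> 1" and V: "\<And>\<omega>. 0 \<le> V \<omega>" "\<And>\<omega>. V \<omega> \<le> T"
    and mix: "\<And>z t. \<bar>prob ({\<omega> \<in> space M. z < Z \<omega>} \<inter> {\<omega> \<in> space M. t < V \<omega>})
        - prob {\<omega> \<in> space M. z < Z \<omega>} * prob {\<omega> \<in> space M. t < V \<omega>}\<bar> \<le> a"
  shows "\<bar>expectation (\<lambda>\<omega>. Z \<omega> * V \<omega>) - expectation Z * expectation V\<bar>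
      \<le> (\<integral>t. indicator {0..T} t * min a (prob {\<omega> \<in> space M. t < V \<omega>}) \<partial>lborel)"
proof -
  have a0: "0 \<le> a" using mix[of 0 0] by linarith
  have Zint: "integrable M Z" using Z by (intro integrable_const_bound[where B=1]) auto
  have ev: "\<bar>expectation (\<lambda>\<omega>. Z \<omega> * indicator E \<omega>) - expectation Z * prob E\<bar> \<le> min a (prob E)"
    if E: "E = {\<omega> \<in> space M. t < V \<omega>}" for E t
  proof -
    have [measurable]: "E \<in> events" unfolding E by measurable
    have pr: "expectation (\<lambda>\<omega>. indicator E \<omega> * indicator {\<omega>. z < Z \<omega>} \<omega>) = prob ({\<omega> \<in> space M. z < Z \<omega>} \<inter> E)" for z
    proof -
      have "expectation (\<lambda>\<omega>. indicator E \<omega> * indicator {\<omega>. z < Z \<omega>} \<omega>) = expectation (indicat_real ({\<omega> \<in> space M. z < Z \<omega>} \<inter> E))"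
        by (intro Bochner_Integration.integral_cong) (auto simp: indicator_def)
      then show ?thesis by simp
    qed
    have pr1: "expectation (\<lambda>\<omega>. 1 * indicator {\<omega>. z < Z \<omega>} \<omega>) = prob {\<omega> \<in> space M. z < Z \<omega>}" for z
    proof -
      have "expectation (\<lambda>\<omega>. 1 * indicator {\<omega>. z < Z \<omega>} \<omega>) = expectation (indicat_real {\<omega> \<in> space M. z < Z \<omega>})"
        by (intro Bochner_Integration.integral_cong) (auto simp: indicator_def)
      then show ?thesis by simp
    qed
    note l1 = expectation_mult_layer_cake[of "indicator E" Z 1 1, unfolded pr]
    note l2 = expectation_mult_layer_cake[of "\<lambda>_. 1" Z 1 1, unfolded pr1]
    have i1: "integrable lborel (\<lambda>z. indicator {0..1} z * prob ({\<omega> \<in> space M. z < Z \<omega>} \<inter> E))"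
      by (rule l1) (use Z in \<open>auto simp: indicator_def\<close>)
    have i2: "integrable lborel (\<lambda>z. indicator {0..1} z * prob {\<omega> \<in> space M. z < Z \<omega>})"
      by (rule l2) (use Z in auto)
    have e1: "expectation (\<lambda>\<omega>. Z \<omega> * indicator E \<omega>) = (\<integral>z. indicator {0..1} z * prob ({\<omega> \<in> space M. z < Z \<omega>} \<inter> E) \<partial>lborel)"
      using l1(2) Z by (simp add: mult.commute indicator_def)
    have e2: "expectation Z = (\<integral>z. indicator {0..1} z * prob {\<omega> \<in> space M. z < Z \<omega>} \<partial>lborel)"
      using l2(2) Z by simp
    have "expectation (\<lambda>\<omega>. Z \<omega> * indicator E \<omega>) - expectation Z * prob E
      = (\<integral>z. indicator {0..1} z * (prob ({\<omega> \<in> space M. z < Z \<omega>} \<inter> E) - prob {\<omega> \<in> space M. z < Z \<omega>} * prob E) \<partial>lborel)"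
      unfolding e1 e2 using i1 i2
      by (subst integral_mult_left_zero[symmetric], subst Bochner_Integration.integral_diff[symmetric]) (auto simp: algebra_simps)
    also have "\<bar>\<dots>\<bar> \<le> (\<integral>z. indicator {0..1::real} z * a \<partial>lborel)"
    proof (rule order_trans[OF integral_abs_bound], rule integral_mono)
      have "integrable lborel (\<lambda>z. indicator {0..1} z * prob ({\<omega> \<in> space M. z < Z \<omega>} \<inter> E) - indicator {0..1} z * prob {\<omega> \<in> space M. z < Z \<omega>} * prob E)"
        by (intro Bochner_Integration.integrable_diff integrable_mult_left i1 i2)
      then show "integrable lborel (\<lambda>z. \<bar>indicator {0..1} z * (prob ({\<omega> \<in> space M. z < Z \<omega>} \<inter> E) - prob {\<omega> \<in> space M. z < Z \<omega>} * prob E)\<bar>)"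
        by (intro integrable_abs) (simp add: algebra_simps)
      show "integrable lborel (\<lambda>z. indicator {0..1::real} z * a)" by simp
    qed (use mix[of _ t] in \<open>auto simp: E indicator_def\<close>)
    also have "\<dots> = a" by simp
    finally have le_a: "\<bar>expectation (\<lambda>\<omega>. Z \<omega> * indicator E \<omega>) - expectation Z * prob E\<bar> \<le> a" .
    have "expectation (\<lambda>\<omega>. Z \<omega> * indicator E \<omega>) \<le> expectation (indicator E)"
      using Z by (intro integral_mono integrable_const_bound[where B=1] AE_I2) (auto simp: indicator_def)
    then have le1: "expectation (\<lambda>\<omega>. Z \<omega> * indicator E \<omega>) \<le> prob E" by simp
    have ge1: "0 \<le> expectation (\<lambda>\<omega>. Z \<omega> * indicator E \<omega>)"
      using Z by (intro Bochner_Integration.integral_nonneg) auto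
    have "0 \<le> expectation Z" "expectation Z \<le> 1"
      using Z Zint integral_mono[of M Z "\<lambda>_. 1"] by (auto simp: prob_space intro!: Bochner_Integration.integral_nonneg)
    then have "0 \<le> expectation Z * prob E" "expectation Z * prob E \<le> prob E"
      by (auto intro!: mult_nonneg_nonneg mult_left_le_one_le)
    then show ?thesis using le_a le1 ge1 by auto
  qed
  have ind: "expectation (\<lambda>\<omega>. g \<omega> * indicator {\<omega>. t < V \<omega>} \<omega>) = expectation (\<lambda>\<omega>. g \<omega> * indicator {\<omega> \<in> space M. t < V \<omega>} \<omega>)" for g :: "'a \<Rightarrow> real" and t
    by (intro Bochner_Integration.integral_cong) (auto simp: indicator_def)
  note l1 = expectation_mult_layer_cake[of Z V 1 T, unfolded ind]
  note l2 = expectation_mult_layer_cake[of "\<lambda>_. 1" V 1 T, unfolded ind]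
  have Zb: "\<bar>Z \<omega>\<bar> \<le> 1" for \<omega> using Z[of \<omega>] by simp
  have i1: "integrable lborel (\<lambda>t. indicator {0..T} t * expectation (\<lambda>\<omega>. Z \<omega> * indicator {\<omega> \<in> space M. t < V \<omega>} \<omega>))"
    by (rule l1) (use Zb V in auto)
  have i2: "integrable lborel (\<lambda>t. indicator {0..T} t * prob {\<omega> \<in> space M. t < V \<omega>})"
    using l2(1) V by simp
  have e1: "expectation (\<lambda>\<omega>. Z \<omega> * V \<omega>) = (\<integral>t. indicator {0..T} t * expectation (\<lambda>\<omega>. Z \<omega> * indicator {\<omega> \<in> space M. t < V \<omega>} \<omega>) \<partial>lborel)"
    by (rule l1) (use Zb V in auto)
  have e2: "expectation V = (\<integral>t. indicator {0..T} t * prob {\<omega> \<in> space M. t < V \<omega>} \<partial>lborel)"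
    using l2(2) V by simp
  have "expectation (\<lambda>\<omega>. Z \<omega> * V \<omega>) - expectation Z * expectation V
    = (\<integral>t. indicator {0..T} t * expectation (\<lambda>\<omega>. Z \<omega> * indicator {\<omega> \<in> space M. t < V \<omega>} \<omega>)
        - expectation Z * (indicator {0..T} t * prob {\<omega> \<in> space M. t < V \<omega>}) \<partial>lborel)"
    unfolding e1 e2 using i1 i2
    by (subst Bochner_Integration.integral_diff) auto
  also have "\<bar>\<dots>\<bar> \<le> (\<integral>t. indicator {0..T} t * min a (prob {\<omega> \<in> space M. t < V \<omega>}) \<partial>lborel)"
  proof (rule order_trans[OF integral_abs_bound], rule integral_mono)
    show "integrable lborel (\<lambda>t. \<bar>indicator {0..T} t * expectation (\<lambda>\<omega>. Z \<omega> * indicator {\<omega> \<in> space M. t < V \<omega>} \<omega>)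
        - expectation Z * (indicator {0..T} t * prob {\<omega> \<in> space M. t < V \<omega>})\<bar>)"
      by (intro integrable_abs Bochner_Integration.integrable_diff integrable_mult_right i1 i2)
    have "integrable lborel (\<lambda>t. min (indicator {0..T} t * a) (indicator {0..T} t * prob {\<omega> \<in> space M. t < V \<omega>}))"
      by (intro integrable_min i2 integrable_mult_left integrable_real_indicator) (auto simp: emeasure_lborel_Icc_eq)
    moreover have "min (indicator {0..T} t * a) (indicator {0..T} t * prob {\<omega> \<in> space M. t < V \<omega>}) 
       = indicator {0..T} t * min a (prob {\<omega> \<in> space M. t < V \<omega>})" for t
      by (auto simp: indicator_def)
    ultimately show "integrable lborel (\<lambda>t. indicator {0..T} t * min a (prob {\<omega> \<in> space M. t < V \<omega>}))"
      by simp
    fix t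
    show "\<bar>indicator {0..T} t * expectation (\<lambda>\<omega>. Z \<omega> * indicator {\<omega> \<in> space M. t < V \<omega>} \<omega>)
        - expectation Z * (indicator {0..T} t * prob {\<omega> \<in> space M. t < V \<omega>})\<bar>
       \<le> indicator {0..T} t * min a (prob {\<omega> \<in> space M. t < V \<omega>})"
      using ev[OF refl, of t] by (cases "t \<in> {0..T}") auto
  qed
  finally show ?thesis .
qed

text \<open>  With \<open>f = sqrt (1 + x\<^sup>2)\<close>, the left-hand side is \<open>sqrt (f\<^sup>2 + e)\<close> for \<open>e = 2 x d + d\<^sup>2\<close>, hence at
  most \<open>f + e / (2 f)\<close>, and \<open>f \<ge> 1\<close>.\<close>
lemma sqrt_one_plus_square_increment:
  fixes x d :: real
  shows "sqrt (1 + (x + d)\<^sup>2) \<le> sqrt (1 + x\<^sup>2) + x / sqrt (1 + x\<^sup>2) * d + d\<^sup>2 / 2"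
proof -
  define f where "f = sqrt (1 + x\<^sup>2)"
  define e where "e = 2 * x * d + d\<^sup>2"
  have f: "1 \<le> f" "f\<^sup>2 = 1 + x\<^sup>2" by (auto simp: f_def)
  have e: "1 + (x + d)\<^sup>2 = f\<^sup>2 + e" using f by (simp add: e_def power2_sum)
  have "(f + e / (2 * f))\<^sup>2 = f\<^sup>2 + e + (e / (2 * f))\<^sup>2" using f by (simp add: power2_sum)
  then have "1 + (x + d)\<^sup>2 \<le> (f + e / (2 * f))\<^sup>2" unfolding e by simp
  moreover have "0 \<le> f + e / (2 * f)"
  proof -
    have "0 \<le> 1 + (x + d)\<^sup>2" by simp
    then have "- e \<le> f * f" unfolding e by (simp add: power2_eq_square)
    moreover have "0 \<le> f * f" using f by simp
    ultimately have "- e \<le> f * (2 * f)" by linarith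
    then have "- e / (2 * f) \<le> f" using f by (simp only: pos_divide_le_eq)
    then show ?thesis by simp
  qed
  ultimately have "sqrt (1 + (x + d)\<^sup>2) \<le> f + e / (2 * f)" by (intro real_le_lsqrt) auto
  also have "e / (2 * f) = x / f * d + d\<^sup>2 / (2 * f)" using f by (simp add: e_def add_divide_distrib)
  also have "d\<^sup>2 / (2 * f) \<le> d\<^sup>2 / 2" using f by (intro divide_left_mono) auto
  finally show ?thesis by (simp add: f_def)
qed

lemma sqrt_one_plus_square_slope:
  fixes x y :: real
  shows "\<bar>x / sqrt (1 + x\<^sup>2)\<bar> \<le> 1" "\<bar>x / sqrt (1 + x\<^sup>2) - y / sqrt (1 + y\<^sup>2)\<bar> \<le> \<bar>x - y\<bar>"
proof -
  have pos: "0 < 1 + z\<^sup>2" for z :: real by (simp add: add_pos_nonneg)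
  show "\<bar>x / sqrt (1 + x\<^sup>2)\<bar> \<le> 1"
    using pos[of x] by (simp add: abs_divide real_le_rsqrt)
  have der: "((\<lambda>z. z / sqrt (1 + z\<^sup>2)) has_real_derivative 1 / (sqrt (1 + z\<^sup>2) * (1 + z\<^sup>2))) (at z)" for z :: real
  proof -
    have "((\<lambda>z. z / sqrt (1 + z\<^sup>2)) has_real_derivative
       (sqrt (1 + z\<^sup>2) - z * (inverse (sqrt (1 + z\<^sup>2)) / 2 * (2 * z))) / (sqrt (1 + z\<^sup>2) * sqrt (1 + z\<^sup>2))) (at z)"
      using pos[of z] by (auto intro!: derivative_eq_intros)
    moreover have "(sqrt (1 + z\<^sup>2) - z * (inverse (sqrt (1 + z\<^sup>2)) / 2 * (2 * z))) / (sqrt (1 + z\<^sup>2) * sqrt (1 + z\<^sup>2))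
       = 1 / (sqrt (1 + z\<^sup>2) * (1 + z\<^sup>2))"
    proof -
      define s where "s = sqrt (1 + z\<^sup>2)"
      have "0 < s" "s * s = 1 + z\<^sup>2" using pos[of z] by (auto simp: s_def)
      then have "s - z * (inverse s / 2 * (2 * z)) = 1 / s"
        by (simp add: field_simps power2_eq_square)
      then show ?thesis using \<open>s * s = _\<close> by (simp add: s_def[symmetric])
    qed
    ultimately show ?thesis by simp
  qed
  have bd: "\<bar>1 / (sqrt (1 + z\<^sup>2) * (1 + z\<^sup>2))\<bar> \<le> 1" for z :: real
  proof -
    have "1 \<le> sqrt (1 + z\<^sup>2) * (1 + z\<^sup>2)" using mult_mono[of 1 "sqrt (1 + z\<^sup>2)" 1 "1 + z\<^sup>2"] by simp
    then show ?thesis by simp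
  qed
  show "\<bar>x / sqrt (1 + x\<^sup>2) - y / sqrt (1 + y\<^sup>2)\<bar> \<le> \<bar>x - y\<bar>"
    using field_differentiable_bound[of UNIV "\<lambda>z. z / sqrt (1 + z\<^sup>2)" "\<lambda>z. 1 / (sqrt (1 + z\<^sup>2) * (1 + z\<^sup>2))" 1 y x] der bd
    by (simp add: real_norm_def)
qed

text \<open>  A second order expansion of \<open>\<psi>(S\<^sub>i)\<close> with \<open>\<psi> x = sqrt (1 + x\<^sup>2)\<close>, where \<open>S\<^sub>i\<close> is the centred sum
  divided by \<open>l\<close>. In the linear term \<open>\<psi>'(S\<^sub>i\<^sub>-\<^sub>1)\<close> is replaced by \<open>\<psi>'(S\<^sub>i\<^sub>-\<^sub>q)\<close>, a function of the
  distant past with values in \<open>[-1, 1]\<close>, so the expectation of that term is a covariance bounded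
  by \<open>2 h / l\<close>. The \<open>q - 1\<close> skipped summands cost at most \<open>(q - 1) T\<^sup>2 / l\<^sup>2\<close>, because \<open>\<psi>'\<close> is 1-Lipschitz.
  As \<open>\<psi>'\<close> is bounded, \<open>h\<close> enters linearly and with the factor \<open>1 / l\<close> only.\<close>
lemma (in prob_space) deviation_of_weakly_dependent_sum:
  fixes V :: "nat \<Rightarrow> 'a \<Rightarrow> real"
  assumes meas: "\<And>i. 1 \<le> i \<Longrightarrow> V i \<in> borel_measurable M"
    and V: "\<And>i \<omega>. 0 \<le> V i \<omega>" "\<And>i \<omega>. V i \<omega> \<le> T"
    and mean: "\<And>i. 1 \<le> i \<Longrightarrow> expectation (V i) = m"
    and q: "1 \<le> q" and lam: "0 < l" and h: "0 \<le> h"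
    and decor: "\<And>i f. q < i \<Longrightarrow> f \<in> borel_measurable borel \<Longrightarrow> (\<And>x. 0 \<le> f x) \<Longrightarrow> (\<And>x. f x \<le> 1) \<Longrightarrow>
      \<bar>expectation (\<lambda>\<omega>. f (\<Sum>j=1..i - q. V j \<omega>) * V i \<omega>) - expectation (\<lambda>\<omega>. f (\<Sum>j=1..i - q. V j \<omega>)) * m\<bar> \<le> h"
  shows "prob {\<omega> \<in> space M. l \<le> \<bar>\<Sum>i=1..n. V i \<omega> - m\<bar>} \<le> 3 * real n * (2 * h / l + real q * T\<^sup>2 / l\<^sup>2)"
proof -
  define \<psi> where "\<psi> = (\<lambda>x::real. sqrt (1 + x\<^sup>2))"
  define \<psi>' where "\<psi>' = (\<lambda>x::real. x / sqrt (1 + x\<^sup>2))"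
  define S where "S = (\<lambda>k \<omega>. (\<Sum>j=1..k. V j \<omega> - m) / l)"
  have [measurable]: "\<psi> \<in> borel_measurable borel" "\<psi>' \<in> borel_measurable borel"
    unfolding \<psi>_def \<psi>'_def by measurable
  have Smeas[measurable]: "S k \<in> borel_measurable M" for k
    unfolding S_def using meas by (intro borel_measurable_divide borel_measurable_sum borel_measurable_diff) auto
  have T: "0 \<le> T" using V(1)[of 0 undefined] V(2)[of 0 undefined] by linarith
  have intV: "integrable M (V i)" if "1 \<le> i" for i
    using V meas[OF that] by (intro integrable_const_bound[where B=T] AE_I2) auto
  have m: "0 \<le> m" "m \<le> T"
  proof -
    show "0 \<le> m" using V mean[of 1] by (auto intro!: Bochner_Integration.integral_nonneg simp flip: mean[of 1])
    have "expectation (V 1) \<le> expectation (\<lambda>_. T)" using V intV[of 1] by (intro integral_mono) auto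
    then show "m \<le> T" using mean[of 1] by (simp add: prob_space)
  qed
  have d: "\<bar>V i \<omega> - m\<bar> \<le> T" for i \<omega> using V(1)[of i \<omega>] V(2)[of i \<omega>] m by linarith
  have Sbd: "\<bar>S k \<omega>\<bar> \<le> real k * T / l" for k \<omega>
  proof -
    have "\<bar>\<Sum>j=1..k. V j \<omega> - m\<bar> \<le> (\<Sum>j=1..k. \<bar>V j \<omega> - m\<bar>)" by (rule sum_abs)
    also have "\<dots> \<le> real (card {1..k}) * T" using d by (intro sum_bounded_above) auto
    finally show ?thesis using lam by (simp add: S_def divide_right_mono)
  qed
  have \<psi>int: "integrable M (\<lambda>\<omega>. \<psi> (S k \<omega>))" for k
  proof (rule integrable_const_bound[where B="1 + real k * T / l"])
    have "\<psi> x \<le> 1 + \<bar>x\<bar>" for x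
      unfolding \<psi>_def by (rule real_le_lsqrt) (auto simp: power2_sum)
    then have "\<bar>\<psi> (S k \<omega>)\<bar> \<le> 1 + real k * T / l" for \<omega>
      using Sbd[of k \<omega>] by (simp add: \<psi>_def) (smt (verit))
    then show "AE \<omega> in M. norm (\<psi> (S k \<omega>)) \<le> 1 + real k * T / l" by simp
  qed simp
  have \<psi>'bd: "\<bar>\<psi>' x\<bar> \<le> 1" for x unfolding \<psi>'_def by (rule sqrt_one_plus_square_slope)
  define b where "b = 2 * h / l + real q * T\<^sup>2 / l\<^sup>2"
  have step: "expectation (\<lambda>\<omega>. \<psi> (S i \<omega>)) \<le> expectation (\<lambda>\<omega>. \<psi> (S (i - 1) \<omega>)) + b" if i: "1 \<le> i" for i
  proof -
    note [measurable] = meas[OF i]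
    define D where "D = (\<lambda>\<omega>. (V i \<omega> - m) / l)"
    have Dmeas[measurable]: "D \<in> borel_measurable M" unfolding D_def by measurable
    have Dbd: "\<bar>D \<omega>\<bar> \<le> T / l" for \<omega> using d[of i \<omega>] lam by (simp add: D_def divide_right_mono)
    have Si: "S i \<omega> = S (i - 1) \<omega> + D \<omega>" for \<omega>
      using i by (cases i) (auto simp: S_def D_def add_divide_distrib)
    have far: "\<bar>S (i - 1) \<omega> - S (i - q) \<omega>\<bar> \<le> (real q - 1) * T / l" for \<omega>
    proof -
      have "{1..i - 1} = {1..i - q} \<union> {i - q + 1..i - 1}" "{1..i - q} \<inter> {i - q + 1..i - 1} = {}" using q i by auto
      then have "(\<Sum>j=1..i - 1. V j \<omega> - m) = (\<Sum>j=1..i - q. V j \<omega> - m) + (\<Sum>j=i - q + 1..i - 1. V j \<omega> - m)"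
        by (simp add: sum.union_disjoint)
      moreover have "\<bar>\<Sum>j=i - q + 1..i - 1. V j \<omega> - m\<bar> \<le> (real q - 1) * T"
      proof -
        have "\<bar>\<Sum>j=i - q + 1..i - 1. V j \<omega> - m\<bar> \<le> (\<Sum>j=i - q + 1..i - 1. \<bar>V j \<omega> - m\<bar>)" by (rule sum_abs)
        also have "\<dots> \<le> real (card {i - q + 1..i - 1}) * T" using d by (intro sum_bounded_above) auto
        also have "\<dots> \<le> (real q - 1) * T" using q i T by (intro mult_right_mono) auto
        finally show ?thesis .
      qed
      ultimately show ?thesis using lam by (simp add: S_def diff_divide_distrib[symmetric] divide_right_mono)
    qed
    have pt: "\<psi> (S i \<omega>) \<le> \<psi> (S (i - 1) \<omega>) + \<psi>' (S (i - q) \<omega>) * D \<omega> + real q * T\<^sup>2 / l\<^sup>2" for \<omega>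
    proof -
      have "\<psi> (S i \<omega>) \<le> \<psi> (S (i - 1) \<omega>) + \<psi>' (S (i - 1) \<omega>) * D \<omega> + (D \<omega>)\<^sup>2 / 2"
        unfolding Si \<psi>_def \<psi>'_def by (rule sqrt_one_plus_square_increment)
      moreover have "(D \<omega>)\<^sup>2 \<le> T\<^sup>2 / l\<^sup>2"
        using power_mono[OF Dbd[of \<omega>], of 2] by (simp add: power_divide)
      moreover have "(\<psi>' (S (i - 1) \<omega>) - \<psi>' (S (i - q) \<omega>)) * D \<omega> \<le> (real q - 1) * (T\<^sup>2 / l\<^sup>2)"
      proof -
        have "(\<psi>' (S (i - 1) \<omega>) - \<psi>' (S (i - q) \<omega>)) * D \<omega> \<le> \<bar>\<psi>' (S (i - 1) \<omega>) - \<psi>' (S (i - q) \<omega>)\<bar> * \<bar>D \<omega>\<bar>"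
          by (metis abs_mult abs_ge_self)
        also have "\<dots> \<le> ((real q - 1) * T / l) * (T / l)"
          using order_trans[OF sqrt_one_plus_square_slope(2) far] Dbd q T lam
          by (intro mult_mono) (auto simp: \<psi>'_def)
        finally show ?thesis by (simp add: power2_eq_square)
      qed
      moreover have "0 \<le> T\<^sup>2 / l\<^sup>2" by simp
      moreover have "real q * T\<^sup>2 / l\<^sup>2 = real q * (T\<^sup>2 / l\<^sup>2)" by simp
      ultimately show ?thesis by (simp only: left_diff_distrib)
    qed
    have crossint: "integrable M (\<lambda>\<omega>. \<psi>' (S (i - q) \<omega>) * D \<omega>)"
    proof (rule integrable_const_bound[where B="1 * (T / l)"])
      show "AE \<omega> in M. norm (\<psi>' (S (i - q) \<omega>) * D \<omega>) \<le> 1 * (T / l)"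
        unfolding real_norm_def abs_mult using \<psi>'bd Dbd by (intro AE_I2 mult_mono) auto
    qed simp
    have cross: "expectation (\<lambda>\<omega>. \<psi>' (S (i - q) \<omega>) * D \<omega>) \<le> 2 * h / l"
    proof (cases "i \<le> q")
      case True
      then show ?thesis using h lam by (simp add: S_def \<psi>'_def)
    next
      case False
      \<comment> \<open>The slope at the past sum, rescaled to a function of the uncentred sum with values in [0, 1].\<close>
      define f where "f = (\<lambda>x. (\<psi>' ((x - real (i - q) * m) / l) + 1) / 2)"
      have [measurable]: "f \<in> borel_measurable borel" unfolding f_def by measurable
      have f01: "0 \<le> f x" "f x \<le> 1" for x using \<psi>'bd[of "(x - real (i - q) * m) / l"] by (auto simp: f_def)
      define Z where "Z = (\<lambda>\<omega>. f (\<Sum>j=1..i - q. V j \<omega>))"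
      have Zeq: "\<psi>' (S (i - q) \<omega>) = 2 * Z \<omega> - 1" for \<omega>
        by (simp add: Z_def f_def S_def sum_subtractf add_divide_distrib)
      have [measurable]: "Z \<in> borel_measurable M"
      proof -
        have "Z = (\<lambda>\<omega>. (\<psi>' (S (i - q) \<omega>) + 1) / 2)" using Zeq by auto
        then show ?thesis by simp
      qed
      have Z01: "0 \<le> Z \<omega>" "Z \<omega> \<le> 1" for \<omega> using f01 by (auto simp: Z_def)
      have Zint: "integrable M Z" using Z01 by (intro integrable_const_bound[where B=1] AE_I2) auto
      have ZVint: "integrable M (\<lambda>\<omega>. Z \<omega> * V i \<omega>)"
      proof (rule integrable_const_bound[where B="1 * T"])
        show "AE \<omega> in M. norm (Z \<omega> * V i \<omega>) \<le> 1 * T"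
          unfolding real_norm_def abs_mult using Z01 V by (intro AE_I2 mult_mono) auto
      qed simp
      have "\<psi>' (S (i - q) \<omega>) * D \<omega> = (2 * (Z \<omega> * V i \<omega>) - 2 * m * Z \<omega> - (V i \<omega> - m)) / l" for \<omega>
        unfolding Zeq D_def by (simp add: algebra_simps diff_divide_distrib add_divide_distrib)
      then have "expectation (\<lambda>\<omega>. \<psi>' (S (i - q) \<omega>) * D \<omega>)
        = (2 * expectation (\<lambda>\<omega>. Z \<omega> * V i \<omega>) - 2 * m * expectation Z - (expectation (V i) - m)) / l"
        using Zint ZVint intV[OF i] by (simp add: prob_space)
      also have "\<dots> = 2 * (expectation (\<lambda>\<omega>. Z \<omega> * V i \<omega>) - expectation Z * m) / l"
        using mean[OF i] by (simp add: algebra_simps)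
      also have "\<dots> \<le> 2 * h / l"
        using decor[of i f] False f01 lam unfolding Z_def by (intro divide_right_mono mult_left_mono) auto
      finally show ?thesis .
    qed
    have "expectation (\<lambda>\<omega>. \<psi> (S i \<omega>)) \<le> expectation (\<lambda>\<omega>. \<psi> (S (i - 1) \<omega>) + \<psi>' (S (i - q) \<omega>) * D \<omega> + real q * T\<^sup>2 / l\<^sup>2)"
      by (intro integral_mono pt \<psi>int Bochner_Integration.integrable_add crossint integrable_const)
    also have "\<dots> = expectation (\<lambda>\<omega>. \<psi> (S (i - 1) \<omega>)) + expectation (\<lambda>\<omega>. \<psi>' (S (i - q) \<omega>) * D \<omega>) + real q * T\<^sup>2 / l\<^sup>2"
      using \<psi>int crossint by (simp add: prob_space)
    finally show ?thesis using cross by (simp add: b_def)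
  qed
  have total: "expectation (\<lambda>\<omega>. \<psi> (S k \<omega>)) \<le> 1 + real k * b" for k
  proof (induction k)
    case 0
    show ?case by (simp add: S_def \<psi>_def prob_space)
  next
    case (Suc k)
    then show ?case using step[of "Suc k"] by (simp add: algebra_simps)
  qed
  have "prob {\<omega> \<in> space M. l \<le> \<bar>\<Sum>i=1..n. V i \<omega> - m\<bar>} \<le> prob {\<omega> \<in> space M. 1/3 \<le> \<psi> (S n \<omega>) - 1}"
  proof (intro finite_measure_mono subsetI)
    fix \<omega> assume \<omega>: "\<omega> \<in> {\<omega> \<in> space M. l \<le> \<bar>\<Sum>i=1..n. V i \<omega> - m\<bar>}"
    then have "1 \<le> \<bar>S n \<omega>\<bar>" using lam by (simp add: S_def)
    then have "1 \<le> (S n \<omega>)\<^sup>2" by (simp add: abs_le_square_iff[of 1 "S n \<omega>", simplified])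
    \<comment> \<open>sqrt 2 > 4/3 gives the factor 3 in the Markov inequality.\<close>
    then have "4/3 \<le> \<psi> (S n \<omega>)" unfolding \<psi>_def by (intro real_le_rsqrt) (simp add: power2_eq_square)
    then show "\<omega> \<in> {\<omega> \<in> space M. 1/3 \<le> \<psi> (S n \<omega>) - 1}" using \<omega> by auto
  qed simp
  also have "\<dots> \<le> expectation (\<lambda>\<omega>. \<psi> (S n \<omega>) - 1) / (1/3)"
  proof (rule integral_Markov_inequality_measure[where A="{}"])
    show "integrable M (\<lambda>\<omega>. \<psi> (S n \<omega>) - 1)" using \<psi>int by simp
  qed (auto simp: \<psi>_def)
  also have "\<dots> = 3 * (expectation (\<lambda>\<omega>. \<psi> (S n \<omega>)) - 1)" using \<psi>int by (simp add: prob_space)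
  also have "\<dots> \<le> 3 * real n * b" using total[of n] by simp
  finally show ?thesis by (simp add: b_def)
qed

section \<open>A strong law under alpha-mixing\<close>

text \<open>  Every large \<open>n\<close> lies between \<open>b\<^sup>k c\<close> and \<open>b\<^sup>k (c + 1)\<close> for some \<open>c\<close> between \<open>J\<close> and \<open>b J\<close>. For a
  monotone \<open>S\<close> this determines \<open>S n / n\<close> up to a factor \<open>1 + 1 / J\<close>. Only finitely many \<open>c\<close> occur
  for fixed \<open>J\<close>, so their limits hold uniformly.\<close>
lemma tendsto_average_of_geometric_subsequences:
  fixes S :: "nat \<Rightarrow> real"
  assumes mono: "incseq S" and S0: "0 \<le> S 0" and b: "2 \<le> (b::nat)"
    and sub: "\<And>c. 1 \<le> c \<Longrightarrow> (\<lambda>k. S (b ^ k * c) / real (b ^ k * c)) \<longlonglongrightarrow> m"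
  shows "(\<lambda>n. S n / real n) \<longlonglongrightarrow> m"
proof (rule tendstoI)
  fix e :: real assume e: "0 < e"
  have Snn: "0 \<le> S n" for n using S0 incseqD[OF mono, of 0 n] by simp
  have m0: "0 \<le> m" using sub[OF order_refl] by (rule tendsto_lowerbound) (simp_all add: Snn)
  obtain J0 :: nat where J0: "(m + 1) / (e / 4) < real J0" using reals_Archimedean2[of "(m + 1) / (e / 4)"] by blast
  define J where "J = Suc J0"
  have J: "1 \<le> J" "(m + 1) / real J < e / 4"
  proof -
    have "(m + 1) / (e / 4) < real J" using J0 by (simp add: J_def)
    then have "m + 1 < real J * (e / 4)" using e by (simp only: pos_divide_less_eq)
    then show "(m + 1) / real J < e / 4" by (simp add: J_def pos_divide_less_eq mult.commute)
  qed (simp add: J_def)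
  define d where "d = min 1 (e / 4)"
  have d: "0 < d" "d \<le> 1" "d \<le> e / 4" using e by (auto simp: d_def)
  have "\<forall>\<^sub>F k in sequentially. \<forall>c\<in>{J..b * J}. dist (S (b ^ k * c) / real (b ^ k * c)) m < d"
    using J d by (intro eventually_ball_finite ballI tendstoD[OF sub]) auto
  then obtain K where "\<forall>k\<ge>K. \<forall>c\<in>{J..b * J}. \<bar>S (b ^ k * c) / real (b ^ k * c) - m\<bar> < d"
    unfolding eventually_sequentially dist_real_def by blast
  then have K: "\<bar>S (b ^ k * c) / real (b ^ k * c) - m\<bar> < d" if "K \<le> k" "J \<le> c" "c \<le> b * J" for k c
    using that by simp
  show "\<forall>\<^sub>F n in sequentially. dist (S n / real n) m < e"
    using eventually_ge_at_top[of "J * b ^ K"]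
  proof eventually_elim
    case (elim n)
    have JK: "b ^ K \<le> n div J" using elim J(1) by (simp add: less_eq_div_iff_mult_less_eq mult.commute)
    moreover have "1 \<le> b ^ K" using b by simp
    ultimately have "1 \<le> n div J" by linarith
    then obtain k where k: "b ^ k \<le> n div J" "n div J < b ^ (k + 1)" using ex_power_ivl1[OF b] by blast
    have "b ^ K < b ^ (k + 1)" using JK k by linarith
    then have "K < k + 1" using b by (intro power_less_imp_less_exp[of b K "k + 1"]) auto
    then have Kk: "K \<le> k" by simp
    define c where "c = n div b ^ k"
    have bk: "0 < b ^ k" using b by simp
    have c1: "J \<le> c" unfolding c_def using k(1) J(1) bk by (simp add: less_eq_div_iff_mult_less_eq mult.commute)
    have c2: "c < b * J"
    proof -
      have "n < b ^ (k + 1) * J" using k(2) J(1) by (simp add: div_less_iff_less_mult)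
      then have "n < (b * J) * b ^ k" by (simp add: mult_ac)
      then show ?thesis unfolding c_def using bk by (simp add: div_less_iff_less_mult)
    qed
    have lo: "b ^ k * c \<le> n" by (simp add: c_def)
    have hi: "n < b ^ k * (c + 1)" unfolding c_def using bk dividend_less_times_div[of "b ^ k" n] by simp
    have c0: "0 < real c" "real J \<le> real c" using c1 J by auto
    have n0: "0 < real n" using lo bk c0 by (metis mult_pos_pos of_nat_0_less_iff order_less_le_trans)
    have bk': "0 < real (b ^ k)" using bk by (simp only: of_nat_0_less_iff)
    have lo': "real (b ^ k * c) \<le> real n" and hi': "real n \<le> real (b ^ k * (c + 1))"
      using lo hi by (simp_all only: of_nat_le_iff less_imp_le)
    have bkc: "0 < real (b ^ k * c)" using bk c0 by (simp only: of_nat_0_less_iff) simp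
    have re: "real (b ^ k * c) = real (b ^ k) * real c" "real (b ^ k * (c + 1)) = real (b ^ k) * (real c + 1)"
      by (simp_all only: of_nat_mult of_nat_add of_nat_1)
    have frac: "s / (B * x) = s / (B * (x + 1)) * ((x + 1) / x)"
      "s / (B * x) * (x / (x + 1)) = s / (B * (x + 1))" if "0 < B" "0 < x" for s B x :: real
      using that by simp_all
    have lower_of_abs: "m - d \<le> x" if "\<bar>x - m\<bar> < d" for x :: real using that by linarith
    have up: "S n / real n \<le> (m + d) * ((real c + 1) / real c)"
    proof -
      have "S n / real n \<le> S (b ^ k * (c + 1)) / real (b ^ k * c)"
        using incseqD[OF mono, of n "b ^ k * (c + 1)"] hi lo' bkc Snn by (intro frac_le) auto
      also have "\<dots> = (S (b ^ k * (c + 1)) / real (b ^ k * (c + 1))) * ((real c + 1) / real c)"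
        unfolding re using bk' c0(1) by (rule frac)
      also have "\<dots> \<le> (m + d) * ((real c + 1) / real c)"
        using K[OF Kk, of "c + 1"] c1 c2 c0 by (intro mult_right_mono) (auto simp del: of_nat_power)
      finally show ?thesis .
    qed
    \<comment> \<open>If m < d, the lower bound m - e is negative and S n is nonnegative.\<close>
    have dn: "(m - d) * (1 - 1 / (real c + 1)) \<le> S n / real n \<or> m < d"
    proof (cases "m < d")
      case False
      have "(m - d) * (real c / (real c + 1)) \<le> (S (b ^ k * c) / real (b ^ k * c)) * (real c / (real c + 1))"
      proof (rule mult_right_mono)
        show "m - d \<le> S (b ^ k * c) / real (b ^ k * c)" 
          using K[OF Kk c1 less_imp_le[OF c2]] by (rule lower_of_abs)
      qed (use c0 in simp)
      also have "\<dots> = S (b ^ k * c) / real (b ^ k * (c + 1))"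
        unfolding re using bk' c0(1) by (rule frac)
      also have "\<dots> \<le> S n / real n"
        using incseqD[OF mono lo] hi' n0 Snn by (intro frac_le) auto
      finally show ?thesis using c0 by (simp add: field_simps)
    qed simp
    have inv: "1 / real c \<le> 1 / real J" "1 / (real c + 1) \<le> 1 / real J" using c0 J by (auto intro!: divide_left_mono)
    have A: "(m + 1) * (1 / real J) < e / 4" using J(2) by simp
    have up2: "S n / real n < m + e"
    proof -
      have "(m + d) * ((real c + 1) / real c) = (m + d) + (m + d) * (1 / real c)" using c0 by (simp add: field_simps)
      also have "(m + d) * (1 / real c) \<le> (m + 1) * (1 / real J)" using m0 d inv by (intro mult_mono) auto
      finally show ?thesis using up A d e by linarith
    qed
    have dn2: "m - e < S n / real n"
    proof (cases "m < d")
      case True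
      moreover have "0 \<le> S n / real n" using Snn[of n] n0 by simp
      ultimately show ?thesis using d e by linarith
    next
      case False
      have "(m - d) * (1 / (real c + 1)) \<le> (m + 1) * (1 / real J)" using False m0 d inv by (intro mult_mono) auto
      then have "(m - d) * (1 - 1 / (real c + 1)) \<ge> m - d - (m + 1) * (1 / real J)" by (simp add: algebra_simps)
      then show ?thesis using dn False A d e by linarith
    qed
    show ?case using up2 dn2 by (simp add: dist_real_def abs_less_iff)
  qed
qed

text \<open>  The sets in \<open>sigma_gen_by M X I\<close> are the measurable sets of a measure space on which all \<open>X i\<close>
  with \<open>i \<in> I\<close> are measurable. Measurability of functions of these variables can be derived there.\<close>
lemma measurable_history:
  assumes "i \<in> I"
  shows "X i \<in> borel_measurable (sigma (space M) (\<Union>i\<in>I. {X i -` A \<inter> space M | A. A \<in> sets borel}))"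
  using assms by (intro measurableI) (auto simp: space_measure_of_conv intro!: in_measure_of)

lemma sets_history:
  "sets (sigma (space M) (\<Union>i\<in>I. {X i -` A \<inter> space M | A. A \<in> sets borel})) = sigma_gen_by M X I"
  unfolding sigma_gen_by_def by (intro sets_measure_of) auto

text \<open>  All values under the suprema lie in \<open>[0, 1]\<close>, so both suprema are upper bounds.\<close>
lemma (in prob_space) alpha_coeff_upper:
  assumes "1 \<le> k" "A \<in> sigma_gen_by M X {1..k}" "B \<in> sigma_gen_by M X {k + n..}"
  shows "\<bar>prob (A \<inter> B) - prob A * prob B\<bar> \<le> alpha_coeff M X n"
proof -
  let ?f = "\<lambda>(A, B). \<bar>prob (A \<inter> B) - prob A * prob B\<bar>"
  let ?S = "\<lambda>k. sigma_gen_by M X {1..k} \<times> sigma_gen_by M X {k + n..}"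
  have le1: "?f z \<le> 1" for z
  proof (cases z)
    case (Pair A B)
    have "0 \<le> prob A * prob B" "prob A * prob B \<le> 1" by (auto intro!: mult_le_one)
    then have "\<bar>prob (A \<inter> B) - prob A * prob B\<bar> \<le> 1"
      using prob_le_1[of "A \<inter> B"] measure_nonneg[of M "A \<inter> B"] by linarith
    then show ?thesis using Pair by simp
  qed
  have ne: "?S k \<noteq> {}" for k using sigma_sets.Empty by (auto simp: sigma_gen_by_def)
  have "?f (A, B) \<le> (SUP z\<in>?S k. ?f z)"
    using assms le1 by (intro cSUP_upper bdd_aboveI2[where M=1]) auto
  also have "\<dots> \<le> alpha_coeff M X n"
    unfolding alpha_coeff_def
  proof (rule cSUP_upper)
    show "bdd_above ((\<lambda>k. SUP z\<in>?S k. ?f z) ` {1..})"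
      by (rule bdd_aboveI2[where M=1], rule cSUP_least[OF ne le1])
  qed (use assms in simp)
  finally show ?thesis by simp
qed

lemma (in prob_space) distr_eq_of_cdf_eq:
  assumes "Z \<in> borel_measurable M" "Y \<in> borel_measurable M"
    and "cdf (distr M borel Z) = cdf (distr M borel Y)"
  shows "distr M borel Z = distr M borel Y"
  using assms by (intro cdf_unique real_distribution_distr) auto

lemma excess_le_power:
  fixes u T p :: real
  assumes "0 < T" "0 \<le> u" "1 \<le> p"
  shows "max 0 (u - T) \<le> u powr p * T powr (1 - p)"
proof (cases "u \<le> T")
  case False
  then have "u - T \<le> u powr p * u powr (1 - p)" using assms by (simp add: powr_add[symmetric])
  also have "\<dots> \<le> u powr p * T powr (1 - p)" using False assms by (intro mult_left_mono powr_mono2') auto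
  finally show ?thesis using assms by simp
qed simp

text \<open>  Each summand is the integral of the quantile function of \<open>U\<close> over \<open>[0, \<alpha>(2\<^sup>k)]\<close>, written without
  the quantile function. In this form it is visibly monotone in the tails of \<open>U\<close>.\<close>
definition mixing_tails :: "'a measure \<Rightarrow> (nat \<Rightarrow> 'a \<Rightarrow> real) \<Rightarrow> ('a \<Rightarrow> real) \<Rightarrow> ennreal" where
  "mixing_tails M X U = (\<Sum>k. \<integral>\<^sup>+ t. indicator {0..} t *
    min (ennreal (alpha_coeff M X (2 ^ k))) (emeasure M {\<omega> \<in> space M. t < U \<omega>}) \<partial>lborel)"

text \<open>  Along \<open>n = 16\<^sup>k c\<close> the variables are truncated at \<open>2\<^sup>k\<close>. The expected excess over the truncation
  decreases geometrically because of the moment of order \<open>p > 1\<close>. The truncated sums are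
  controlled by \<open>deviation_of_weakly_dependent_sum\<close> with lag \<open>q = 2\<^sup>k\<close>: the covariance bounds
  are summable by the mixing assumption, and the remaining term is \<open>q T\<^sup>2 / n \<le> 8\<^sup>k / 16\<^sup>k\<close>.
  Nonnegativity makes the partial sums monotone and so fills the gaps.\<close>
lemma (in prob_space) mixing_slln:
  fixes X :: "nat \<Rightarrow> 'a \<Rightarrow> real" and v :: "real \<Rightarrow> real"
  assumes X: "\<And>i. 1 \<le> i \<Longrightarrow> X i \<in> borel_measurable M"
    and cdf: "\<And>i. 1 \<le> i \<Longrightarrow> cdf (distr M borel (X i)) = F"
    and v[measurable]: "v \<in> borel_measurable borel" and v0: "\<And>x. 0 \<le> v x"
    and p: "1 < p" and mom: "integrable M (\<lambda>\<omega>. v (X 1 \<omega>) powr p)"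
    and mix: "mixing_tails M X (\<lambda>\<omega>. v (X 1 \<omega>)) < \<infinity>"
  shows "AE \<omega> in M. (\<lambda>n. (\<Sum>i=1..n. v (X i \<omega>)) / real n) \<longlonglongrightarrow> expectation (\<lambda>\<omega>. v (X 1 \<omega>))"
proof -
  note [measurable] = X X[of 1, simplified]
  have dist: "distr M borel (X i) = distr M borel (X 1)" if "1 \<le> i" for i
    using distr_eq_of_cdf_eq[OF X[OF that] X[OF order_refl]] cdf[OF that] cdf[OF order_refl] by simp
  have same_int: "expectation (\<lambda>\<omega>. g (X i \<omega>)) = expectation (\<lambda>\<omega>. g (X 1 \<omega>))"
    if "1 \<le> i" and [measurable]: "g \<in> borel_measurable borel" for g :: "real \<Rightarrow> real" and i
    using integral_distr[OF X[OF that(1)] that(2)] integral_distr[OF X[OF order_refl] that(2)] dist[OF that(1)] by simp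
  have same_nn: "(\<integral>\<^sup>+ \<omega>. g (X i \<omega>) \<partial>M) = (\<integral>\<^sup>+ \<omega>. g (X 1 \<omega>) \<partial>M)"
    if "1 \<le> i" and [measurable]: "g \<in> borel_measurable borel" for g :: "real \<Rightarrow> ennreal" and i
  proof -
    have "(\<integral>\<^sup>+ \<omega>. g (X j \<omega>) \<partial>M) = (\<integral>\<^sup>+ x. g x \<partial>distr M borel (X j))" if "1 \<le> j" for j
      using X[OF that] by (subst nn_integral_distr) auto
    from this[OF that(1)] this[OF order_refl] show ?thesis using dist[OF that(1)] by simp
  qed
  define P where "P = (\<lambda>t. prob {\<omega> \<in> space M. t < v (X 1 \<omega>)})"
  have Peq: "prob {\<omega> \<in> space M. t < v (X i \<omega>)} = P t" if "1 \<le> i" for i t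
  proof -
    have "prob {\<omega> \<in> space M. t < v (X j \<omega>)} = measure (distr M borel (X j)) {x. t < v x}" if "1 \<le> j" for j
      using X[OF that] by (subst measure_distr) (auto intro!: arg_cong[where f=prob])
    from this[OF that] this[OF order_refl] show ?thesis using dist[OF that] by (simp add: P_def)
  qed
  define \<alpha> where "\<alpha> = alpha_coeff M X"
  have \<alpha>0: "0 \<le> \<alpha> n" for n
    using alpha_coeff_upper[of 1 "{}" X "{}" n] sigma_sets.Empty by (auto simp: \<alpha>_def sigma_gen_by_def)
  define U where "U = (\<lambda>\<omega>. v (X 1 \<omega>))"
  have [measurable]: "U \<in> borel_measurable M" unfolding U_def by simp
  have U0: "0 \<le> U \<omega>" for \<omega> by (simp add: U_def v0)
  define h where "h = (\<lambda>k::nat. \<integral>t. indicator {0..2 ^ k} t * min (\<alpha> (2 ^ k)) (P t) \<partial>lborel)"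
  have Pmeas[measurable]: "P \<in> borel_measurable borel"
  proof -
    have "(\<lambda>t. - P t) \<in> borel_measurable borel"
      by (intro borel_measurable_mono monoI) (auto simp: P_def intro!: finite_measure_mono)
    then show ?thesis by simp
  qed
  have hint: "integrable lborel (\<lambda>t. indicator {0..2 ^ k} t * min (\<alpha> (2 ^ k)) (P t))" for k :: nat
  proof (rule Bochner_Integration.integrable_bound)
    show "integrable lborel (\<lambda>t. indicator {0..2 ^ k :: real} t * (1 :: real))" by simp
    show "AE t in lborel. norm (indicator {0..2 ^ k} t * min (\<alpha> (2 ^ k)) (P t)) \<le> norm (indicator {0..2 ^ k :: real} t * (1::real))"
    proof (rule AE_I2)
      fix t
      have "0 \<le> min (\<alpha> (2 ^ k)) (P t)" "min (\<alpha> (2 ^ k)) (P t) \<le> 1"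
        using \<alpha>0 by (auto simp: P_def min_le_iff_disj)
      then show "norm (indicator {0..2 ^ k} t * min (\<alpha> (2 ^ k)) (P t)) \<le> norm (indicator {0..2 ^ k :: real} t * (1::real))"
        by (simp add: indicator_def)
    qed
  qed simp
  have h0: "0 \<le> h k" for k unfolding h_def using \<alpha>0 by (intro Bochner_Integration.integral_nonneg) (auto simp: P_def)
  have hsum: "summable h"
  proof (rule summable_suminf_not_top[OF h0])
    have "ennreal (h k) \<le> (\<integral>\<^sup>+ t. indicator {0..} t * min (ennreal (\<alpha> (2 ^ k)))
        (emeasure M {\<omega> \<in> space M. t < v (X 1 \<omega>)}) \<partial>lborel)" for k
    proof -
      have "ennreal (h k) = (\<integral>\<^sup>+ t. ennreal (indicator {0..2 ^ k} t * min (\<alpha> (2 ^ k)) (P t)) \<partial>lborel)"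
        unfolding h_def by (rule nn_integral_eq_integral[symmetric]) (use hint \<alpha>0 in \<open>auto simp: P_def\<close>)
      also have "\<dots> \<le> (\<integral>\<^sup>+ t. indicator {0..} t * min (ennreal (\<alpha> (2 ^ k)))
        (emeasure M {\<omega> \<in> space M. t < v (X 1 \<omega>)}) \<partial>lborel)"
        by (intro nn_integral_mono) (auto simp: indicator_def P_def emeasure_eq_measure min_def)
      finally show ?thesis .
    qed
    then have "(\<Sum>k. ennreal (h k)) \<le> (\<Sum>k. \<integral>\<^sup>+ t. indicator {0..} t * min (ennreal (\<alpha> (2 ^ k)))
        (emeasure M {\<omega> \<in> space M. t < v (X 1 \<omega>)}) \<partial>lborel)" by (intro suminf_le) auto
    also have "\<dots> < \<infinity>" using mix by (simp add: \<alpha>_def mixing_tails_def)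
    finally show "(\<Sum>k. ennreal (h k)) \<noteq> \<top>" by simp
  qed
  define tr where "tr = (\<lambda>(k::nat) x. min (v x) (2 ^ k))"
  define ex where "ex = (\<lambda>(k::nat) x. max 0 (v x - 2 ^ k))"
  have [measurable]: "tr k \<in> borel_measurable borel" "ex k \<in> borel_measurable borel" for k
    unfolding tr_def ex_def by measurable
  have split: "v x = tr k x + ex k x" for k x by (auto simp: tr_def ex_def)
  have tr01: "0 \<le> tr k x" "tr k x \<le> 2 ^ k" and ex0: "0 \<le> ex k x" for k x using v0 by (auto simp: tr_def ex_def)
  define m where "m = (\<lambda>k. expectation (\<lambda>\<omega>. tr k (X 1 \<omega>)))"
  define e where "e = (\<lambda>k. expectation (\<lambda>\<omega>. ex k (X 1 \<omega>)))"
  define C where "C = expectation (\<lambda>\<omega>. v (X 1 \<omega>) powr p)"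
  have exle: "ex k x \<le> v x powr p * (2 powr (1 - p)) ^ k" for k x
  proof -
    have "ex k x \<le> v x powr p * (2 ^ k) powr (1 - p)"
      unfolding ex_def using v0 p by (intro excess_le_power) auto
    also have "((2::real) ^ k) powr (1 - p) = (2 powr (1 - p)) ^ k"
      by (simp add: powr_realpow[symmetric] powr_powr mult.commute)
    finally show ?thesis .
  qed
  have exint: "integrable M (\<lambda>\<omega>. ex k (X 1 \<omega>))" for k
  proof (rule Bochner_Integration.integrable_bound)
    show "integrable M (\<lambda>\<omega>. v (X 1 \<omega>) powr p * (2 powr (1 - p)) ^ k)" using mom by simp
    show "AE \<omega> in M. norm (ex k (X 1 \<omega>)) \<le> norm (v (X 1 \<omega>) powr p * (2 powr (1 - p)) ^ k)"
      using exle ex0 by (intro AE_I2) auto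
  qed simp
  have trint: "integrable M (\<lambda>\<omega>. tr k (X 1 \<omega>))" for k
    using tr01 by (intro integrable_const_bound[where B="2 ^ k"] AE_I2) auto
  have e_le: "e k \<le> C * (2 powr (1 - p)) ^ k" for k
  proof -
    have "e k \<le> expectation (\<lambda>\<omega>. v (X 1 \<omega>) powr p * (2 powr (1 - p)) ^ k)"
      unfolding e_def using mom exint by (intro integral_mono exle) auto
    then show ?thesis by (simp add: C_def)
  qed
  have e0: "0 \<le> e k" for k unfolding e_def using ex0 by (intro Bochner_Integration.integral_nonneg)
  have ratio: "norm ((2::real) powr (1 - p)) < 1" using p by (simp add: powr_less_one)
  have esum: "summable e"
    by (rule summable_comparison_test'[OF summable_mult[OF summable_geometric[OF ratio]], where N=0])
       (use e_le e0 in auto)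
  have elim0: "e \<longlonglongrightarrow> 0" by (rule summable_LIMSEQ_zero[OF esum])
  have mean: "expectation U = m k + e k" for k
    unfolding m_def e_def U_def split[of _ k] using trint exint by simp
  have sub: "AE \<omega> in M. (\<lambda>k. (\<Sum>i=1..16 ^ k * c. v (X i \<omega>)) / real (16 ^ k * c)) \<longlonglongrightarrow> expectation U"
    if c: "1 \<le> c" for c :: nat
  proof -
    define n where "n = (\<lambda>k. 16 ^ k * c)"
    have n0: "0 < real (n k)" for k using c by (simp add: n_def)
    define Y where "Y = (\<lambda>k \<omega>. (\<Sum>i=1..n k. tr k (X i \<omega>) - m k) / real (n k))"
    define Q where "Q = (\<lambda>k \<omega>. (\<Sum>i=1..n k. ex k (X i \<omega>)) / real (n k))"
    have meas_tr: "(\<lambda>\<omega>. tr k (X i \<omega>)) \<in> borel_measurable M" if "1 \<le> i" for i k using X[OF that] by measurable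
    have meas_ex: "(\<lambda>\<omega>. ex k (X i \<omega>)) \<in> borel_measurable M" if "1 \<le> i" for i k using X[OF that] by measurable
    have Ymeas[measurable]: "Y k \<in> borel_measurable M" for k
      unfolding Y_def using meas_tr by (intro borel_measurable_divide borel_measurable_sum borel_measurable_diff) auto
    have Qmeas[measurable]: "Q k \<in> borel_measurable M" for k
      unfolding Q_def using meas_ex by (intro borel_measurable_divide borel_measurable_sum) auto
    have "AE \<omega> in M. (\<lambda>k. Y k \<omega>) \<longlonglongrightarrow> 0"
    proof (rule AE_tendsto_0_of_summable_tails)
      fix d :: real assume d: "0 < d"
      have bound: "prob {\<omega> \<in> space M. d \<le> \<bar>Y k \<omega>\<bar>} \<le> 6 / d * h k + 3 / d\<^sup>2 * (1/2) ^ k" for k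
      proof -
        have "{\<omega> \<in> space M. d \<le> \<bar>Y k \<omega>\<bar>} = {\<omega> \<in> space M. d * real (n k) \<le> \<bar>\<Sum>i=1..n k. tr k (X i \<omega>) - m k\<bar>}"
          using n0[of k] by (auto simp: Y_def pos_le_divide_eq)
        also have "prob \<dots> \<le> 3 * real (n k) * (2 * h k / (d * real (n k)) + real (2 ^ k) * (2 ^ k)\<^sup>2 / (d * real (n k))\<^sup>2)"
        proof (rule deviation_of_weakly_dependent_sum)
          fix i :: nat and f :: "real \<Rightarrow> real"
          assume i: "2 ^ k < i" and f[measurable]: "f \<in> borel_measurable borel" and f01: "\<And>x. 0 \<le> f x" "\<And>x. f x \<le> 1"
          define Z where "Z = (\<lambda>\<omega>. f (\<Sum>j=1..i - 2 ^ k. tr k (X j \<omega>)))"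
          have i1: "1 \<le> i" "1 \<le> i - 2 ^ k" using i by auto
          have Zm[measurable]: "Z \<in> borel_measurable M"
            unfolding Z_def using meas_tr by (intro measurable_compose[OF _ f] borel_measurable_sum) auto
          have "\<bar>expectation (\<lambda>\<omega>. Z \<omega> * tr k (X i \<omega>)) - expectation Z * expectation (\<lambda>\<omega>. tr k (X i \<omega>))\<bar>
            \<le> (\<integral>t. indicator {0..2 ^ k} t * min (\<alpha> (2 ^ k)) (prob {\<omega> \<in> space M. t < tr k (X i \<omega>)}) \<partial>lborel)"
          proof (rule covariance_le_of_level_sets)
            fix z t
            let ?G = "\<lambda>I. sigma (space M) (\<Union>i\<in>I. {X i -` A \<inter> space M | A. A \<in> sets borel})"
            have "{\<omega> \<in> space (?G {1..i - 2 ^ k}). z < Z \<omega>} \<in> sets (?G {1..i - 2 ^ k})"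
            proof -
              have "Z \<in> borel_measurable (?G {1..i - 2 ^ k})"
                unfolding Z_def
                by (intro measurable_compose[OF _ f] borel_measurable_sum measurable_compose[OF measurable_history]) auto
              then show ?thesis by measurable
            qed
            then have A: "{\<omega> \<in> space M. z < Z \<omega>} \<in> sigma_gen_by M X {1..i - 2 ^ k}"
              unfolding sets_history by (simp add: space_measure_of_conv)
            have "{\<omega> \<in> space (?G {i - 2 ^ k + 2 ^ k..}). t < tr k (X i \<omega>)} \<in> sets (?G {i - 2 ^ k + 2 ^ k..})"
            proof -
              have [measurable]: "X i \<in> borel_measurable (?G {i - 2 ^ k + 2 ^ k..})"
                using i by (intro measurable_history) auto
              show ?thesis by measurable
            qed
            then have B: "{\<omega> \<in> space M. t < tr k (X i \<omega>)} \<in> sigma_gen_by M X {i - 2 ^ k + 2 ^ k..}"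
              unfolding sets_history by (simp add: space_measure_of_conv)
            show "\<bar>prob ({\<omega> \<in> space M. z < Z \<omega>} \<inter> {\<omega> \<in> space M. t < tr k (X i \<omega>)})
               - prob {\<omega> \<in> space M. z < Z \<omega>} * prob {\<omega> \<in> space M. t < tr k (X i \<omega>)}\<bar> \<le> \<alpha> (2 ^ k)"
              unfolding \<alpha>_def using i1(2) A B by (rule alpha_coeff_upper)
          qed (use meas_tr[OF i1(1)] f01 tr01 in \<open>auto simp: Z_def[abs_def] Zm[unfolded Z_def]\<close>)
          also have "\<dots> \<le> h k"
            unfolding h_def
          proof (rule integral_mono'[OF hint])
            fix t
            have "prob {\<omega> \<in> space M. t < tr k (X i \<omega>)} \<le> P t"
              unfolding Peq[OF i1(1), symmetric] using X[OF i1(1)]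
              by (intro finite_measure_mono) (auto simp: tr_def)
            then show "indicator {0..2 ^ k} t * min (\<alpha> (2 ^ k)) (prob {\<omega> \<in> space M. t < tr k (X i \<omega>)})
               \<le> indicator {0..2 ^ k} t * min (\<alpha> (2 ^ k)) (P t)"
              by (auto simp: indicator_def min_def)
            show "0 \<le> indicator {0..2 ^ k} t * min (\<alpha> (2 ^ k)) (P t)" using \<alpha>0 by (simp add: P_def)
          qed
          finally show "\<bar>expectation (\<lambda>\<omega>. f (\<Sum>j=1..i - 2 ^ k. tr k (X j \<omega>)) * tr k (X i \<omega>))
             - expectation (\<lambda>\<omega>. f (\<Sum>j=1..i - 2 ^ k. tr k (X j \<omega>))) * m k\<bar> \<le> h k"
            using same_int[OF i1(1), of "tr k"] by (simp add: Z_def m_def)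
        next
          fix i :: nat assume "1 \<le> i"
          from same_int[OF this, of "tr k"] show "expectation (\<lambda>\<omega>. tr k (X i \<omega>)) = m k"
            by (simp add: m_def)
        qed (use meas_tr tr01 h0 d n0 in auto)
        also have "\<dots> = 6 / d * h k + 3 / d\<^sup>2 * (8 ^ k / real (n k))"
        proof -
          have "real (2 ^ k) * (2 ^ k)\<^sup>2 = 8 ^ k"
            by (simp add: power2_eq_square power_mult_distrib[symmetric])
          then show ?thesis using d n0[of k] by (simp only:) (simp add: field_simps power2_eq_square)
        qed
        also have "8 ^ k / real (n k) \<le> (1/2) ^ k"
        proof -
          have "(8::real) ^ k / real (n k) \<le> 8 ^ k / 16 ^ k"
            using c by (intro divide_left_mono) (auto simp: n_def)
          also have "\<dots> = (1/2) ^ k" by (simp add: power_divide[symmetric])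
          finally show ?thesis .
        qed
        finally show ?thesis using d by (simp add: divide_right_mono)
      qed
      show "summable (\<lambda>k. prob {\<omega> \<in> space M. d \<le> \<bar>Y k \<omega>\<bar>})"
      proof (rule summable_comparison_test'[where N=0])
        show "summable (\<lambda>k. 6 / d * h k + 3 / d\<^sup>2 * (1/2) ^ k)"
          by (intro summable_add summable_mult hsum summable_geometric) simp
      qed (use bound in auto)
    qed (auto simp: finite_measure_axioms)
    moreover have "AE \<omega> in M. (\<lambda>k. ennreal (Q k \<omega>)) \<longlonglongrightarrow> 0"
    proof (rule AE_tendsto_0_of_summable_expectations)
      have "(\<integral>\<^sup>+ \<omega>. ennreal (Q k \<omega>) \<partial>M) = ennreal (e k)" for k
      proof -
        have "(\<integral>\<^sup>+ \<omega>. ennreal (Q k \<omega>) \<partial>M) = (\<integral>\<^sup>+ \<omega>. (\<Sum>i=1..n k. ennreal (ex k (X i \<omega>))) * ennreal (1 / real (n k)) \<partial>M)"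
          unfolding Q_def using ex0 n0[of k]
          by (intro nn_integral_cong) (simp add: sum_ennreal sum_nonneg ennreal_mult'[symmetric])
        also have "\<dots> = (\<Sum>i=1..n k. \<integral>\<^sup>+ \<omega>. ennreal (ex k (X i \<omega>)) \<partial>M) * ennreal (1 / real (n k))"
          using meas_ex by (subst nn_integral_multc, simp, subst nn_integral_sum) auto
        also have "(\<Sum>i=1..n k. \<integral>\<^sup>+ \<omega>. ennreal (ex k (X i \<omega>)) \<partial>M) = (\<Sum>i=1..n k. ennreal (e k))"
        proof (intro sum.cong refl)
          fix i assume "i \<in> {1..n k}"
          then have "(\<integral>\<^sup>+ \<omega>. ennreal (ex k (X i \<omega>)) \<partial>M) = (\<integral>\<^sup>+ \<omega>. ennreal (ex k (X 1 \<omega>)) \<partial>M)"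
            by (intro same_nn) auto
          also have "\<dots> = ennreal (e k)" unfolding e_def using exint ex0 by (intro nn_integral_eq_integral) auto
          finally show "(\<integral>\<^sup>+ \<omega>. ennreal (ex k (X i \<omega>)) \<partial>M) = ennreal (e k)" .
        qed
        also have "\<dots> * ennreal (1 / real (n k)) = ennreal (e k)"
          using e0[of k] n0[of k] by (simp add: sum_ennreal ennreal_mult'[symmetric] ennreal_of_nat_eq_real_of_nat)
        finally show ?thesis .
      qed
      then have "(\<Sum>k. \<integral>\<^sup>+ \<omega>. ennreal (Q k \<omega>) \<partial>M) = ennreal (suminf e)" using suminf_ennreal2[OF e0 esum] by simp
      then show "(\<Sum>k. \<integral>\<^sup>+ \<omega>. ennreal (Q k \<omega>) \<partial>M) < \<infinity>" by simp
    qed simp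
    ultimately show ?thesis
    proof eventually_elim
      case (elim \<omega>)
      have Q0: "0 \<le> Q k \<omega>" for k unfolding Q_def using ex0 by (intro divide_nonneg_nonneg sum_nonneg) auto
      have "(\<lambda>k. Q k \<omega>) \<longlonglongrightarrow> 0"
        using elim(2) Q0 by (intro tendsto_ennrealD[where F=sequentially]) auto
      then have "(\<lambda>k. expectation U + (Y k \<omega> + Q k \<omega> - e k)) \<longlonglongrightarrow> expectation U + (0 + 0 - 0)"
        by (intro tendsto_intros elim(1) elim0)
      moreover have "(\<Sum>i=1..16 ^ k * c. v (X i \<omega>)) / real (16 ^ k * c) = expectation U + (Y k \<omega> + Q k \<omega> - e k)" for k
      proof -
        have "(\<Sum>i=1..n k. v (X i \<omega>)) = (\<Sum>i=1..n k. tr k (X i \<omega>)) + (\<Sum>i=1..n k. ex k (X i \<omega>))"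
          unfolding split[of _ k] by (rule sum.distrib)
        then have "(\<Sum>i=1..n k. v (X i \<omega>)) / real (n k) = Y k \<omega> + m k + Q k \<omega>"
          using n0[of k] by (simp add: Y_def Q_def sum_subtractf diff_divide_distrib add_divide_distrib)
        then show ?thesis using mean[of k] by (simp add: n_def)
      qed
      ultimately show ?case by simp
    qed
  qed
  have "AE \<omega> in M. \<forall>c. (\<lambda>k. (\<Sum>i=1..16 ^ k * Suc c. v (X i \<omega>)) / real (16 ^ k * Suc c)) \<longlonglongrightarrow> expectation U"
    unfolding AE_all_countable by (intro allI sub) simp
  then show ?thesis
  proof eventually_elim
    case (elim \<omega>)
    show ?case unfolding U_def[symmetric]
    proof (rule tendsto_average_of_geometric_subsequences[where b=16])
      show "incseq (\<lambda>n. \<Sum>i=1..n. v (X i \<omega>))" using v0 by (intro incseq_SucI) simp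
      fix c :: nat assume "1 \<le> c"
      then show "(\<lambda>k. (\<Sum>i=1..16 ^ k * c. v (X i \<omega>)) / real (16 ^ k * c)) \<longlonglongrightarrow> expectation U"
        using elim[rule_format, of "c - 1"] by simp
    qed auto
  qed
qed

section \<open>Weighted convergence under alpha-mixing\<close>

text \<open>  Decompose dyadically: \<open>F(Z)\<^bsup>-\<theta>\<^esup>\<close> is at most \<open>2\<^bsup>\<theta>(k+1)\<^esup>\<close> where \<open>2\<^bsup>-k-1\<^esup> < F(Z) \<le> 2\<^bsup>-k\<^esup>\<close>, an event of
  probability at most \<open>2\<^bsup>-k\<^esup>\<close>.\<close>
lemma (in prob_space) nn_integral_cdf_powr_neg_finite:
  assumes [measurable]: "Z \<in> borel_measurable M" and cdf: "cdf (distr M borel Z) = F"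
    and th: "0 \<le> \<theta>" "\<theta> < 1"
  shows "(\<integral>\<^sup>+ \<omega>. F (Z \<omega>) powr (- \<theta>) \<partial>M) < \<infinity>"
proof -
  have [measurable]: "F \<in> borel_measurable borel" using borel_measurable_cdf_of[OF _ cdf] by simp
  note F01 = cdf_of_bounds[OF assms(1) cdf]
  define w where "w = (\<lambda>k::nat. (2 powr \<theta>) * (2 powr \<theta>) ^ k :: real)"
  have w0: "0 \<le> w k" for k by (simp add: w_def)
  define g where "g = (\<lambda>(k::nat) \<omega>. ennreal (w k) * indicator {\<omega> \<in> space M. F (Z \<omega>) \<le> (1/2) ^ k} \<omega>)"
  have pt: "ennreal (F (Z \<omega>) powr (- \<theta>)) \<le> (\<Sum>k. g k \<omega>)" if om: "\<omega> \<in> space M" and pos: "0 < F (Z \<omega>)" for \<omega>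
  proof -
    let ?u = "F (Z \<omega>)"
    obtain n :: nat where "(1/2) ^ n < ?u" using real_arch_pow_inv[OF pos, of "1/2"] by auto
    moreover have "(1/2::real) ^ Suc n \<le> (1/2) ^ n" by (intro power_decreasing) auto
    ultimately have "(1/2) ^ Suc n < ?u" by linarith
    then have ex: "\<exists>n::nat. (1/2) ^ Suc n < ?u" by blast
    define k where "k = (LEAST n::nat. (1/2) ^ Suc n < ?u)"
    have k1: "(1/2) ^ Suc k < ?u" unfolding k_def using LeastI_ex[OF ex] .
    have k2: "?u \<le> (1/2) ^ k"
    proof (cases k)
      case 0
      then show ?thesis using F01 by simp
    next
      case (Suc j)
      then have "\<not> (1/2) ^ Suc j < ?u" using not_less_Least[of j "\<lambda>n. (1/2) ^ Suc n < ?u"] by (simp add: k_def)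
      then show ?thesis using Suc by simp
    qed
    have "?u powr (- \<theta>) \<le> ((1/2) ^ Suc k) powr (- \<theta>)"
      using k1 th by (intro powr_mono2') auto
    also have "\<dots> = w k"
    proof -
      have "(1/2::real) ^ Suc k = 2 powr (- real (Suc k))"
        unfolding powr_minus_divide powr_realpow[OF zero_less_numeral] by (rule power_one_over)
      moreover have "w k = 2 powr (\<theta> + \<theta> * real k)" by (simp add: w_def powr_power powr_add mult.commute)
      moreover have "- real (Suc k) * - \<theta> = \<theta> + \<theta> * real k" by (simp add: algebra_simps)
      ultimately show ?thesis by (simp only: powr_powr)
    qed
    finally have "ennreal (?u powr (- \<theta>)) \<le> ennreal (w k)" by (rule ennreal_leI)
    also have "\<dots> = g k \<omega>" using k2 om by (simp add: g_def)
    also have "\<dots> \<le> (\<Sum>k. g k \<omega>)" using sum_le_suminf[of "\<lambda>k. g k \<omega>" "{k}"] by simp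
    finally show ?thesis .
  qed
  have "(\<integral>\<^sup>+ \<omega>. F (Z \<omega>) powr (- \<theta>) \<partial>M) \<le> (\<integral>\<^sup>+ \<omega>. (\<Sum>k. g k \<omega>) \<partial>M)"
  proof (rule nn_integral_mono_AE)
    show "AE \<omega> in M. ennreal (F (Z \<omega>) powr (- \<theta>)) \<le> (\<Sum>k. g k \<omega>)"
      using AE_cdf_pos[OF assms(1) cdf] AE_space by eventually_elim (rule pt)
  qed
  also have "\<dots> = (\<Sum>k. \<integral>\<^sup>+ \<omega>. g k \<omega> \<partial>M)" unfolding g_def by (rule nn_integral_suminf) simp
  also have "\<dots> \<le> (\<Sum>k. ennreal (2 powr \<theta> * (2 powr \<theta> / 2) ^ k))"
  proof (intro suminf_le)
    fix k
    have "(\<integral>\<^sup>+ \<omega>. g k \<omega> \<partial>M) = ennreal (w k * prob {\<omega> \<in> space M. F (Z \<omega>) \<le> (1/2) ^ k})"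
      unfolding g_def using w0 by (simp add: nn_integral_cmult emeasure_eq_measure ennreal_mult)
    also have "\<dots> \<le> ennreal (w k * (1/2) ^ k)"
      using prob_cdf_le[OF assms(1) cdf, of "(1/2) ^ k"] w0 by (intro ennreal_leI mult_left_mono) auto
    also have "w k * (1/2) ^ k = 2 powr \<theta> * (2 powr \<theta> / 2) ^ k" by (simp add: w_def power_divide)
    finally show "(\<integral>\<^sup>+ \<omega>. g k \<omega> \<partial>M) \<le> ennreal (2 powr \<theta> * (2 powr \<theta> / 2) ^ k)" .
  qed auto
  also have "\<dots> < \<infinity>"
  proof -
    have "2 powr \<theta> < 2 powr (1::real)" using th by (intro powr_less_mono) auto
    then have "summable (\<lambda>k. 2 powr \<theta> * (2 powr \<theta> / 2) ^ k)" by (intro summable_mult summable_geometric) simp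
    then show ?thesis by (subst suminf_ennreal2) auto
  qed
  finally show ?thesis .
qed

lemma (in prob_space) mixing_slln_dominated:
  fixes X :: "nat \<Rightarrow> 'a \<Rightarrow> real" and v :: "real \<Rightarrow> real"
  assumes X: "\<And>i. 1 \<le> i \<Longrightarrow> X i \<in> borel_measurable M"
    and cdf: "\<And>i. 1 \<le> i \<Longrightarrow> cdf (distr M borel (X i)) = F"
    and v[measurable]: "v \<in> borel_measurable borel" and v0: "\<And>x. 0 \<le> v x"
    and p: "1 < p" and mom: "integrable M (\<lambda>\<omega>. v (X 1 \<omega>) powr p)"
    and U[measurable]: "U \<in> borel_measurable M" and dom: "AE \<omega> in M. v (X 1 \<omega>) \<le> U \<omega>"
    and mix: "mixing_tails M X U < \<infinity>"
  shows "AE \<omega> in M. (\<lambda>n. (\<Sum>i=1..n. v (X i \<omega>)) / real n) \<longlonglongrightarrow> expectation (\<lambda>\<omega>. v (X 1 \<omega>))"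
proof (rule mixing_slln[where X=X and F=F and p=p])
  note [measurable] = X[OF order_refl]
  have le: "emeasure M {\<omega> \<in> space M. t < v (X 1 \<omega>)} \<le> emeasure M {\<omega> \<in> space M. t < U \<omega>}" for t
    using dom by (intro emeasure_mono_AE) auto
  have "mixing_tails M X (\<lambda>\<omega>. v (X 1 \<omega>))
     \<le> mixing_tails M X U"
    unfolding mixing_tails_def by (intro suminf_le nn_integral_mono mult_left_mono min.mono le) auto
  then show "mixing_tails M X (\<lambda>\<omega>. v (X 1 \<omega>)) < \<infinity>" using mix by (rule order_le_less_trans)
qed (fact X cdf v v0 p mom)+

text \<open>  The Markov inequality for the monotone function \<open>H\<^sup>\<gamma>\<close>.\<close>
lemma emeasure_atLeast_le_powr:
  fixes N :: "real measure" and H :: "real \<Rightarrow> real"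
  assumes N: "sets N = sets borel" and [measurable]: "H \<in> borel_measurable borel"
    and mono: "mono H" and H0: "0 < H y" and g: "0 \<le> \<gamma>"
  shows "emeasure N {y..} \<le> ennreal (H y powr (- \<gamma>)) * (\<integral>\<^sup>+ x. H x powr \<gamma> \<partial>N)"
proof -
  note [measurable_cong] = N
  have "{y..} \<in> sets N" by (simp add: N)
  then have "ennreal (H y powr \<gamma>) * emeasure N {y..} = (\<integral>\<^sup>+ x. ennreal (H y powr \<gamma>) * indicator {y..} x \<partial>N)"
    by (rule nn_integral_cmult_indicator[symmetric])
  also have "\<dots> \<le> (\<integral>\<^sup>+ x. H x powr \<gamma> \<partial>N)"
    using H0 g by (intro nn_integral_mono) (auto simp: indicator_def intro!: ennreal_leI powr_mono2 monoD[OF mono])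
  finally have "ennreal (H y powr (- \<gamma>)) * (ennreal (H y powr \<gamma>) * emeasure N {y..})
    \<le> ennreal (H y powr (- \<gamma>)) * (\<integral>\<^sup>+ x. H x powr \<gamma> \<partial>N)" by (intro mult_left_mono) auto
  moreover have "ennreal (H y powr (- \<gamma>)) * ennreal (H y powr \<gamma>) = 1"
    using H0 by (simp add: ennreal_mult[symmetric] powr_add[symmetric])
  ultimately show ?thesis by (simp add: mult.assoc[symmetric])
qed

text \<open>  \<open>W(X\<^sub>i) = N [X\<^sub>i, \<infinity>)\<close> satisfies \<open>\<integral> F\<^sub>n dN = (W(X\<^sub>1) + ... + W(X\<^sub>n)) / n\<close> and has mean \<open>\<integral> F dN\<close>. It is
  bounded by a multiple of \<open>F(X\<^sub>i)\<^bsup>-\<gamma>\<^esup>\<close> and therefore has a moment of some order \<open>p > 1\<close>. The strong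
  law for \<open>W(X\<^sub>i)\<close> and for the indicators gives the hypotheses of the lemma of Scheffe:
  \<open>F\<^sub>n \<rightarrow> F\<close> holds \<open>N\<close>-almost everywhere and \<open>\<integral> F\<^sub>n dN \<rightarrow> \<integral> F dN\<close>.\<close>
lemma (in prob_space) mixing_weighted_slln:
  fixes X :: "nat \<Rightarrow> 'a \<Rightarrow> real"
  assumes X: "\<And>i. 1 \<le> i \<Longrightarrow> X i \<in> borel_measurable M"
    and cdf: "\<And>i. 1 \<le> i \<Longrightarrow> cdf (distr M borel (X i)) = F"
    and N: "sigma_finite_measure N" "sets N = sets borel"
    and g: "0 < \<gamma>" "\<gamma> < 1"
    and fin: "(\<integral>\<^sup>+ x. F x powr \<gamma> \<partial>N) < \<infinity>"
    and U[measurable]: "U \<in> borel_measurable M" and U1: "\<And>\<omega>. 1 \<le> U \<omega>"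
    and C: "0 < C" and dom: "AE \<omega> in M. emeasure N {X 1 \<omega>..} \<le> ennreal (C * U \<omega>)"
    and mix: "mixing_tails M X U < \<infinity>"
  shows "AE \<omega> in M. (\<lambda>n. \<integral>\<^sup>+ x. \<bar>emp_cdf X n \<omega> x - F x\<bar> \<partial>N) \<longlonglongrightarrow> 0"
proof -
  note [measurable] = X X[OF order_refl] and N(2)[measurable_cong]
  interpret N: sigma_finite_measure N by fact
  interpret P: pair_sigma_finite M N ..
  have spN[simp]: "space N = UNIV" using sets_eq_imp_space_eq[OF N(2)] by simp
  note F01 = cdf_of_bounds[OF X[OF order_refl] cdf[OF order_refl]]
  have Fm[measurable]: "F \<in> borel_measurable borel"
    using borel_measurable_cdf_of[OF X[OF order_refl] cdf[OF order_refl]] .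
  have emx[measurable]: "(\<lambda>x. emp_cdf X n \<omega> x) \<in> borel_measurable borel" for n \<omega>
    unfolding emp_cdf_def by measurable
  define \<Lambda> where "\<Lambda> = (\<integral>\<^sup>+ x. F x powr \<gamma> \<partial>N)"
  obtain \<Lambda>r where \<Lambda>r: "\<Lambda> = ennreal \<Lambda>r" "0 \<le> \<Lambda>r" using fin unfolding \<Lambda>_def[symmetric] by (cases \<Lambda>) auto
  define W where "W = (\<lambda>y. enn2real (emeasure N {y..}))"
  have W0: "0 \<le> W y" for y by (simp add: W_def)
  have Wm[measurable]: "(\<lambda>y. emeasure N {y..}) \<in> borel_measurable borel"
  proof -
    have "(\<lambda>y. emeasure N (Pair y -` {(y, x). y \<le> x})) \<in> borel_measurable borel"
    proof (rule N.measurable_emeasure_Pair)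
      have "{z \<in> space (borel \<Otimes>\<^sub>M N). fst z \<le> snd z} \<in> sets (borel \<Otimes>\<^sub>M N)" by measurable
      then show "{(y, x). y \<le> x} \<in> sets (borel \<Otimes>\<^sub>M N)"
        by (simp add: space_pair_measure case_prod_beta')
    qed
    then show ?thesis by (simp add: vimage_def atLeast_def)
  qed
  then have [measurable]: "W \<in> borel_measurable borel" unfolding W_def by measurable
  have Nle: "emeasure N {y..} \<le> ennreal (\<Lambda>r * F y powr (- \<gamma>))" if y: "0 < F y" for y
    using emeasure_atLeast_le_powr[OF N(2) Fm F01(3) y, of \<gamma>] g(1) \<Lambda>r
    by (simp add: \<Lambda>_def ennreal_mult'[symmetric] mult.commute)
  have Nfin: "emeasure N {y..} = ennreal (W y)" "W y \<le> \<Lambda>r * F y powr (- \<gamma>)" if y: "0 < F y" for y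
  proof -
    have "emeasure N {y..} < \<top>" using Nle[OF y] by (rule order_le_less_trans) simp
    then show "emeasure N {y..} = ennreal (W y)" by (simp add: W_def)
    then show "W y \<le> \<Lambda>r * F y powr (- \<gamma>)" using Nle[OF y] \<Lambda>r by (simp add: W0)
  qed
  have pos: "AE \<omega> in M. \<forall>i. 0 < F (X (Suc i) \<omega>)"
    unfolding AE_all_countable using AE_cdf_pos[OF X cdf] by auto
  \<comment> \<open>The choice solves \<open>\<gamma> p = (1 + \<gamma>) / 2\<close>, which is less than 1.\<close>
  define p where "p = (1 + \<gamma>) / (2 * \<gamma>)"
  have p: "1 < p" "0 \<le> \<gamma> * p" "\<gamma> * p < 1" using g by (auto simp: p_def field_simps)
  have Wmom: "integrable M (\<lambda>\<omega>. W (X 1 \<omega>) powr p)"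
  proof (rule integrableI_bounded)
    have "(\<integral>\<^sup>+ \<omega>. norm (W (X 1 \<omega>) powr p) \<partial>M) \<le> (\<integral>\<^sup>+ \<omega>. ennreal (\<Lambda>r powr p) * ennreal (F (X 1 \<omega>) powr (- (\<gamma> * p))) \<partial>M)"
    proof (rule nn_integral_mono_AE)
      show "AE \<omega> in M. ennreal (norm (W (X 1 \<omega>) powr p)) \<le> ennreal (\<Lambda>r powr p) * ennreal (F (X 1 \<omega>) powr (- (\<gamma> * p)))"
        using AE_cdf_pos[OF X[OF order_refl] cdf[OF order_refl]]
      proof eventually_elim
        case (elim \<omega>)
        have "W (X 1 \<omega>) powr p \<le> (\<Lambda>r * F (X 1 \<omega>) powr (- \<gamma>)) powr p"
          using Nfin(2)[OF elim] W0 p by (intro powr_mono2) auto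
        also have "\<dots> = \<Lambda>r powr p * F (X 1 \<omega>) powr (- (\<gamma> * p))"
          using \<Lambda>r by (simp add: powr_mult powr_powr)
        finally show ?case by (simp add: ennreal_mult[symmetric])
      qed
    qed
    also have "\<dots> = ennreal (\<Lambda>r powr p) * (\<integral>\<^sup>+ \<omega>. F (X 1 \<omega>) powr (- (\<gamma> * p)) \<partial>M)"
      by (rule nn_integral_cmult) measurable
    also have "\<dots> < \<infinity>"
      using nn_integral_cdf_powr_neg_finite[OF X[OF order_refl] cdf[OF order_refl] p(2,3)] by (simp add: ennreal_mult_less_top)
    finally show "(\<integral>\<^sup>+ \<omega>. norm (W (X 1 \<omega>) powr p) \<partial>M) < \<infinity>" .
  qed measurable
  have sllnW: "AE \<omega> in M. (\<lambda>n. (\<Sum>i=1..n. W (X i \<omega>) / C) / real n) \<longlonglongrightarrow> expectation (\<lambda>\<omega>. W (X 1 \<omega>) / C)"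
  proof (rule mixing_slln_dominated[OF X cdf _ _ p(1) _ U _ mix])
    show "integrable M (\<lambda>\<omega>. (W (X 1 \<omega>) / C) powr p)"
      using Wmom C W0 by (simp add: powr_divide)
    show "AE \<omega> in M. W (X 1 \<omega>) / C \<le> U \<omega>"
      using dom AE_cdf_pos[OF X[OF order_refl] cdf[OF order_refl]]
    proof eventually_elim
      case (elim \<omega>)
      have "0 \<le> C * U \<omega>" using C U1[of \<omega>] by simp
      then have "W (X 1 \<omega>) \<le> C * U \<omega>" using elim(1) Nfin(1)[OF elim(2)] by simp
      then show ?case using C by (simp add: pos_divide_le_eq mult.commute)
    qed
  qed (use C W0 in auto)
  have slln1: "AE \<omega> in M. (\<lambda>n. emp_cdf X n \<omega> x) \<longlonglongrightarrow> F x" for x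
  proof -
    have "AE \<omega> in M. (\<lambda>n. (\<Sum>i=1..n. indicator {..x} (X i \<omega>)) / real n) \<longlonglongrightarrow> expectation (\<lambda>\<omega>. indicator {..x} (X 1 \<omega>))"
    proof (rule mixing_slln_dominated[OF X cdf _ _ p(1) _ U _ mix])
      show "integrable M (\<lambda>\<omega>. (indicator {..x} (X 1 \<omega>) :: real) powr p)"
        by (rule integrable_const_bound[where B=1]) (auto simp: indicator_def)
      show "AE \<omega> in M. indicator {..x} (X 1 \<omega>) \<le> U \<omega>"
        using U1 by (intro AE_I2) (auto simp: indicator_def intro: order_trans[OF zero_le_one])
    qed auto
    moreover have "expectation (\<lambda>\<omega>. indicator {..x} (X 1 \<omega>)) = F x"
    proof -
      have "expectation (\<lambda>\<omega>. indicator {..x} (X 1 \<omega>)) = expectation (indicat_real {\<omega> \<in> space M. X 1 \<omega> \<le> x})"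
        by (intro Bochner_Integration.integral_cong) (auto simp: indicator_def)
      then show ?thesis using prob_le_eq_cdf[OF X[OF order_refl] cdf[OF order_refl]] by simp
    qed
    moreover have "(\<Sum>i=1..n. indicator {..x} (X i \<omega>)) / real n = emp_cdf X n \<omega> x" for n \<omega>
      unfolding emp_cdf_def by (intro arg_cong2[where f="(/)"] sum.cong refl) (auto simp: indicator_def)
    ultimately show ?thesis by simp
  qed
  have mean: "ennreal (expectation (\<lambda>\<omega>. W (X 1 \<omega>))) = (\<integral>\<^sup>+ x. F x \<partial>N)" and intW: "integrable M (\<lambda>\<omega>. W (X 1 \<omega>))"
  proof -
    show int: "integrable M (\<lambda>\<omega>. W (X 1 \<omega>))"
    proof (rule Bochner_Integration.integrable_bound)
      show "integrable M (\<lambda>\<omega>. 1 + W (X 1 \<omega>) powr p)" using Wmom by simp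
      have "w \<le> 1 + w powr p" if "0 \<le> w" for w :: real
      proof (cases "w \<le> 1")
        case False
        then have "w powr 1 \<le> w powr p" using p by (intro powr_mono) auto
        then show ?thesis using that by simp
      qed (auto simp: add_increasing2)
      then show "AE \<omega> in M. norm (W (X 1 \<omega>)) \<le> norm (1 + W (X 1 \<omega>) powr p)"
        using W0 by (intro AE_I2) simp
    qed measurable
    have "ennreal (expectation (\<lambda>\<omega>. W (X 1 \<omega>))) = (\<integral>\<^sup>+ \<omega>. ennreal (W (X 1 \<omega>)) \<partial>M)"
      using int W0 by (intro nn_integral_eq_integral[symmetric]) auto
    also have "\<dots> = (\<integral>\<^sup>+ \<omega>. emeasure N {X 1 \<omega>..} \<partial>M)"
      using AE_cdf_pos[OF X[OF order_refl] cdf[OF order_refl]] Nfin(1)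
      by (intro nn_integral_cong_AE) (auto elim!: eventually_mono)
    also have "\<dots> = (\<integral>\<^sup>+ \<omega>. (\<integral>\<^sup>+ x. (if X 1 \<omega> \<le> x then 1 else 0) \<partial>N) \<partial>M)"
    proof (intro nn_integral_cong)
      fix \<omega>
      have "(\<integral>\<^sup>+ x. (if X 1 \<omega> \<le> x then 1 else 0) \<partial>N) = (\<integral>\<^sup>+ x. indicator {X 1 \<omega>..} x \<partial>N)"
        by (intro nn_integral_cong) (auto simp: indicator_def)
      then show "emeasure N {X 1 \<omega>..} = (\<integral>\<^sup>+ x. (if X 1 \<omega> \<le> x then 1 else 0) \<partial>N)" by simp
    qed
    also have "\<dots> = (\<integral>\<^sup>+ x. (\<integral>\<^sup>+ \<omega>. (if X 1 \<omega> \<le> x then 1 else 0) \<partial>M) \<partial>N)"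
      by (rule P.Fubini'[symmetric]) measurable
    also have "\<dots> = (\<integral>\<^sup>+ x. F x \<partial>N)"
    proof (intro nn_integral_cong)
      fix x
      have "(\<integral>\<^sup>+ \<omega>. (if X 1 \<omega> \<le> x then 1 else 0) \<partial>M) = (\<integral>\<^sup>+ \<omega>. indicator {\<omega> \<in> space M. X 1 \<omega> \<le> x} \<omega> \<partial>M)"
        by (intro nn_integral_cong) (auto simp: indicator_def)
      then show "(\<integral>\<^sup>+ \<omega>. (if X 1 \<omega> \<le> x then 1 else 0) \<partial>M) = ennreal (F x)"
        using prob_le_eq_cdf[OF X[OF order_refl] cdf[OF order_refl]] by (simp add: emeasure_eq_measure)
    qed
    finally show "ennreal (expectation (\<lambda>\<omega>. W (X 1 \<omega>))) = (\<integral>\<^sup>+ x. F x \<partial>N)" .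
  qed
  \<comment> \<open>Convergence is expressed with countable quantifiers, so that the set of pairs \<open>(\<omega>, x)\<close> is measurable
    and the quantifiers "almost surely" and "almost everywhere" can be exchanged.\<close>
  let ?conv = "\<lambda>\<omega> x. \<forall>m::nat. \<exists>n0::nat. \<forall>n\<ge>n0. \<bar>emp_cdf X n \<omega> x - F x\<bar> < 1 / real (Suc m)"
  have conv: "?conv \<omega> x \<longleftrightarrow> (\<lambda>n. emp_cdf X n \<omega> x) \<longlonglongrightarrow> F x" for \<omega> x
  proof
    assume c: "?conv \<omega> x"
    show "(\<lambda>n. emp_cdf X n \<omega> x) \<longlonglongrightarrow> F x"
    proof (rule LIMSEQ_I)
      fix r :: real assume "0 < r"
      then obtain m where "1 / real (Suc m) < r" using nat_approx_posE by blast
      moreover obtain n0 where "\<forall>n\<ge>n0. \<bar>emp_cdf X n \<omega> x - F x\<bar> < 1 / real (Suc m)" using c by blast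
      ultimately show "\<exists>no. \<forall>n\<ge>no. norm (emp_cdf X n \<omega> x - F x) < r" by force
    qed
  next
    assume "(\<lambda>n. emp_cdf X n \<omega> x) \<longlonglongrightarrow> F x"
    then show "?conv \<omega> x" using LIMSEQ_D[of "\<lambda>n. emp_cdf X n \<omega> x" "F x"] by (simp add: real_norm_def)
  qed
  have ae: "AE \<omega> in M. AE x in N. (\<lambda>n. emp_cdf X n \<omega> x) \<longlonglongrightarrow> F x"
  proof -
    have [measurable]: "(\<lambda>z. emp_cdf X n (fst z) (snd z)) \<in> borel_measurable (M \<Otimes>\<^sub>M N)" for n
      using measurable_emp_cdf_pair[of X M N n, OF X N(2)] by (simp add: case_prod_beta')
    have "{z \<in> space (M \<Otimes>\<^sub>M N). ?conv (fst z) (snd z)} \<in> sets (M \<Otimes>\<^sub>M N)" by measurable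
    then have "(AE \<omega> in M. AE x in N. ?conv \<omega> x) \<longleftrightarrow> (AE x in N. AE \<omega> in M. ?conv \<omega> x)"
      by (rule P.AE_commute)
    then show ?thesis unfolding conv using slln1 by simp
  qed
  show ?thesis using ae sllnW pos
  proof eventually_elim
    case (elim \<omega>)
    have posi: "0 < F (X i \<omega>)" if "1 \<le> i" for i using elim(3)[rule_format, of "i - 1"] that by simp
    have emp_int: "(\<integral>\<^sup>+ x. emp_cdf X n \<omega> x \<partial>N) = ennreal ((\<Sum>i=1..n. W (X i \<omega>)) / real n)" for n
    proof (cases "n = 0")
      case True
      then show ?thesis by (simp add: emp_cdf_def)
    next
      case False
      have "ennreal (emp_cdf X n \<omega> x) = (\<Sum>i=1..n. indicator {X i \<omega>..} x) * ennreal (1 / real n)" for x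
      proof -
        have "emp_cdf X n \<omega> x = (\<Sum>i=1..n. indicator {X i \<omega>..} x) * (1 / real n)" by (simp add: emp_cdf_def)
        also have "ennreal \<dots> = ennreal (\<Sum>i=1..n. indicator {X i \<omega>..} x) * ennreal (1 / real n)"
          by (intro ennreal_mult sum_nonneg) auto
        also have "ennreal (\<Sum>i=1..n. indicator {X i \<omega>..} x) = (\<Sum>i=1..n. indicator {X i \<omega>..} x)"
          by (subst sum_ennreal[symmetric]) (auto simp: ennreal_indicator)
        finally show ?thesis .
      qed
      then have "(\<integral>\<^sup>+ x. emp_cdf X n \<omega> x \<partial>N) = (\<Sum>i=1..n. emeasure N {X i \<omega>..}) * ennreal (1 / real n)"
        by (simp add: nn_integral_multc nn_integral_sum)
      also have "(\<Sum>i=1..n. emeasure N {X i \<omega>..}) = (\<Sum>i=1..n. ennreal (W (X i \<omega>)))"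
        using Nfin(1)[OF posi] by (intro sum.cong) auto
      also have "\<dots> * ennreal (1 / real n) = ennreal ((\<Sum>i=1..n. W (X i \<omega>)) * (1 / real n))"
        using W0 by (subst ennreal_mult) (auto simp: sum_ennreal intro!: sum_nonneg)
      finally show ?thesis by simp
    qed
    have "(\<lambda>n. C * ((\<Sum>i=1..n. W (X i \<omega>) / C) / real n)) \<longlonglongrightarrow> C * expectation (\<lambda>\<omega>. W (X 1 \<omega>) / C)"
      by (intro tendsto_mult tendsto_const elim(2))
    then have lim: "(\<lambda>n. (\<Sum>i=1..n. W (X i \<omega>)) / real n) \<longlonglongrightarrow> expectation (\<lambda>\<omega>. W (X 1 \<omega>))"
      using C by (simp add: sum_divide_distrib[symmetric])
    have "(\<lambda>n. \<integral>\<^sup>+ x. norm (emp_cdf X n \<omega> x - F x) \<partial>N) \<longlonglongrightarrow> 0"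
    proof (rule Scheffe_lemma1)
      show "integrable N (emp_cdf X n \<omega>)" for n
        using emp_int[of n] by (intro integrableI_nonneg) (auto simp: emp_cdf_bounds)
      show "integrable N F"
        using mean[symmetric] F01(1) by (intro integrableI_nonneg) auto
      have eq: "(\<integral>\<^sup>+ x. norm (emp_cdf X n \<omega> x) \<partial>N) = ennreal ((\<Sum>i=1..n. W (X i \<omega>)) / real n)" for n
        using emp_int[of n] by (simp add: emp_cdf_bounds)
      have "(\<lambda>n. \<integral>\<^sup>+ x. norm (emp_cdf X n \<omega> x) \<partial>N) \<longlonglongrightarrow> ennreal (expectation (\<lambda>\<omega>. W (X 1 \<omega>)))"
        unfolding eq by (intro tendsto_ennrealI lim)
      then have "limsup (\<lambda>n. \<integral>\<^sup>+ x. norm (emp_cdf X n \<omega> x) \<partial>N) = ennreal (expectation (\<lambda>\<omega>. W (X 1 \<omega>)))"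
        by (intro lim_imp_Limsup) auto
      then show "limsup (\<lambda>n. \<integral>\<^sup>+ x. norm (emp_cdf X n \<omega> x) \<partial>N) \<le> (\<integral>\<^sup>+ x. norm (F x) \<partial>N)"
        using mean F01(1) by simp
    qed (use elim(1) in auto)
    then show ?case by simp
  qed
qed

section \<open>Reflection and the weight function\<close>

text \<open>  If \<open>F (y\<^sub>k) > 0\<close> tends to 0, the events \<open>Z \<le> y\<^sub>k\<close> shrink to a null set, so the integral of
  \<open>1 / F(Z)\<close> over them would have to vanish in the limit. But \<open>1 / F(Z) \<ge> 1 / F(y\<^sub>k)\<close> on an event of
  probability \<open>F(y\<^sub>k)\<close>, so each of these integrals is at least 1.\<close>
lemma (in prob_space) cdf_bounded_below_of_inverse_integrable:
  assumes [measurable]: "Z \<in> borel_measurable M" and cdf: "cdf (distr M borel Z) = F"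
    and fin: "(\<integral>\<^sup>+ \<omega>. 1 / F (Z \<omega>) \<partial>M) < \<infinity>"
  shows "\<exists>c>0. \<forall>x. 0 < F x \<longrightarrow> c \<le> F x"
proof (rule ccontr)
  assume "\<not> ?thesis"
  then have small: "\<exists>x. 0 < F x \<and> F x < c" if "0 < c" for c using that by (meson not_le)
  have [measurable]: "F \<in> borel_measurable borel" using borel_measurable_cdf_of[OF _ cdf] by simp
  note F01 = cdf_of_bounds[OF assms(1) cdf] and pos = AE_cdf_pos[OF assms(1) cdf]
  have "\<forall>k::nat. \<exists>x. 0 < F x \<and> F x < 1 / real (Suc k)" using small by simp
  then obtain y where y: "\<And>k::nat. 0 < F (y k)" "\<And>k. F (y k) < 1 / real (Suc k)" by metis
  define f where "f = (\<lambda>\<omega>. 1 / F (Z \<omega>))"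
  have f0: "0 \<le> f \<omega>" for \<omega> using F01(1) by (simp add: f_def)
  have fint: "integrable M f"
    using fin F01(1) by (intro integrableI_nonneg) (auto simp: f_def)
  have lim: "(\<lambda>k. expectation (\<lambda>\<omega>. f \<omega> * indicator {..y k} (Z \<omega>))) \<longlonglongrightarrow> expectation (\<lambda>\<omega>. 0)"
  proof (rule integral_dominated_convergence[where w=f])
    show "AE \<omega> in M. (\<lambda>k. f \<omega> * indicator {..y k} (Z \<omega>)) \<longlonglongrightarrow> 0"
      using pos
    proof eventually_elim
      case (elim \<omega>)
      then obtain k0 :: nat where k0: "1 / real (Suc k0) < F (Z \<omega>)" using nat_approx_posE by blast
      have "\<forall>\<^sub>F k in sequentially. f \<omega> * indicator {..y k} (Z \<omega>) = 0"
        using eventually_ge_at_top[of k0]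
      proof eventually_elim
        case (elim k)
        then have "1 / real (Suc k) \<le> 1 / real (Suc k0)" by (intro divide_left_mono) auto
        then have "F (y k) < F (Z \<omega>)" using y(2)[of k] k0 by linarith
        then have "\<not> Z \<omega> \<le> y k" using monoD[OF F01(3), of "Z \<omega>" "y k"] by auto
        then show ?case by simp
      qed
      then show ?case by (rule tendsto_eventually)
    qed
    show "AE \<omega> in M. norm (f \<omega> * indicator {..y k} (Z \<omega>)) \<le> f \<omega>" for k
      using f0 by (auto simp: indicator_def)
  qed (use fint in \<open>auto simp: f_def\<close>)
  have ge1: "1 \<le> expectation (\<lambda>\<omega>. f \<omega> * indicator {..y k} (Z \<omega>))" for k
  proof -
    have int: "integrable M (\<lambda>\<omega>. f \<omega> * indicator {..y k} (Z \<omega>))"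
      by (rule Bochner_Integration.integrable_bound[OF fint]) (use f0 in \<open>auto simp: f_def indicator_def\<close>)
    have "1 = 1 / F (y k) * prob {\<omega> \<in> space M. Z \<omega> \<le> y k}"
      using y(1)[of k] prob_le_eq_cdf[OF assms(1) cdf] by simp
    also have "\<dots> = expectation (\<lambda>\<omega>. 1 / F (y k) * indicator {\<omega> \<in> space M. Z \<omega> \<le> y k} \<omega>)" by simp
    also have "\<dots> \<le> expectation (\<lambda>\<omega>. f \<omega> * indicator {..y k} (Z \<omega>))"
    proof (rule integral_mono_AE)
      show "AE \<omega> in M. 1 / F (y k) * indicator {\<omega> \<in> space M. Z \<omega> \<le> y k} \<omega> \<le> f \<omega> * indicator {..y k} (Z \<omega>)"
        using pos
      proof eventually_elim
        case (elim \<omega>)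
        then show ?case using monoD[OF F01(3), of "Z \<omega>" "y k"]
          by (auto simp: f_def indicator_def intro!: divide_left_mono)
      qed
    qed (use int in \<open>auto simp: emeasure_eq_measure\<close>)
    finally show ?thesis .
  qed
  have "1 \<le> expectation (\<lambda>\<omega>. 0 :: real)" by (rule tendsto_lowerbound[OF lim]) (use ge1 in auto)
  then show False by simp
qed

text \<open>  \<open>F'\<close>, the distribution function of \<open>-Z\<close>, satisfies \<open>F'(-x) = P(Z \<ge> x)\<close>. This exceeds \<open>1 - F x\<close> by the
  mass of the point \<open>x\<close>, and there are at most countably many atoms. The difference matters when
  \<open>F'(-Z)\<close> and \<open>1 - F(Z)\<close> are compared as random variables.\<close>
lemma (in prob_space) reflected_cdf:
  fixes Z :: "'a \<Rightarrow> real"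
  assumes [measurable]: "Z \<in> borel_measurable M" and cdf: "cdf (distr M borel Z) = F"
    and cdf': "cdf (distr M borel (\<lambda>\<omega>. - Z \<omega>)) = F'"
  shows "F' (- x) = prob {\<omega> \<in> space M. x \<le> Z \<omega>}"
    and "1 - F x \<le> F' (- x)"
    and "AE x in lborel. F' (- x) = 1 - F x"
    and "(F \<longlongrightarrow> 1 - F' (- x)) (at_left x)"
proof -
  interpret D: real_distribution "distr M borel Z" by simp
  show 1: "F' (- x) = prob {\<omega> \<in> space M. x \<le> Z \<omega>}" for x
    using prob_le_eq_cdf[OF _ cdf', of "- x"] by simp
  have compl: "F' (- x) = 1 - prob {\<omega> \<in> space M. Z \<omega> < x}" for x
  proof -
    have "prob {\<omega> \<in> space M. x \<le> Z \<omega>} = 1 - prob {\<omega> \<in> space M. \<not> x \<le> Z \<omega>}"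
      by (subst prob_neg[symmetric]) auto
    then show ?thesis using 1 by (simp add: not_le)
  qed
  have lt: "prob {\<omega> \<in> space M. Z \<omega> < x} = measure (distr M borel Z) {..<x}" for x
    by (subst measure_distr) (auto intro!: arg_cong[where f=prob])
  have "prob {\<omega> \<in> space M. Z \<omega> < x} \<le> prob {\<omega> \<in> space M. Z \<omega> \<le> x}"
    by (intro finite_measure_mono) auto
  then show "1 - F x \<le> F' (- x)" using compl[of x] prob_le_eq_cdf[OF assms(1) cdf, of x] by simp
  show "AE x in lborel. F' (- x) = 1 - F x"
  proof -
    have "{x. measure (distr M borel Z) {x} > 0} \<in> null_sets lborel"
      using D.countable_atoms by (rule countable_imp_null_set_lborel)
    then have "AE x in lborel. x \<notin> {x. measure (distr M borel Z) {x} > 0}" by (rule AE_not_in)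
    then show ?thesis
    proof eventually_elim
      case (elim x)
      then have z: "measure (distr M borel Z) {x} = 0" by (simp add: measure_nonneg antisym not_less)
      have "F x = measure (distr M borel Z) ({..<x} \<union> {x})"
        unfolding cdf[symmetric] cdf_def by (intro arg_cong[where f="measure _"]) auto
      also have "\<dots> = measure (distr M borel Z) {..<x} + measure (distr M borel Z) {x}"
        by (rule D.finite_measure_Union) auto
      finally show ?case using z compl[of x] lt[of x] by simp
    qed
  qed
  show "(F \<longlongrightarrow> 1 - F' (- x)) (at_left x)"
    using D.cdf_at_left[of x] unfolding cdf by (simp add: compl lt)
qed

lemma emp_cdf_reflected:
  assumes "1 \<le> n"
  shows "AE x in lborel. emp_cdf (\<lambda>i \<omega>. - X i \<omega>) n \<omega> (- x) = 1 - emp_cdf X n \<omega> x"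
proof -
  have "(\<lambda>i. X i \<omega>) ` {1..n} \<in> null_sets lborel" by (intro finite_imp_null_set_lborel) simp
  then have "AE x in lborel. x \<notin> (\<lambda>i. X i \<omega>) ` {1..n}" by (rule AE_not_in)
  then show ?thesis
  proof eventually_elim
    case (elim x)
    have "indicator {- X i \<omega>..} (- x) = (1 - indicator {X i \<omega>..} x :: real)" if "i \<in> {1..n}" for i
      using elim that by (auto simp: indicator_def)
    then have "(\<Sum>i=1..n. indicator {- X i \<omega>..} (- x) :: real) = real n - (\<Sum>i=1..n. indicator {X i \<omega>..} x)"
      by (simp add: sum_subtractf)
    then show ?case using assms by (simp add: emp_cdf_def diff_divide_distrib)
  qed
qed

lemma alpha_coeff_reflected: "alpha_coeff M (\<lambda>i \<omega>. - X i \<omega>) = alpha_coeff M X"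
proof -
  have "{(\<lambda>\<omega>. - X i \<omega>) -` A \<inter> space M | A. A \<in> sets borel} = {X i -` A \<inter> space M | A. A \<in> sets borel}" for i
  proof -
    have "\<exists>B. (\<lambda>\<omega>. - Y \<omega>) -` A \<inter> space M = Y -` B \<inter> space M \<and> B \<in> sets borel"
      if "A \<in> sets borel" for A :: "real set" and Y :: "'a \<Rightarrow> real"
    proof (intro exI conjI)
      show "uminus -` A \<in> sets borel" using measurable_sets[of uminus borel borel A] that by simp
    qed auto
    from this[of _ "X i"] this[of _ "\<lambda>\<omega>. - X i \<omega>"] show ?thesis by (auto 4 3)
  qed
  then have "sigma_gen_by M (\<lambda>i \<omega>. - X i \<omega>) = sigma_gen_by M X"
    by (simp add: sigma_gen_by_def fun_eq_iff)
  then show ?thesis by (simp add: alpha_coeff_def fun_eq_iff)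
qed

lemma (in prob_space) median_facts:
  assumes [measurable]: "Z \<in> borel_measurable M" and cdf: "cdf (distr M borel Z) = F"
    and cdf': "cdf (distr M borel (\<lambda>\<omega>. - Z \<omega>)) = F'"
  defines "c \<equiv> Inf {x. 1 / 2 \<le> F x}"
  shows "\<And>x. x < c \<Longrightarrow> F x < 1 / 2" "\<And>x. c \<le> x \<Longrightarrow> 1 / 2 \<le> F x" "\<And>x. x \<le> c \<Longrightarrow> 1 / 2 \<le> F' (- x)"
proof -
  interpret D: real_distribution "distr M borel Z" by simp
  note F01 = cdf_of_bounds[OF assms(1) cdf]
  have top: "(F \<longlongrightarrow> 1) at_top" and bot: "(F \<longlongrightarrow> 0) at_bot"
    using D.cdf_lim_at_top_prob D.cdf_lim_at_bot by (simp_all add: cdf)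
  let ?S = "{x. 1 / 2 \<le> F x}"
  have "\<forall>\<^sub>F x in at_top. 1/2 < F x" using top by (rule order_tendstoD) simp
  then have ne: "?S \<noteq> {}" by (auto simp: eventually_at_top_linorder intro: less_imp_le)
  have "\<forall>\<^sub>F x in at_bot. F x < 1/2" using bot by (rule order_tendstoD) simp
  then obtain b where b: "\<And>x. x \<le> b \<Longrightarrow> F x < 1/2" by (auto simp: eventually_at_bot_linorder)
  have bdd: "bdd_below ?S"
  proof (rule bdd_belowI[of _ b])
    fix x assume "x \<in> ?S"
    then show "b \<le> x" using b[of x] by (cases "x \<le> b") auto
  qed
  show lt: "F x < 1 / 2" if "x < c" for x
  proof (rule ccontr)
    assume "\<not> F x < 1 / 2"
    then have "c \<le> x" unfolding c_def using bdd by (intro cInf_lower) auto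
    then show False using that by simp
  qed
  have gt: "1 / 2 \<le> F x" if cx: "c < x" for x
  proof -
    obtain z where "z \<in> ?S" "z < x" using cx cInf_less_iff[OF ne bdd, of x] unfolding c_def by blast
    then show ?thesis using monoD[OF F01(3), of z x] by auto
  qed
  have "(F \<longlongrightarrow> F c) (at_right c)"
    using D.cdf_is_right_cont[of c] unfolding cdf by (simp add: continuous_within)
  then have Fc: "1 / 2 \<le> F c"
  proof (rule tendsto_lowerbound)
    show "\<forall>\<^sub>F x in at_right c. 1 / 2 \<le> F x"
      using eventually_at_right_less by eventually_elim (rule gt)
  qed simp
  show "1 / 2 \<le> F x" if "c \<le> x" for x using Fc gt that by (cases "x = c") auto
  show "1 / 2 \<le> F' (- x)" if "x \<le> c" for x
  proof -
    have "1 - F' (- x) \<le> 1 / 2"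
      by (rule tendsto_upperbound[OF reflected_cdf(4)[OF assms(1) cdf cdf', of x]])
        (use that lt in \<open>auto simp: eventually_at_left_field less_imp_le intro!: exI[of _ "x - 1"]\<close>)
    then show ?thesis by simp
  qed
qed

lemma phi_weight_ge_1:
  assumes "\<And>x. 0 \<le> F x" "\<And>x. F x \<le> 1" "0 \<le> \<gamma>"
  shows "1 \<le> phi_weight \<gamma> F x"
proof -
  have "1 \<le> u powr (- \<gamma>)" if "0 < u" "u \<le> 1" for u :: real
  proof -
    have "1 powr (- \<gamma>) \<le> u powr (- \<gamma>)" using that assms(3) by (intro powr_mono2') auto
    then show ?thesis by simp
  qed
  from this[of "F x"] this[of "1 - F x"] show ?thesis
    using assms(1)[of x] assms(2)[of x] by (cases "F x = 0"; cases "F x = 1") (simp_all add: phi_weight_def)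
qed

lemma phi_weight_measurable:
  assumes [measurable]: "F \<in> borel_measurable borel"
  shows "phi_weight \<gamma> F \<in> borel_measurable borel"
  unfolding phi_weight_def[abs_def] by measurable

text \<open>  The two powers are compared with \<open>\<phi>\<close> separately on both sides of its split point \<open>s\<close>. On its own
  side, each power is \<open>\<phi>\<close> or at most \<open>\<phi>\<close>; on the other side its base is at least \<open>F s\<close> or \<open>F'(-s)\<close>.
  Where \<open>F\<close> is 1, \<open>\<phi>\<close> is 1 by convention. Almost surely the only such value of \<open>Z\<close> is the right
  endpoint \<open>b\<close> of the support, so a constant suffices there as well.\<close>
lemma (in prob_space) phi_weight_dominates:
  fixes Z :: "'a \<Rightarrow> real"
  assumes Z[measurable]: "Z \<in> borel_measurable M" and cdf: "cdf (distr M borel Z) = F"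
    and cdf': "cdf (distr M borel (\<lambda>\<omega>. - Z \<omega>)) = F'" and g: "0 \<le> \<gamma>"
  shows "\<exists>C>0. AE \<omega> in M. F (Z \<omega>) powr (- \<gamma>) \<le> C * phi_weight \<gamma> F (Z \<omega>) \<and>
      F' (- Z \<omega>) powr (- \<gamma>) \<le> C * phi_weight \<gamma> F (Z \<omega>)"
proof -
  interpret D: real_distribution "distr M borel Z" by simp
  note F01 = cdf_of_bounds[OF Z cdf]
  have [measurable]: "F \<in> borel_measurable borel" using borel_measurable_cdf_of[OF Z cdf] .
  have Zm[measurable]: "(\<lambda>\<omega>. - Z \<omega>) \<in> borel_measurable M" by simp
  note F'01 = cdf_of_bounds[OF Zm cdf']
  note R = reflected_cdf[OF Z cdf cdf'] and med = median_facts[OF Z cdf cdf']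
  define s where "s = split_point F"
  define \<phi> where "\<phi> = phi_weight \<gamma> F"
  have \<phi>1: "1 \<le> \<phi> x" for x unfolding \<phi>_def by (rule phi_weight_ge_1[OF F01(1,2) g])
  have Fs: "0 < F s"
    using med(2)[OF order_refl] by (auto simp: s_def split_point_def)
  have F's: "0 < F' (- s)"
  proof (cases "0 < F 0 \<and> F 0 < 1")
    case True
    then show ?thesis using R(2)[of 0] by (simp add: s_def split_point_def)
  next
    case False
    then show ?thesis using med(3)[OF order_refl] by (auto simp: s_def split_point_def)
  qed
  have neg: "v powr (- \<gamma>) \<le> u powr (- \<gamma>)" if "0 < u" "u \<le> v" for u v :: real
    using that g by (intro powr_mono2') auto
  define b where "b = Inf {x. F x = 1}"
  define C where "C = 1 + F s powr (- \<gamma>) + F' (- s) powr (- \<gamma>) + F' (- b) powr (- \<gamma>)"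
  have C: "0 < C" "1 \<le> C" "F s powr (- \<gamma>) \<le> C" "F' (- s) powr (- \<gamma>) \<le> C" "F' (- b) powr (- \<gamma>) \<le> C"
    using powr_ge_zero[of "F s" "- \<gamma>"] powr_ge_zero[of "F' (- s)" "- \<gamma>"] powr_ge_zero[of "F' (- b)" "- \<gamma>"]
    unfolding C_def by linarith+
  have up: "u \<le> C * \<phi> x" if "u \<le> C" for u x
  proof -
    have "C * 1 \<le> C * \<phi> x" using \<phi>1[of x] C by (intro mult_left_mono) auto
    then show ?thesis using that by simp
  qed
  have up1: "\<phi> x \<le> C * \<phi> x" for x
    using \<phi>1[of x] C mult_right_mono[of 1 C "\<phi> x"] by simp
  have end_point: "AE \<omega> in M. F (Z \<omega>) = 1 \<longrightarrow> Z \<omega> = b"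
  proof (cases "\<exists>x. F x = 1")
    case False
    then show ?thesis by simp
  next
    case True
    then have ne: "{x. F x = 1} \<noteq> {}" by auto
    have "(F \<longlongrightarrow> 0) at_bot" using D.cdf_lim_at_bot by (simp add: cdf)
    then have "\<forall>\<^sub>F x in at_bot. F x < 1" by (rule order_tendstoD) simp
    then obtain a where a: "\<And>x. x \<le> a \<Longrightarrow> F x < 1" by (auto simp: eventually_at_bot_linorder)
    have bdd: "bdd_below {x. F x = 1}"
    proof (rule bdd_belowI[of _ a])
      fix x assume "x \<in> {x. F x = 1}"
      then show "a \<le> x" using a[of x] by (cases "x \<le> a") auto
    qed
    have gt: "F x = 1" if bx: "b < x" for x
    proof -
      obtain z where "F z = 1" "z < x" using bx cInf_less_iff[OF ne bdd, of x] unfolding b_def by blast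
      then show ?thesis using monoD[OF F01(3), of z x] F01(2)[of x] by auto
    qed
    have "(F \<longlongrightarrow> F b) (at_right b)"
      using D.cdf_is_right_cont[of b] unfolding cdf by (simp add: continuous_within)
    then have "1 \<le> F b"
      by (rule tendsto_lowerbound) (auto simp: eventually_at_right_field gt intro!: exI[of _ "b + 1"])
    then have Fb: "prob {\<omega> \<in> space M. Z \<omega> \<le> b} = 1"
      using prob_le_eq_cdf[OF Z cdf, of b] F01(2)[of b] by simp
    have "AE \<omega> in M. \<omega> \<in> {\<omega> \<in> space M. Z \<omega> \<le> b}"
      by (rule AE_prob_1[OF Fb])
    then show ?thesis
    proof eventually_elim
      case (elim \<omega>)
      show ?case
      proof
        assume "F (Z \<omega>) = 1"
        then have "b \<le> Z \<omega>" unfolding b_def using bdd by (intro cInf_lower) auto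
        then show "Z \<omega> = b" using elim by simp
      qed
    qed
  qed
  have "AE \<omega> in M. F (Z \<omega>) powr (- \<gamma>) \<le> C * \<phi> (Z \<omega>) \<and> F' (- Z \<omega>) powr (- \<gamma>) \<le> C * \<phi> (Z \<omega>)"
    using end_point AE_cdf_pos[OF Z cdf]
  proof eventually_elim
    case (elim \<omega>)
    let ?x = "Z \<omega>"
    show ?case
    proof (cases "?x < s")
      case True
      then have eq: "\<phi> ?x = F ?x powr (- \<gamma>)" using elim(2) by (simp add: \<phi>_def phi_weight_def s_def)
      have "F' (- s) \<le> F' (- ?x)" using True by (intro monoD[OF F'01(3)]) simp
      then have "F' (- ?x) powr (- \<gamma>) \<le> C" using neg[OF F's] C(4) by fastforce
      from up[OF this, of ?x] show ?thesis using up1[of ?x] eq by simp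
    next
      case False
      then have "F s \<le> F ?x" by (intro monoD[OF F01(3)]) simp
      then have "F ?x powr (- \<gamma>) \<le> C" using neg[OF Fs] C(3) by fastforce
      moreover have "F' (- ?x) powr (- \<gamma>) \<le> C * \<phi> ?x"
      proof (cases "F ?x = 1")
        case True
        then have "?x = b" using elim(1) by simp
        then show ?thesis using up C(5) by simp
      next
        case False
        then have "\<phi> ?x = (1 - F ?x) powr (- \<gamma>)" using \<open>\<not> ?x < s\<close> by (simp add: \<phi>_def phi_weight_def s_def)
        moreover have "F' (- ?x) powr (- \<gamma>) \<le> (1 - F ?x) powr (- \<gamma>)"
          using False F01(2)[of ?x] R(2)[of ?x] by (intro neg) auto
        ultimately show ?thesis using up1[of ?x] by simp
      qed
      ultimately show ?thesis using up by simp
    qed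
  qed
  then show ?thesis using C(1) unfolding \<phi>_def by blast
qed

section \<open>The logarithmic mixing condition\<close>

text \<open>  By Tonelli the sum is the integral over \<open>s\<close> in \<open>(0,1)\<close> of the number of \<open>k\<close> with \<open>\<alpha>(2\<^sup>k) > s\<close>
  times the length of \<open>{t \<ge> 0. P(U > t) > s}\<close>. Every such \<open>k\<close> satisfies \<open>2\<^sup>k \<le> A s\<close>, where \<open>A s\<close> is
  the inverse of \<open>\<alpha>\<close> at \<open>s/2\<close>, so the number of \<open>k\<close> is of order \<open>ln (1 + A s)\<close>. The length is at
  most the quantile \<open>Q s\<close> of \<open>U\<close>.\<close>
lemma (in prob_space) summable_truncated_tails:
  fixes X :: "nat \<Rightarrow> 'a \<Rightarrow> real"
  assumes U[measurable]: "U \<in> borel_measurable M" and G: "G = cdf (distr M borel U)"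
    and am: "alpha_mixing M X"
    and int: "set_integrable lborel {0..1} (\<lambda>s. ln (1 + right_inv (alpha_ext M X) (s / 2)) * right_inv (\<lambda>y. 1 - G y) s)"
  shows "mixing_tails M X U < \<infinity>"
proof -
  define \<alpha> where "\<alpha> = (\<lambda>k::nat. alpha_coeff M X (2 ^ k))"
  define P where "P = (\<lambda>t. prob {\<omega> \<in> space M. t < U \<omega>})"
  have P1: "P t \<le> 1" "0 \<le> P t" for t by (auto simp: P_def)
  have Pmono: "P t \<le> P s" if "s \<le> t" for s t unfolding P_def using that by (intro finite_measure_mono) auto
  have [measurable]: "P \<in> borel_measurable borel"
  proof -
    have "(\<lambda>t. - P t) \<in> borel_measurable borel"
      using Pmono by (intro borel_measurable_mono monoI) simp
    then show ?thesis by simp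
  qed
  have GP: "1 - G t = P t" for t
  proof -
    have "prob {\<omega> \<in> space M. t < U \<omega>} = 1 - prob {\<omega> \<in> space M. \<not> t < U \<omega>}"
      by (subst prob_neg[symmetric]) auto
    then show ?thesis using prob_le_eq_cdf[OF U G[symmetric], of t] by (simp add: P_def not_less)
  qed
  interpret D: real_distribution "distr M borel U" by simp
  have Plim: "(P \<longlongrightarrow> 0) at_top"
  proof -
    have "((\<lambda>t. 1 - G t) \<longlongrightarrow> 1 - 1) at_top" unfolding G by (intro tendsto_intros D.cdf_lim_at_top_prob)
    then show ?thesis by (simp add: GP)
  qed
  define Q where "Q = right_inv (\<lambda>y. 1 - G y)"
  define A where "A = (\<lambda>s. right_inv (alpha_ext M X) (s / 2))"
  have Qbound: "t \<le> Q s" if "0 < s" "0 \<le> t" "s < P t" for s t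
  proof -
    have "\<forall>\<^sub>F t in at_top. P t < s" using Plim that(1) by (rule order_tendstoD)
    then obtain B where "\<And>t. B \<le> t \<Longrightarrow> P t < s" by (auto simp: eventually_at_top_linorder)
    then have "bdd_above {x. 0 \<le> x \<and> s < 1 - G x}"
    proof (intro bdd_aboveI[of _ B])
      fix x assume B: "\<And>t. B \<le> t \<Longrightarrow> P t < s" and x: "x \<in> {x. 0 \<le> x \<and> s < 1 - G x}"
      show "x \<le> B"
      proof (rule ccontr)
        assume "\<not> x \<le> B"
        then have "P x < s" by (intro B) simp
        then show False using x by (simp add: GP)
      qed
    qed
    moreover have mem: "t \<in> {x. 0 \<le> x \<and> s < 1 - G x}" using that by (simp add: GP)
    ultimately have "t \<le> Sup {x. 0 \<le> x \<and> s < 1 - G x}" by (intro cSup_upper)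
    also have "\<dots> = Q s"
    proof -
      have "{x. 0 \<le> x \<and> s < 1 - G x} \<noteq> {}" using mem by blast
      then show ?thesis unfolding Q_def right_inv_def by (rule if_not_P[symmetric])
    qed
    finally show ?thesis .
  qed
  have Abound: "2 ^ k \<le> A s" if "0 < s" "s < \<alpha> k" for s k
  proof -
    have "\<forall>\<^sub>F n in sequentially. alpha_coeff M X n < s / 2"
      using am that(1) unfolding alpha_mixing_def by (intro order_tendstoD) auto
    then obtain n0 where n0: "\<And>n. n0 \<le> n \<Longrightarrow> alpha_coeff M X n < s / 2" by (auto simp: eventually_sequentially)
    have "bdd_above {x. 0 \<le> x \<and> s / 2 < alpha_ext M X x}"
    proof (rule bdd_aboveI[of _ "real n0 + 1"])
      fix x assume x: "x \<in> {x. 0 \<le> x \<and> s / 2 < alpha_ext M X x}"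
      then have "\<not> n0 \<le> nat \<lfloor>x\<rfloor>" using n0[of "nat \<lfloor>x\<rfloor>"] by (auto simp: alpha_ext_def)
      then show "x \<le> real n0 + 1" using x by (simp add: not_le) linarith
    qed
    moreover have mem: "(2::real) ^ k \<in> {x. 0 \<le> x \<and> s / 2 < alpha_ext M X x}"
    proof -
      have "\<lfloor>(2::real) ^ k\<rfloor> = 2 ^ k" using floor_of_nat[of "2 ^ k"] by simp
      then have "alpha_ext M X (2 ^ k) = \<alpha> k" by (simp add: alpha_ext_def \<alpha>_def nat_power_eq)
      then show ?thesis using that by simp
    qed
    ultimately have "2 ^ k \<le> Sup {x. 0 \<le> x \<and> s / 2 < alpha_ext M X x}" by (intro cSup_upper)
    also have "\<dots> = A s"
    proof -
      have "{x. 0 \<le> x \<and> s / 2 < alpha_ext M X x} \<noteq> {}" using mem by blast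
      then show ?thesis unfolding A_def right_inv_def by (rule if_not_P[symmetric])
    qed
    finally show ?thesis .
  qed
  have count: "(\<Sum>k. indicator {k. s < \<alpha> k} k :: ennreal) \<le> ennreal (3 * ln (1 + A s))" if s: "0 < s" for s
  proof -
    have fin: "finite {k. s < \<alpha> k}"
    proof (rule finite_subset)
      show "{k. s < \<alpha> k} \<subseteq> {k. 2 ^ k \<le> nat \<lfloor>A s\<rfloor>}"
      proof safe
        fix k assume "s < \<alpha> k"
        then have "real (2 ^ k) \<le> A s" using Abound[OF s] by simp
        then show "2 ^ k \<le> nat \<lfloor>A s\<rfloor>" by (rule le_nat_floor)
      qed
      show "finite {k. (2::nat) ^ k \<le> nat \<lfloor>A s\<rfloor>}"
        by (rule finite_subset[of _ "{..nat \<lfloor>A s\<rfloor>}"]) (auto intro: order_trans[OF less_imp_le[OF less_exp]])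
    qed
    show ?thesis
    proof (cases "{k. s < \<alpha> k} = {}")
      case True
      then have "indicator {k. s < \<alpha> k} k = (0::ennreal)" for k by (auto simp: indicator_def)
      then show ?thesis by simp
    next
      case False
      define m where "m = Max {k. s < \<alpha> k}"
      have "m \<in> {k. s < \<alpha> k}" unfolding m_def using fin False by (rule Max_in)
      then have "2 ^ m \<le> A s" using Abound[OF s] by simp
      have "(\<Sum>k. indicator {k. s < \<alpha> k} k :: ennreal) = (\<Sum>k\<in>{k. s < \<alpha> k}. 1)"
        using fin by (subst suminf_finite[of "{k. s < \<alpha> k}"]) auto
      also have "\<dots> = ennreal (real (card {k. s < \<alpha> k}))" by (simp add: ennreal_of_nat_eq_real_of_nat)
      also have "card {k. s < \<alpha> k} \<le> card {..m}"
        using fin by (intro card_mono) (auto simp: m_def)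
      also have "card {..m} = Suc m" by simp
      finally have le: "(\<Sum>k. indicator {k. s < \<alpha> k} k :: ennreal) \<le> ennreal (real (Suc m))"
        by (simp add: ennreal_leI)
      have "1/2 \<le> ln (2::real)" using ln2_ge_two_thirds by simp
      \<comment> \<open>The factor 3 covers m = 0, where ln 2 > 1/2, and m > 0, where m ln 2 > 2 m / 3.\<close>
      have "real (Suc m) \<le> 3 * ln (1 + A s)"
      proof (cases m)
        case 0
        have "ln 2 \<le> ln (1 + A s)" using \<open>2 ^ m \<le> A s\<close> 0 by (subst ln_le_cancel_iff) auto
        then show ?thesis using 0 \<open>1/2 \<le> ln 2\<close> by simp
      next
        case (Suc j)
        have p0: "(0::real) < 2 ^ m" by simp
        have "real m * ln 2 = ln (2 ^ m)" by (simp add: ln_realpow)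
        also have "\<dots> \<le> ln (1 + A s)" using \<open>2 ^ m \<le> A s\<close> p0 by (subst ln_le_cancel_iff) (linarith+)
        finally have "real m * ln 2 \<le> ln (1 + A s)" .
        moreover have "real m * (2/3) \<le> real m * ln 2" using ln2_ge_two_thirds by (intro mult_left_mono) auto
        ultimately show ?thesis using Suc by simp
      qed
      then show ?thesis using le by (meson ennreal_leI order_trans)
    qed
  qed
  have min_eq: "min (ennreal a) (emeasure M {\<omega> \<in> space M. t < U \<omega>}) = (\<integral>\<^sup>+ s. indicator {0<..<1} s * indicator {s. s < a} s * indicator {s. s < P t} s \<partial>lborel)"
    if "0 \<le> a" for a t
  proof -
    have "(\<integral>\<^sup>+ s. indicator {0<..<1} s * indicator {s. s < a} s * indicator {s. s < P t} s \<partial>lborel)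
      = (\<integral>\<^sup>+ s. indicator {0<..<min a (P t)} s \<partial>lborel)"
      using P1 by (intro nn_integral_cong) (auto simp: indicator_def intro: less_le_trans)
    also have "\<dots> = ennreal (min a (P t))" using that P1 by simp
    also have "\<dots> = min (ennreal a) (ennreal (P t))" using that P1 by (simp add: min_def ennreal_le_iff)
    also have "ennreal (P t) = emeasure M {\<omega> \<in> space M. t < U \<omega>}" by (simp add: emeasure_eq_measure P_def)
    finally show ?thesis by simp
  qed
  have \<alpha>0: "0 \<le> \<alpha> k" for k
    using alpha_coeff_upper[of 1 "{}" X "{}" "2 ^ k"] sigma_sets.Empty by (auto simp: \<alpha>_def sigma_gen_by_def)
  have "(\<Sum>k. \<integral>\<^sup>+ t. indicator {0..} t * min (ennreal (\<alpha> k)) (emeasure M {\<omega> \<in> space M. t < U \<omega>}) \<partial>lborel)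
    = (\<Sum>k. \<integral>\<^sup>+ t. \<integral>\<^sup>+ s. indicator {0..} t * (indicator {0<..<1} s * indicator {s. s < \<alpha> k} s * indicator {s. s < P t} s) \<partial>lborel \<partial>lborel)"
    using \<alpha>0 by (intro suminf_cong nn_integral_cong) (simp add: min_eq nn_integral_cmult)
  also have "\<dots> = (\<Sum>k. \<integral>\<^sup>+ s. \<integral>\<^sup>+ t. indicator {0..} t * (indicator {0<..<1} s * indicator {s. s < \<alpha> k} s * indicator {s. s < P t} s) \<partial>lborel \<partial>lborel)"
    by (intro suminf_cong lborel_pair.Fubini') (measurable)
  also have "\<dots> = (\<Sum>k. \<integral>\<^sup>+ s. indicator {0<..<1} s * indicator {s. s < \<alpha> k} s * (\<integral>\<^sup>+ t. indicator {0..} t * indicator {s. s < P t} s \<partial>lborel) \<partial>lborel)"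
    by (intro suminf_cong nn_integral_cong) (simp add: nn_integral_cmult[symmetric] mult_ac)
  also have "\<dots> \<le> (\<Sum>k. \<integral>\<^sup>+ s. indicator {k. s < \<alpha> k} k * (indicator {0<..<1} s * (\<integral>\<^sup>+ t. indicator {0..} t * indicator {s. s < P t} s \<partial>lborel)) \<partial>lborel)"
    by (intro suminf_le nn_integral_mono) (auto simp: indicator_def)
  also have "\<dots> = (\<integral>\<^sup>+ s. (\<Sum>k. indicator {k. s < \<alpha> k} k * (indicator {0<..<1} s * (\<integral>\<^sup>+ t. indicator {0..} t * indicator {s. s < P t} s \<partial>lborel))) \<partial>lborel)"
    by (rule nn_integral_suminf[symmetric]) measurable
  also have "\<dots> = (\<integral>\<^sup>+ s. (\<Sum>k. indicator {k. s < \<alpha> k} k) * (indicator {0<..<1} s * (\<integral>\<^sup>+ t. indicator {0..} t * indicator {s. s < P t} s \<partial>lborel)) \<partial>lborel)"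
    by (simp add: ennreal_suminf_multc)
  also have "\<dots> \<le> (\<integral>\<^sup>+ s. ennreal 3 * ennreal (norm (indicator {0..1} s *\<^sub>R (ln (1 + A s) * Q s))) \<partial>lborel)"
  proof (intro nn_integral_mono)
    fix s :: real
    show "(\<Sum>k. indicator {k. s < \<alpha> k} k) * (indicator {0<..<1} s * (\<integral>\<^sup>+ t. indicator {0..} t * indicator {s. s < P t} s \<partial>lborel))
      \<le> ennreal 3 * ennreal (norm (indicator {0..1} s *\<^sub>R (ln (1 + A s) * Q s)))"
    proof (cases "0 < s \<and> s < 1")
      case True
      then have s: "0 < s" "s < 1" by auto
      have "(\<integral>\<^sup>+ t. indicator {0..} t * indicator {s. s < P t} s \<partial>lborel) \<le> (\<integral>\<^sup>+ t. indicator {0..Q s} t \<partial>lborel)"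
        using Qbound[OF s(1)] by (intro nn_integral_mono) (auto simp: indicator_def)
      also have "\<dots> \<le> ennreal \<bar>Q s\<bar>" by (simp add: emeasure_lborel_Icc_eq ennreal_leI)
      finally have "(\<Sum>k. indicator {k. s < \<alpha> k} k) * (\<integral>\<^sup>+ t. indicator {0..} t * indicator {s. s < P t} s \<partial>lborel)
         \<le> ennreal (3 * ln (1 + A s)) * ennreal \<bar>Q s\<bar>"
        by (intro mult_mono count s) auto
      also have "\<dots> \<le> ennreal (3 * \<bar>ln (1 + A s)\<bar>) * ennreal \<bar>Q s\<bar>"
        by (intro mult_right_mono ennreal_leI) auto
      also have "\<dots> = ennreal 3 * ennreal \<bar>ln (1 + A s) * Q s\<bar>"
        by (simp add: ennreal_mult abs_mult mult.assoc)
      finally show ?thesis using s by simp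
    qed auto
  qed
  also have "\<dots> = ennreal 3 * (\<integral>\<^sup>+ s. ennreal (norm (indicator {0..1} s *\<^sub>R (ln (1 + A s) * Q s))) \<partial>lborel)"
    using int unfolding set_integrable_def A_def Q_def by (intro nn_integral_cmult) auto
  also have "\<dots> < \<infinity>"
    using int unfolding set_integrable_def A_def Q_def integrable_iff_bounded by (simp add: ennreal_mult_less_top)
  finally show ?thesis by (simp add: \<alpha>_def mixing_tails_def)
qed

section \<open>Both tails together\<close>

text \<open>  The kernel bound is void where \<open>F\<close> is 0 or 1. There the empirical distribution function agrees
  with \<open>F\<close>: almost surely \<open>F(X\<^sub>i) > 0\<close> and \<open>P(X \<ge> X\<^sub>i) > 0\<close> (evaluated at \<open>X\<^sub>i\<close>) for all \<open>i\<close>.\<close>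
lemma (in prob_space) AE_emp_cdf_degenerate:
  fixes X :: "nat \<Rightarrow> 'a \<Rightarrow> real"
  assumes X: "\<And>i. 1 \<le> i \<Longrightarrow> X i \<in> borel_measurable M"
    and cdf: "\<And>i. 1 \<le> i \<Longrightarrow> cdf (distr M borel (X i)) = F"
    and cdf': "\<And>i. 1 \<le> i \<Longrightarrow> cdf (distr M borel (\<lambda>\<omega>. - X i \<omega>)) = F'"
  shows "AE \<omega> in M. \<forall>n\<ge>1. \<forall>x. (F x = 0 \<longrightarrow> emp_cdf X n \<omega> x = 0) \<and> (F x = 1 \<longrightarrow> emp_cdf X n \<omega> x = 1)"
proof -
  have mX: "(\<lambda>\<omega>. - X i \<omega>) \<in> borel_measurable M" if "1 \<le> i" for i using X[OF that] by simp
  have "AE \<omega> in M. \<forall>i. 0 < F (X (Suc i) \<omega>)"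
    unfolding AE_all_countable using AE_cdf_pos[OF X cdf] by auto
  moreover have "AE \<omega> in M. \<forall>i. 0 < F' (- X (Suc i) \<omega>)"
    unfolding AE_all_countable using AE_cdf_pos[OF mX cdf'] by auto
  ultimately show ?thesis
  proof eventually_elim
    case (elim \<omega>)
    have p: "0 < F (X i \<omega>)" "0 < F' (- X i \<omega>)" if "1 \<le> i" for i
      using elim(1)[rule_format, of "i - 1"] elim(2)[rule_format, of "i - 1"] that by simp_all
    note F01 = cdf_of_bounds[OF X[OF order_refl] cdf[OF order_refl]]
    show ?case
    proof (intro allI impI conjI)
      fix n :: nat and x assume n: "1 \<le> n" and F0: "F x = 0"
      have "(\<Sum>i=1..n. indicator {X i \<omega>..} x :: real) = 0"
      proof (intro sum.neutral ballI)
        fix i assume "i \<in> {1..n}"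
        then have "\<not> X i \<omega> \<le> x" using p(1)[of i] F0 monoD[OF F01(3), of "X i \<omega>" x] by auto
        then show "indicator {X i \<omega>..} x = (0 :: real)" by simp
      qed
      then show "emp_cdf X n \<omega> x = 0" by (simp add: emp_cdf_def)
    next
      fix n :: nat and x assume n: "1 \<le> n" and F1: "F x = 1"
      have "(\<Sum>i=1..n. indicator {X i \<omega>..} x :: real) = (\<Sum>i=1..n. 1)"
      proof (intro sum.cong refl)
        fix i assume i: "i \<in> {1..n}"
        have "X i \<omega> \<le> x"
        proof (rule ccontr)
          assume lt: "\<not> X i \<omega> \<le> x"
          note [measurable] = X[OF order_refl, unfolded One_nat_def]
          have "F' (- X i \<omega>) = prob {\<omega>' \<in> space M. X i \<omega> \<le> X 1 \<omega>'}"
            by (rule reflected_cdf(1)[OF X[OF order_refl] cdf[OF order_refl] cdf'[OF order_refl]])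
          also have "\<dots> \<le> prob {\<omega>' \<in> space M. \<not> X 1 \<omega>' \<le> x}"
            using lt by (intro finite_measure_mono) auto
          also have "\<dots> = 1 - F x"
            using prob_le_eq_cdf[OF X[OF order_refl] cdf[OF order_refl], of x] by (subst prob_neg) auto
          finally show False using F1 p(2)[of i] i by simp
        qed
        then show "indicator {X i \<omega>..} x = (1 :: real)" by simp
      qed
      then show "emp_cdf X n \<omega> x = 1" using n by (simp add: emp_cdf_def)
    qed
  qed
qed

text \<open>  The kernel weight on one side of the median. Since \<open>0 powr a = 0\<close>, it has no mass where \<open>F\<close>
  vanishes.\<close>
definition side_measure :: "(real \<Rightarrow> real) \<Rightarrow> real \<Rightarrow> real \<Rightarrow> real measure" where
  "side_measure F b c = density lborel (\<lambda>x. ennreal (indicator {..<c} x * F x powr (- b)))"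

lemma
  assumes [measurable]: "F \<in> borel_measurable borel"
  shows sigma_finite_side_measure: "sigma_finite_measure (side_measure F b c)"
    and sets_side_measure: "sets (side_measure F b c) = sets borel"
    and nn_integral_side_measure: "\<And>f. f \<in> borel_measurable borel \<Longrightarrow>
      (\<integral>\<^sup>+ x. f x \<partial>side_measure F b c) = (\<integral>\<^sup>+ x. ennreal (indicator {..<c} x * F x powr (- b)) * f x \<partial>lborel)"
proof -
  let ?w = "\<lambda>x. ennreal (indicator {..<c} x * F x powr (- b))"
  have [measurable]: "?w \<in> borel_measurable borel" by measurable
  show "sigma_finite_measure (side_measure F b c)"
    unfolding side_measure_def using sigma_finite_measure.sigma_finite_iff_density_finite'[OF sigma_finite_lborel, of ?w] by simp
  show "sets (side_measure F b c) = sets borel" by (simp add: side_measure_def)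
  show "(\<integral>\<^sup>+ x. f x \<partial>side_measure F b c) = (\<integral>\<^sup>+ x. ?w x * f x \<partial>lborel)" if "f \<in> borel_measurable borel" for f
    unfolding side_measure_def using that by (intro nn_integral_density) auto
qed

text \<open>  Left of the median \<open>c\<close> the weight \<open>F\<^bsup>-b\<^esup>\<close> dominates \<open>(1-F)\<^bsup>-b\<^esup>\<close>, right of it the converse holds. The
  right part becomes a left part for \<open>-X\<close> after the substitution \<open>x \<mapsto> -x\<close>.\<close>
lemma (in prob_space) L_functional_rate_of_side_rates:
  fixes X :: "nat \<Rightarrow> 'a \<Rightarrow> real" and \<kappa> :: "real measure"
  assumes kap: "real_distribution \<kappa>" and one: "measure \<kappa> {0..1} = 1" and K: "K = cdf \<kappa>"
    and atom: "measure \<kappa> {1} = 0" and L: "F \<in> L_class K"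
    and X: "\<And>i. 1 \<le> i \<Longrightarrow> X i \<in> borel_measurable M"
    and cdf: "\<And>i. 1 \<le> i \<Longrightarrow> cdf (distr M borel (X i)) = F"
    and cdf': "\<And>i. 1 \<le> i \<Longrightarrow> cdf (distr M borel (\<lambda>\<omega>. - X i \<omega>)) = F'"
    and b: "0 \<le> b" and B: "0 \<le> B"
    and kernel: "\<And>s t. 0 \<le> s \<Longrightarrow> s \<le> 1 \<Longrightarrow> 0 < t \<Longrightarrow> t < 1 \<Longrightarrow>
      \<bar>K s - K t\<bar> \<le> B * \<bar>s - t\<bar> * (t powr (- b) + (1 - t) powr (- b))"
    and c: "c = Inf {x. 1 / 2 \<le> F x}"
    and left: "AE \<omega> in M. (\<lambda>n. ennreal (real n powr r) *
      (\<integral>\<^sup>+ x. \<bar>emp_cdf X n \<omega> x - F x\<bar> \<partial>side_measure F b c)) \<longlonglongrightarrow> 0"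
    and right: "AE \<omega> in M. (\<lambda>n. ennreal (real n powr r) *
      (\<integral>\<^sup>+ x. \<bar>emp_cdf (\<lambda>i \<omega>. - X i \<omega>) n \<omega> x - F' x\<bar> \<partial>side_measure F' b (- c))) \<longlonglongrightarrow> 0"
  shows "AE \<omega> in M. (\<lambda>n. real n powr r * \<bar>L_functional K (emp_cdf X n \<omega>) - L_functional K F\<bar>) \<longlonglongrightarrow> 0"
proof -
  note X1 = X[OF order_refl] and cdf1 = cdf[OF order_refl] and cdf1' = cdf'[OF order_refl]
  have mX1: "(\<lambda>\<omega>. - X 1 \<omega>) \<in> borel_measurable M" using X1 by simp
  note F01 = cdf_of_bounds[OF X1 cdf1]
  have [measurable]: "F \<in> borel_measurable borel" "F' \<in> borel_measurable borel"
    using borel_measurable_cdf_of[OF X1 cdf1] borel_measurable_cdf_of[OF mX1 cdf1'] .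
  have emx[measurable]: "(\<lambda>x. emp_cdf Y n \<omega> x) \<in> borel_measurable borel" for Y :: "nat \<Rightarrow> 'a \<Rightarrow> real" and n \<omega>
    unfolding emp_cdf_def by measurable
  note med = median_facts[OF X1 cdf1 cdf1', folded c]
  have degenerate: "AE \<omega> in M. \<forall>n\<ge>1. \<forall>x. (F x = 0 \<longrightarrow> emp_cdf X n \<omega> x = 0) \<and> (F x = 1 \<longrightarrow> emp_cdf X n \<omega> x = 1)"
    by (rule AE_emp_cdf_degenerate[where F' = F']) (fact X cdf cdf')+
  show ?thesis
    using left right degenerate
  proof eventually_elim
    case (elim \<omega>)
    define a where "a = (\<lambda>n. \<integral>\<^sup>+ x. \<bar>emp_cdf X n \<omega> x - F x\<bar> \<partial>side_measure F b c)"
    define a' where "a' = (\<lambda>n. \<integral>\<^sup>+ x. \<bar>emp_cdf (\<lambda>i \<omega>. - X i \<omega>) n \<omega> x - F' x\<bar> \<partial>side_measure F' b (- c))"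
    have bound: "ennreal \<bar>L_functional K (emp_cdf X n \<omega>) - L_functional K F\<bar> \<le> ennreal (2 * B) * (a n + a' n)"
      if n: "1 \<le> n" for n
    proof -
      define u where "u = (\<lambda>x. ennreal (indicator {..<c} x * F x powr (- b)) * ennreal \<bar>emp_cdf X n \<omega> x - F x\<bar>)"
      define u' where "u' = (\<lambda>y. ennreal (indicator {..<- c} y * F' y powr (- b)) * ennreal \<bar>emp_cdf (\<lambda>i \<omega>. - X i \<omega>) n \<omega> y - F' y\<bar>)"
      have [measurable]: "u \<in> borel_measurable borel" "u' \<in> borel_measurable borel"
        unfolding u_def u'_def by measurable
      have au: "a n = (\<integral>\<^sup>+ x. u x \<partial>lborel)" unfolding a_def u_def by (rule nn_integral_side_measure) measurable
      have "a' n = (\<integral>\<^sup>+ x. u' x \<partial>lborel)" unfolding a'_def u'_def by (rule nn_integral_side_measure) measurable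
      also have "\<dots> = (\<integral>\<^sup>+ x. u' (- x) \<partial>lborel)" using nn_integral_real_affine[of u' "-1" 0] by simp
      finally have au': "a' n = (\<integral>\<^sup>+ x. u' (- x) \<partial>lborel)" .
      have ae: "AE x in lborel. ennreal \<bar>K (emp_cdf X n \<omega> x) - K (F x)\<bar> \<le> ennreal (2 * B) * (u x + u' (- x))"
        using reflected_cdf(3)[OF X1 cdf1 cdf1'] emp_cdf_reflected[OF n, of X \<omega>] AE_lborel_singleton[of c]
      proof eventually_elim
        case (elim x)
        let ?E = "emp_cdf X n \<omega> x"
        consider "F x = 0" | "F x = 1" | "0 < F x" "F x < 1" using F01(1,2)[of x] by fastforce
        then show ?case
        proof cases
          case 1
          then have "?E = 0" using \<open>\<forall>n\<ge>1. \<forall>x. _ n x\<close> n by blast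
          then show ?thesis using 1 by simp
        next
          case 2
          then have "?E = 1" using \<open>\<forall>n\<ge>1. \<forall>x. _ n x\<close> n by blast
          then show ?thesis using 2 by simp
        next
          case 3
          have k: "\<bar>K ?E - K (F x)\<bar> \<le> B * \<bar>?E - F x\<bar> * (F x powr (- b) + (1 - F x) powr (- b))"
            using 3 by (intro kernel emp_cdf_bounds)
          show ?thesis
          proof (cases "x < c")
            case True
            then have "F x < 1/2" by (rule med)
            then have "(1 - F x) powr (- b) \<le> F x powr (- b)" using 3 b by (intro powr_mono2') auto
            then have "B * \<bar>?E - F x\<bar> * (F x powr (- b) + (1 - F x) powr (- b)) \<le> B * \<bar>?E - F x\<bar> * (2 * F x powr (- b))"
              using B by (intro mult_left_mono) auto
            then have "\<bar>K ?E - K (F x)\<bar> \<le> 2 * B * (F x powr (- b) * \<bar>?E - F x\<bar>)" using k by (simp add: mult_ac)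
            then have "ennreal \<bar>K ?E - K (F x)\<bar> \<le> ennreal (2 * B) * u x"
              using True B by (simp add: u_def ennreal_mult[symmetric] ennreal_leI)
            then show ?thesis by (rule order_trans) (intro mult_left_mono, auto)
          next
            case False
            then have xc: "c < x" using elim(3) by simp
            then have "1/2 \<le> F x" using med(2)[of x] by simp
            then have "F x powr (- b) \<le> (1 - F x) powr (- b)" using 3 b by (intro powr_mono2') auto
            then have "B * \<bar>?E - F x\<bar> * (F x powr (- b) + (1 - F x) powr (- b)) \<le> B * \<bar>?E - F x\<bar> * (2 * (1 - F x) powr (- b))"
              using B by (intro mult_left_mono) auto
            then have "\<bar>K ?E - K (F x)\<bar> \<le> 2 * B * ((1 - F x) powr (- b) * \<bar>?E - F x\<bar>)" using k by (simp add: mult_ac)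
            moreover have "u' (- x) = ennreal ((1 - F x) powr (- b) * \<bar>?E - F x\<bar>)"
              using xc elim(1,2) by (simp add: u'_def ennreal_mult abs_minus_commute)
            ultimately have "ennreal \<bar>K ?E - K (F x)\<bar> \<le> ennreal (2 * B) * u' (- x)"
              using B by (simp add: ennreal_mult[symmetric] ennreal_leI)
            then show ?thesis by (rule order_trans) (intro mult_left_mono, auto)
          qed
        qed
      qed
      have "ennreal \<bar>L_functional K (emp_cdf X n \<omega>) - L_functional K F\<bar>
        \<le> (\<integral>\<^sup>+ x. ennreal \<bar>K (emp_cdf X n \<omega> x) - K (F x)\<bar> \<partial>lborel)"
        by (rule L_functional_diff_le[OF kap one K atom L n])
      also have "\<dots> \<le> (\<integral>\<^sup>+ x. ennreal (2 * B) * (u x + u' (- x)) \<partial>lborel)"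
        using ae by (rule nn_integral_mono_AE)
      also have "\<dots> = ennreal (2 * B) * (a n + a' n)"
        unfolding au au' by (subst nn_integral_cmult, measurable, subst nn_integral_add) auto
      finally show ?thesis .
    qed
    have lim: "(\<lambda>n. ennreal (2 * B) * (ennreal (real n powr r) * a n + ennreal (real n powr r) * a' n)) \<longlonglongrightarrow> ennreal (2 * B) * (0 + 0)"
    proof (intro tendsto_mult_ennreal tendsto_const tendsto_add)
      show "(\<lambda>n. ennreal (real n powr r) * a n) \<longlonglongrightarrow> 0" using elim(1) by (simp only: a_def)
      show "(\<lambda>n. ennreal (real n powr r) * a' n) \<longlonglongrightarrow> 0" using elim(2) by (simp only: a'_def)
    qed auto
    have "(\<lambda>n. ennreal (real n powr r * \<bar>L_functional K (emp_cdf X n \<omega>) - L_functional K F\<bar>)) \<longlonglongrightarrow> 0"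
    proof (rule tendsto_sandwich[OF _ _ tendsto_const])
      show "\<forall>\<^sub>F n in sequentially. ennreal (real n powr r * \<bar>L_functional K (emp_cdf X n \<omega>) - L_functional K F\<bar>)
         \<le> ennreal (2 * B) * (ennreal (real n powr r) * a n + ennreal (real n powr r) * a' n)"
        using eventually_ge_at_top[of 1]
      proof eventually_elim
        case (elim n)
        have "ennreal (real n powr r * \<bar>L_functional K (emp_cdf X n \<omega>) - L_functional K F\<bar>)
          = ennreal (real n powr r) * ennreal \<bar>L_functional K (emp_cdf X n \<omega>) - L_functional K F\<bar>"
          by (simp add: ennreal_mult)
        also have "\<dots> \<le> ennreal (real n powr r) * (ennreal (2 * B) * (a n + a' n))"
          using bound[OF elim] by (intro mult_left_mono) auto
        finally show ?case by (simp add: distrib_left distrib_right mult_ac)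
      qed
      show "(\<lambda>n. ennreal (2 * B) * (ennreal (real n powr r) * a n + ennreal (real n powr r) * a' n)) \<longlonglongrightarrow> 0"
        using lim by simp
    qed simp
    then show ?case
      by (intro tendsto_ennrealD[where F=sequentially]) auto
  qed
qed

lemma (in prob_space) distr_uminus_cdf_eq:
  assumes "Z \<in> borel_measurable M" "Y \<in> borel_measurable M"
    and "cdf (distr M borel Z) = cdf (distr M borel Y)"
  shows "cdf (distr M borel (\<lambda>\<omega>. - Z \<omega>)) = cdf (distr M borel (\<lambda>\<omega>. - Y \<omega> :: real))"
proof -
  have "distr M borel (\<lambda>\<omega>. - W \<omega>) = distr (distr M borel W) borel uminus" if "W \<in> borel_measurable M" for W :: "'a \<Rightarrow> real"
    using that by (subst distr_distr) (auto simp: comp_def)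
  then show ?thesis using assms distr_eq_of_cdf_eq[OF assms] by simp
qed

text \<open>  If \<open>\<gamma> \<ge> 1 - r\<close>, then \<open>1/F(Z)\<close> and \<open>1/F'(-Z)\<close> are at most a multiple of \<open>\<phi>(Z)\<^bsup>1/(1-r)\<^esup>\<close> and hence
  integrable. By \<open>cdf_bounded_below_of_inverse_integrable\<close> the positive values of \<open>F\<close> and \<open>F'\<close> are
  bounded below by some \<open>m > 0\<close>, and all powers of them are comparable. The new exponent \<open>1/2\<close> is
  admissible since \<open>r < 1/2\<close>.\<close>
lemma (in prob_space) exponent_below_moment_order:
  assumes Z[measurable]: "Z \<in> borel_measurable M" and cdf: "cdf (distr M borel Z) = F"
    and cdf': "cdf (distr M borel (\<lambda>\<omega>. - Z \<omega>)) = F'"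
    and g: "0 < \<gamma>" "\<gamma> \<le> 1" and r: "0 \<le> r" "r < 1/2"
    and int: "integrable M (\<lambda>\<omega>. phi_weight \<gamma> F (Z \<omega>) powr (1 / (1 - r)))"
  shows "\<exists>\<gamma>' D. 0 < \<gamma>' \<and> \<gamma>' < 1 - r \<and> 0 < D \<and>
    (\<forall>H\<in>{F, F'}. \<forall>x. H x powr \<gamma>' \<le> D * H x powr \<gamma> \<and> H x powr (- \<gamma>') \<le> D * H x powr (- \<gamma>))"
proof (cases "\<gamma> < 1 - r")
  case True
  then show ?thesis using g by (intro exI[of _ \<gamma>] exI[of _ 1]) auto
next
  case False
  have mZ: "(\<lambda>\<omega>. - Z \<omega>) \<in> borel_measurable M" by simp
  have F[measurable]: "F \<in> borel_measurable borel" by (rule borel_measurable_cdf_of[OF Z cdf])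
  note F01 = cdf_of_bounds[OF Z cdf] and F'01 = cdf_of_bounds[OF mZ cdf']
  have [measurable]: "phi_weight \<gamma> F \<in> borel_measurable borel" by (rule phi_weight_measurable[OF F])
  have \<phi>1: "1 \<le> phi_weight \<gamma> F x" for x by (rule phi_weight_ge_1[OF F01(1,2)]) (use g in simp)
  obtain C where C: "0 < C" and dom: "AE \<omega> in M. F (Z \<omega>) powr (- \<gamma>) \<le> C * phi_weight \<gamma> F (Z \<omega>) \<and>
      F' (- Z \<omega>) powr (- \<gamma>) \<le> C * phi_weight \<gamma> F (Z \<omega>)"
    using phi_weight_dominates[OF Z cdf cdf', of \<gamma>] g by auto
  define q where "q = 1 / (1 - r)"
  have q: "0 < q" "1 \<le> \<gamma> * q" using r False by (auto simp: q_def field_simps)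
  have key: "1 / u \<le> C powr q * w powr q" if u: "0 < u" "u \<le> 1" "u powr (- \<gamma>) \<le> C * w" and w: "1 \<le> w" for u w
  proof -
    have "1 / u = u powr (- 1)" using u by (simp add: powr_minus_divide)
    also have "\<dots> \<le> u powr (- (\<gamma> * q))" using u q by (intro powr_mono') auto
    also have "\<dots> = (u powr (- \<gamma>)) powr q" by (simp add: powr_powr)
    also have "\<dots> \<le> (C * w) powr q" using u q by (intro powr_mono2) auto
    also have "\<dots> = C powr q * w powr q" using C w by (simp add: powr_mult)
    finally show ?thesis .
  qed
  have fin: "(\<integral>\<^sup>+ \<omega>. ennreal (C powr q * phi_weight \<gamma> F (Z \<omega>) powr q) \<partial>M) < \<infinity>"
  proof -
    have "integrable M (\<lambda>\<omega>. C powr q * phi_weight \<gamma> F (Z \<omega>) powr q)"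
      using int unfolding q_def by simp
    from nn_integral_eq_integral[OF this] show ?thesis by simp
  qed
  have "\<exists>c>0. \<forall>x. 0 < F x \<longrightarrow> c \<le> F x"
  proof (rule cdf_bounded_below_of_inverse_integrable[OF Z cdf])
    have "(\<integral>\<^sup>+ \<omega>. ennreal (1 / F (Z \<omega>)) \<partial>M) \<le> (\<integral>\<^sup>+ \<omega>. ennreal (C powr q * phi_weight \<gamma> F (Z \<omega>) powr q) \<partial>M)"
    proof (rule nn_integral_mono_AE)
      show "AE \<omega> in M. ennreal (1 / F (Z \<omega>)) \<le> ennreal (C powr q * phi_weight \<gamma> F (Z \<omega>) powr q)"
        using dom AE_cdf_pos[OF Z cdf]
        by eventually_elim (intro ennreal_leI key F01(2) \<phi>1, auto)
    qed
    then show "(\<integral>\<^sup>+ \<omega>. ennreal (1 / F (Z \<omega>)) \<partial>M) < \<infinity>" using fin by (rule order_le_less_trans)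
  qed
  then obtain c1 where c1: "0 < c1" "\<And>x. 0 < F x \<Longrightarrow> c1 \<le> F x" by blast
  have "\<exists>c>0. \<forall>x. 0 < F' x \<longrightarrow> c \<le> F' x"
  proof (rule cdf_bounded_below_of_inverse_integrable[OF mZ cdf'])
    have "(\<integral>\<^sup>+ \<omega>. ennreal (1 / F' (- Z \<omega>)) \<partial>M) \<le> (\<integral>\<^sup>+ \<omega>. ennreal (C powr q * phi_weight \<gamma> F (Z \<omega>) powr q) \<partial>M)"
    proof (rule nn_integral_mono_AE)
      show "AE \<omega> in M. ennreal (1 / F' (- Z \<omega>)) \<le> ennreal (C powr q * phi_weight \<gamma> F (Z \<omega>) powr q)"
        using dom AE_cdf_pos[OF mZ cdf']
        by eventually_elim (intro ennreal_leI key F'01(2) \<phi>1, auto)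
    qed
    then show "(\<integral>\<^sup>+ \<omega>. ennreal (1 / F' (- Z \<omega>)) \<partial>M) < \<infinity>" using fin by (rule order_le_less_trans)
  qed
  then obtain c2 where c2: "0 < c2" "\<And>x. 0 < F' x \<Longrightarrow> c2 \<le> F' x" by blast
  define m where "m = min 1 (min c1 c2)"
  have m: "0 < m" "m \<le> 1" using c1 c2 by (auto simp: m_def)
  have est: "u powr (1/2) \<le> 1 / m * u powr \<gamma> \<and> u powr (- (1/2)) \<le> 1 / m * u powr (- \<gamma>)"
    if "u = 0 \<or> m \<le> u" "0 \<le> u" "u \<le> 1" for u
  proof (cases "u = 0")
    case False
    then have u: "m \<le> u" "0 < u" using that by auto
    have "u powr (1/2) \<le> 1" using u that by (intro powr_le1) auto
    moreover have "u powr 1 \<le> u powr \<gamma>" using u that g by (intro powr_mono') auto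
    then have "m \<le> u powr \<gamma>" using u by simp
    then have "1 \<le> 1 / m * u powr \<gamma>" using m by (simp add: pos_le_divide_eq)
    moreover have "u powr (- (1/2)) \<le> u powr (- 1)" using u that by (intro powr_mono') auto
    then have "u powr (- (1/2)) \<le> 1 / u" using u by (simp add: powr_minus_divide)
    moreover have "1 / u \<le> 1 / m" using u m by (intro divide_left_mono) auto
    moreover have "u powr 0 \<le> u powr (- \<gamma>)" using u that g by (intro powr_mono') auto
    then have "1 / m * 1 \<le> 1 / m * u powr (- \<gamma>)" using u m by (intro mult_left_mono) auto
    ultimately show ?thesis by simp
  qed simp
  have "\<forall>H\<in>{F, F'}. \<forall>x. H x powr (1/2) \<le> 1 / m * H x powr \<gamma> \<and> H x powr (- (1/2)) \<le> 1 / m * H x powr (- \<gamma>)"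
  proof (intro ballI allI)
    fix H x assume "H \<in> {F, F'}"
    then have "(H x = 0 \<or> m \<le> H x) \<and> 0 \<le> H x \<and> H x \<le> 1"
      using F01(1,2)[of x] F'01(1,2)[of x] c1(2)[of x] c2(2)[of x] by (auto simp: m_def min_le_iff_disj order_le_less)
    then show "H x powr (1/2) \<le> 1 / m * H x powr \<gamma> \<and> H x powr (- (1/2)) \<le> 1 / m * H x powr (- \<gamma>)"
      using est[of "H x"] by blast
  qed
  then show ?thesis using m r by (intro exI[of _ "1/2"] exI[of _ "1/m"]) auto
qed

text \<open>  The assumed integrability concerns the half-line up to 0. The cut at \<open>c\<close> differs by a bounded
  interval, on which the integrand is at most 1.\<close>
lemma nn_integral_side_measure_powr_finite:
  assumes [measurable]: "H \<in> borel_measurable borel" and H: "\<And>x. 0 \<le> H x" "\<And>x. H x \<le> 1"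
    and D: "0 < D" "\<And>x. H x powr \<gamma>' \<le> D * H x powr \<gamma>"
    and int: "set_integrable lborel {..0} (\<lambda>x. H x powr (\<gamma> - b))" and gb: "b \<le> \<gamma>"
  shows "(\<integral>\<^sup>+ x. H x powr \<gamma>' \<partial>side_measure H b c) < \<infinity>"
proof -
  have "(\<integral>\<^sup>+ x. H x powr \<gamma>' \<partial>side_measure H b c) = (\<integral>\<^sup>+ x. ennreal (indicator {..<c} x * H x powr (- b)) * ennreal (H x powr \<gamma>') \<partial>lborel)"
    by (rule nn_integral_side_measure) measurable
  also have "\<dots> \<le> (\<integral>\<^sup>+ x. ennreal D * (ennreal (norm (indicator {..0} x *\<^sub>R H x powr (\<gamma> - b))) + indicator {0..max 0 c} x) \<partial>lborel)"
  proof (intro nn_integral_mono)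
    fix x
    have "H x powr (- b) * H x powr \<gamma>' \<le> H x powr (- b) * (D * H x powr \<gamma>)" using D by (intro mult_left_mono) auto
    also have "\<dots> = D * H x powr (\<gamma> - b)" by (simp add: powr_add[symmetric])
    finally have 1: "H x powr (- b) * H x powr \<gamma>' \<le> D * H x powr (\<gamma> - b)" .
    have 2: "H x powr (\<gamma> - b) \<le> 1" using H gb by (intro powr_le1) auto
    have "indicator {..<c} x * H x powr (- b) * H x powr \<gamma>' \<le> D * (norm (indicator {..0} x *\<^sub>R H x powr (\<gamma> - b)) + indicator {0..max 0 c} x)"
    proof (cases "x < c")
      case True
      then show ?thesis using 1 order_trans[OF 1, of "D * 1"] 2 D by (cases "x \<le> 0") (auto simp: indicator_def distrib_left)
    qed (use D in auto)
    then show "ennreal (indicator {..<c} x * H x powr (- b)) * ennreal (H x powr \<gamma>')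
       \<le> ennreal D * (ennreal (norm (indicator {..0} x *\<^sub>R H x powr (\<gamma> - b))) + indicator {0..max 0 c} x)"
      using D by (simp add: ennreal_mult[symmetric] ennreal_indicator[symmetric] ennreal_plus[symmetric] del: ennreal_plus)
  qed
  also have "\<dots> = ennreal D * ((\<integral>\<^sup>+ x. ennreal (norm (indicator {..0} x *\<^sub>R H x powr (\<gamma> - b))) \<partial>lborel) + emeasure lborel {0..max 0 c})"
    by (subst nn_integral_cmult, measurable, subst nn_integral_add) auto
  also have "\<dots> < \<infinity>"
    using int unfolding set_integrable_def integrable_iff_bounded
    by (simp add: ennreal_mult_less_top emeasure_lborel_Icc_eq)
  finally show ?thesis .
qed

text \<open>  Both parts reduce to the one-sided statements for \<open>X\<close> with weight measure \<open>N\<close> and for \<open>-X\<close> with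
  weight measure \<open>N'\<close>. Under mixing the exponent is chosen for \<open>r = 0\<close>, and the
  dominating variable for the tail masses of \<open>N\<close> and \<open>N'\<close> is \<open>\<phi>(X\<^sub>1)\<close> on both sides.\<close>
theorem theorem3p4:
  fixes M :: "'a measure" and X :: "nat \<Rightarrow> 'a \<Rightarrow> real"
    and \<kappa> :: "real measure" and K F L :: "real \<Rightarrow> real" and \<beta>' \<gamma> C' :: real
  assumes "real_distribution \<kappa>" and "measure \<kappa> {0..1} = 1" and "K = cdf \<kappa>"
    and no_atom_at_1: "measure \<kappa> {1} = 0"
    and "prob_space M"
    and "\<forall>i\<ge>1. X i \<in> borel_measurable M"
    and "\<forall>i\<ge>1. cdf (distr M borel (X i)) = F"
    and "F \<in> L_class K"
    and "0 \<le> \<beta>'" and "\<beta>' < \<gamma>" and "\<gamma> \<le> 1"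
    and "\<forall>x\<in>{0<..<1}. L x > 0 \<and> locally_lipschitz_at (L x) K x"
    and "C' > 0"
    and "\<forall>x\<in>{0<..<1}. L x \<le> C' * x powr (- \<beta>') * (1 - x) powr (- \<beta>')"
    and "set_integrable lborel {..0} (\<lambda>x. F x powr (\<gamma> - \<beta>'))"
    and "set_integrable lborel {0..} (\<lambda>x. (1 - F x) powr (\<gamma> - \<beta>'))"
  shows "(\<forall>r\<in>{0..<1/2}.
            prob_space.indep_vars M (\<lambda>_. borel) X {1..} \<and>
            integrable (interval_measure F) (\<lambda>x. phi_weight \<gamma> F x powr (1 / (1 - r)))
            \<longrightarrow> (AE \<omega> in M. (\<lambda>n. real n powr r *
                    \<bar>L_functional K (emp_cdf X n \<omega>) - L_functional K F\<bar>) \<longlonglongrightarrow> 0))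
         \<and>
         (let G = cdf (distr M borel (\<lambda>\<omega>. phi_weight \<gamma> F (X 1 \<omega>))) in
            alpha_mixing M X \<and>
            integrable (interval_measure F) (phi_weight \<gamma> F) \<and>
            set_integrable lborel {0..1}
              (\<lambda>s. ln (1 + right_inv (alpha_ext M X) (s / 2)) * right_inv (\<lambda>y. 1 - G y) s)
            \<longrightarrow> (AE \<omega> in M. (\<lambda>n.
                    \<bar>L_functional K (emp_cdf X n \<omega>) - L_functional K F\<bar>) \<longlonglongrightarrow> 0))"
proof -
  interpret prob_space M by fact
  note kap = assms(1,2,3) no_atom_at_1
  have X: "\<And>i. 1 \<le> i \<Longrightarrow> X i \<in> borel_measurable M" and cdf: "\<And>i. 1 \<le> i \<Longrightarrow> cdf (distr M borel (X i)) = F"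
    using assms(6,7) by auto
  have g: "0 < \<gamma>" "\<gamma> \<le> 1" and b: "0 \<le> \<beta>'" "\<beta>' < 1" "\<beta>' \<le> \<gamma>" using assms(9,10,11) by auto
  define F' where "F' = cdf (distr M borel (\<lambda>\<omega>. - X 1 \<omega>))"
  have mX: "(\<lambda>\<omega>. - X i \<omega>) \<in> borel_measurable M" if "1 \<le> i" for i using X[OF that] by simp
  have cdf': "cdf (distr M borel (\<lambda>\<omega>. - X i \<omega>)) = F'" if "1 \<le> i" for i
    unfolding F'_def using cdf[OF that] cdf[OF order_refl]
    by (intro distr_uminus_cdf_eq X that order_refl) simp
  note X1 = X[OF order_refl] and mX1 = mX[OF order_refl] and cdf1 = cdf[OF order_refl] and cdf1' = cdf'[OF order_refl]
  note F01 = cdf_of_bounds[OF X1 cdf1] and F'01 = cdf_of_bounds[OF mX1 cdf1']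
  have Fm: "F \<in> borel_measurable borel" and F'm: "F' \<in> borel_measurable borel"
    using borel_measurable_cdf_of[OF X1 cdf1] borel_measurable_cdf_of[OF mX1 cdf1'] .
  note [measurable] = Fm F'm X1[unfolded One_nat_def] X1
  define c where "c = Inf {x. 1 / 2 \<le> F x}"
  define N where "N = side_measure F \<beta>' c"
  define N' where "N' = side_measure F' \<beta>' (- c)"
  define \<phi> where "\<phi> = phi_weight \<gamma> F"
  have \<phi>m[measurable]: "\<phi> \<in> borel_measurable borel" unfolding \<phi>_def by (rule phi_weight_measurable[OF Fm])
  have \<phi>1: "1 \<le> \<phi> x" for x unfolding \<phi>_def by (rule phi_weight_ge_1[OF F01(1,2)]) (use g in simp)
  have sf: "sigma_finite_measure N" "sets N = sets borel" "sigma_finite_measure N'" "sets N' = sets borel"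
    unfolding N_def N'_def by (simp_all only: sigma_finite_side_measure sets_side_measure Fm F'm)
  have law: "interval_measure F = distr M borel (X 1)"
  proof -
    interpret D: real_distribution "distr M borel (X 1)" using X1 by simp
    have m: "\<And>x y. x \<le> y \<Longrightarrow> F x \<le> F y" using F01(3) by (rule monoD)
    have rc: "\<And>a. continuous (at_right a) F" using D.cdf_is_right_cont by (simp only: cdf1)
    have bot: "(F \<longlongrightarrow> 0) at_bot" using D.cdf_lim_at_bot by (simp only: cdf1)
    have top: "(F \<longlongrightarrow> 1) at_top" using D.cdf_lim_at_top_prob by (simp only: cdf1)
    have "real_distribution (interval_measure F)"
      by (rule real_distribution_interval_measure) (fact m rc bot top)+
    moreover have "cdf (interval_measure F) = F"
      by (rule cdf_interval_measure) (fact m rc bot)+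
    ultimately show ?thesis
      using D.real_distribution_axioms by (intro cdf_unique) (simp_all only: cdf1)
  qed
  have lawint: "integrable M (\<lambda>\<omega>. f (X 1 \<omega>))" if "integrable (interval_measure F) f" "f \<in> borel_measurable borel" for f :: "real \<Rightarrow> real"
    using that integrable_distr_eq[OF X1 that(2)] by (simp add: law)
  have int': "set_integrable lborel {..0} (\<lambda>x. F' x powr (\<gamma> - \<beta>'))"
  proof -
    have "set_integrable lborel {..0} (\<lambda>x. (1 - F (- x)) powr (\<gamma> - \<beta>'))"
    proof -
      have "integrable lborel (\<lambda>x. indicator {0..} (0 + (-1) * x) *\<^sub>R (1 - F (0 + (-1) * x)) powr (\<gamma> - \<beta>'))"
        using assms(16) unfolding set_integrable_def by (rule lborel_integrable_real_affine) simp
      moreover have "indicator {0..} (0 + (-1) * x) = (indicator {..0} x :: real)" for x :: real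
        by (auto simp: indicator_def)
      ultimately show ?thesis unfolding set_integrable_def by simp
    qed
    moreover have "AE x in lborel. F' x = 1 - F (- x)"
    proof -
      have d: "distr lborel borel uminus = (lborel :: real measure)"
        by (subst lborel_distr_uminus) (rule refl)
      have "AE x in distr lborel borel uminus. F' (- x) = 1 - F x"
        unfolding d by (rule reflected_cdf(3)[OF X1 cdf1 cdf1'])
      then show ?thesis by (subst (asm) AE_distr_iff) auto
    qed
    ultimately show ?thesis
      by (subst set_integrable_cong_AE[where g = "\<lambda>x. (1 - F (- x)) powr (\<gamma> - \<beta>')"]) (auto elim!: eventually_mono)
  qed
  define B where "B = 2 * C' / (1 - \<beta>')"
  have B0: "0 \<le> B" using assms(13) b by (simp add: B_def)
  have kernel: "\<bar>K s - K t\<bar> \<le> B * \<bar>s - t\<bar> * (t powr (- \<beta>') + (1 - t) powr (- \<beta>'))"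
    if "0 \<le> s" "s \<le> 1" "0 < t" "t < 1" for s t
  proof -
    interpret \<kappa>: real_distribution \<kappa> by fact
    have "continuous (at_right 0) K" unfolding assms(3) by (rule \<kappa>.cdf_is_right_cont)
    moreover have "continuous (at_left 1) K"
      unfolding assms(3) by (rule continuous_at_left_1_of_no_atom[OF assms(1,2) no_atom_at_1])
    ultimately show ?thesis
      unfolding B_def using assms(12,14) that by (intro kernel_increment_bound[where L=L] b assms(13)) auto
  qed
  have conclude: "AE \<omega> in M. (\<lambda>n. real n powr r * \<bar>L_functional K (emp_cdf X n \<omega>) - L_functional K F\<bar>) \<longlonglongrightarrow> 0"
    if left: "AE \<omega> in M. (\<lambda>n. ennreal (real n powr r) * (\<integral>\<^sup>+ x. \<bar>emp_cdf X n \<omega> x - F x\<bar> \<partial>N)) \<longlonglongrightarrow> 0"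
      and right: "AE \<omega> in M. (\<lambda>n. ennreal (real n powr r) *
        (\<integral>\<^sup>+ x. \<bar>emp_cdf (\<lambda>i \<omega>. - X i \<omega>) n \<omega> x - F' x\<bar> \<partial>N')) \<longlonglongrightarrow> 0" for r
    by (rule L_functional_rate_of_side_rates)
      (fact kap assms(8) X cdf cdf' b(1) B0 kernel c_def left[unfolded N_def] right[unfolded N'_def])+
  have indep_part: "AE \<omega> in M. (\<lambda>n. real n powr r * \<bar>L_functional K (emp_cdf X n \<omega>) - L_functional K F\<bar>) \<longlonglongrightarrow> 0"
    if r: "0 \<le> r" "r < 1/2" and ind: "indep_vars (\<lambda>_. borel) X {1..}"
      and int: "integrable (interval_measure F) (\<lambda>x. phi_weight \<gamma> F x powr (1 / (1 - r)))" for r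
  proof -
    have "integrable M (\<lambda>\<omega>. phi_weight \<gamma> F (X 1 \<omega>) powr (1 / (1 - r)))"
      using lawint[OF int] \<phi>m by (simp add: \<phi>_def)
    from exponent_below_moment_order[OF X1 cdf1 cdf1' g r this]
    obtain \<gamma>' D where gd: "0 < \<gamma>'" "\<gamma>' < 1 - r" "0 < D" "\<And>x. F x powr \<gamma>' \<le> D * F x powr \<gamma>" "\<And>x. F' x powr \<gamma>' \<le> D * F' x powr \<gamma>"
      by auto
    have ind': "indep_vars (\<lambda>_. borel) (\<lambda>i \<omega>. - X i \<omega>) {1..}"
      by (rule indep_vars_compose2[OF ind]) simp
    have fin: "(\<integral>\<^sup>+ x. F x powr \<gamma>' \<partial>N) < \<infinity>" "(\<integral>\<^sup>+ x. F' x powr \<gamma>' \<partial>N') < \<infinity>"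
      unfolding N_def N'_def
      by (rule nn_integral_side_measure_powr_finite; fact Fm F01 F'm F'01 b gd int' assms)+
    show ?thesis
    proof (rule conclude)
      show "AE \<omega> in M. (\<lambda>n. ennreal (real n powr r) * (\<integral>\<^sup>+ x. \<bar>emp_cdf X n \<omega> x - F x\<bar> \<partial>N)) \<longlonglongrightarrow> 0"
        by (rule independent_weighted_rate[where \<gamma> = \<gamma>']) (fact ind cdf sf r gd fin)+
      show "AE \<omega> in M. (\<lambda>n. ennreal (real n powr r) * (\<integral>\<^sup>+ x. \<bar>emp_cdf (\<lambda>i \<omega>. - X i \<omega>) n \<omega> x - F' x\<bar> \<partial>N')) \<longlonglongrightarrow> 0"
        by (rule independent_weighted_rate[where \<gamma> = \<gamma>']) (fact ind' cdf' sf r gd fin)+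
    qed
  qed
  have mixing_part: "AE \<omega> in M. (\<lambda>n. \<bar>L_functional K (emp_cdf X n \<omega>) - L_functional K F\<bar>) \<longlonglongrightarrow> 0"
    if mix: "alpha_mixing M X" and int: "integrable (interval_measure F) (phi_weight \<gamma> F)"
      and log: "set_integrable lborel {0..1} (\<lambda>s. ln (1 + right_inv (alpha_ext M X) (s / 2)) *
        right_inv (\<lambda>y. 1 - cdf (distr M borel (\<lambda>\<omega>. phi_weight \<gamma> F (X 1 \<omega>))) y) s)"
  proof -
    define U where "U = (\<lambda>\<omega>. \<phi> (X 1 \<omega>))"
    have Um[measurable]: "U \<in> borel_measurable M" unfolding U_def by measurable
    have U1: "\<And>\<omega>. 1 \<le> U \<omega>" by (simp add: U_def \<phi>1)
    have "integrable M (\<lambda>\<omega>. phi_weight \<gamma> F (X 1 \<omega>) powr (1 / (1 - 0)))"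
      using lawint[OF int] \<phi>m \<phi>1 by (simp add: \<phi>_def order_trans[OF zero_le_one])
    from exponent_below_moment_order[OF X1 cdf1 cdf1' g _ _ this]
    obtain \<gamma>' D where gd: "0 < \<gamma>'" "\<gamma>' < 1" "0 < D" "\<And>x. F x powr \<gamma>' \<le> D * F x powr \<gamma>" "\<And>x. F' x powr \<gamma>' \<le> D * F' x powr \<gamma>"
      and gd': "\<And>x. F x powr (- \<gamma>') \<le> D * F x powr (- \<gamma>)" "\<And>x. F' x powr (- \<gamma>') \<le> D * F' x powr (- \<gamma>)"
      by auto
    have tails: "mixing_tails M X U < \<infinity>"
      by (rule summable_truncated_tails[OF Um refl mix]) (use log in \<open>simp add: U_def \<phi>_def\<close>)
    then have tails': "mixing_tails M (\<lambda>i \<omega>. - X i \<omega>) U < \<infinity>" by (simp add: mixing_tails_def alpha_coeff_reflected)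
    obtain C where C: "0 < C" and dom: "AE \<omega> in M. F (X 1 \<omega>) powr (- \<gamma>) \<le> C * U \<omega> \<and> F' (- X 1 \<omega>) powr (- \<gamma>) \<le> C * U \<omega>"
      using phi_weight_dominates[OF X1 cdf1 cdf1', of \<gamma>] g by (auto simp: U_def \<phi>_def)
    have fin: "(\<integral>\<^sup>+ x. F x powr \<gamma>' \<partial>N) < \<infinity>" "(\<integral>\<^sup>+ x. F' x powr \<gamma>' \<partial>N') < \<infinity>"
      unfolding N_def N'_def
      by (rule nn_integral_side_measure_powr_finite; fact Fm F01 F'm F'01 b gd int' assms)+
    obtain l where l: "(\<integral>\<^sup>+ x. F x powr \<gamma>' \<partial>N) = ennreal l" "0 \<le> l"
      using fin(1) by (cases "\<integral>\<^sup>+ x. F x powr \<gamma>' \<partial>N") auto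
    obtain l' where l': "(\<integral>\<^sup>+ x. F' x powr \<gamma>' \<partial>N') = ennreal l'" "0 \<le> l'"
      using fin(2) by (cases "\<integral>\<^sup>+ x. F' x powr \<gamma>' \<partial>N'") auto
    define E where "E = 1 + D * C * l + D * C * l'"
    have "0 \<le> D * C * l" "0 \<le> D * C * l'" using gd(3) C l l' by simp_all
    then have E: "0 < E" "D * C * l \<le> E" "D * C * l' \<le> E" unfolding E_def by linarith+
    have tail: "ennreal (h powr (- \<gamma>')) * ennreal a \<le> ennreal (E * u)"
      if "h powr (- \<gamma>') \<le> D * h powr (- \<gamma>)" "h powr (- \<gamma>) \<le> C * u" "0 \<le> a" "D * C * a \<le> E" "1 \<le> u" for h a u
    proof -
      have "D * h powr (- \<gamma>) \<le> D * (C * u)" using that(2) gd(3) by (intro mult_left_mono) auto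
      then have "h powr (- \<gamma>') * a \<le> (D * (C * u)) * a"
        using that(1,3) by (intro mult_right_mono) auto
      also have "\<dots> = (D * C * a) * u" by (simp add: mult_ac)
      also have "\<dots> \<le> E * u" using that by (intro mult_right_mono) auto
      finally show ?thesis using that by (simp add: ennreal_mult[symmetric] ennreal_leI)
    qed
    have left: "AE \<omega> in M. (\<lambda>n. \<integral>\<^sup>+ x. \<bar>emp_cdf X n \<omega> x - F x\<bar> \<partial>N) \<longlonglongrightarrow> 0"
    proof (rule mixing_weighted_slln[where \<gamma> = \<gamma>' and U = U and C = E])
      show "AE \<omega> in M. emeasure N {X 1 \<omega>..} \<le> ennreal (E * U \<omega>)"
        using dom AE_cdf_pos[OF X1 cdf1]
      proof eventually_elim
        case (elim \<omega>)
        have "emeasure N {X 1 \<omega>..} \<le> ennreal (F (X 1 \<omega>) powr (- \<gamma>')) * ennreal l"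
          using emeasure_atLeast_le_powr[OF sf(2) Fm F01(3) elim(2), of \<gamma>'] gd(1) l(1) by simp
        also have "\<dots> \<le> ennreal (E * U \<omega>)" using elim(1) by (intro tail gd' E U1 l) simp
        finally show ?case .
      qed
    qed (fact X cdf sf gd fin Um U1 E tails)+
    have right: "AE \<omega> in M. (\<lambda>n. \<integral>\<^sup>+ x. \<bar>emp_cdf (\<lambda>i \<omega>. - X i \<omega>) n \<omega> x - F' x\<bar> \<partial>N') \<longlonglongrightarrow> 0"
    proof (rule mixing_weighted_slln[where \<gamma> = \<gamma>' and U = U and C = E])
      show "AE \<omega> in M. emeasure N' {- X 1 \<omega>..} \<le> ennreal (E * U \<omega>)"
        using dom AE_cdf_pos[OF mX1 cdf1']
      proof eventually_elim
        case (elim \<omega>)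
        have "emeasure N' {- X 1 \<omega>..} \<le> ennreal (F' (- X 1 \<omega>) powr (- \<gamma>')) * ennreal l'"
          using emeasure_atLeast_le_powr[OF sf(4) F'm F'01(3) elim(2), of \<gamma>'] gd(1) l'(1) by simp
        also have "\<dots> \<le> ennreal (E * U \<omega>)" using elim(1) by (intro tail gd' E U1 l') simp
        finally show ?case .
      qed
    qed (fact mX cdf' sf gd fin Um U1 E tails')+
    \<comment> \<open>The factor \<open>n\<^sup>0\<close> is 1 except at \<open>n = 0\<close>, where it is 0.\<close>
    have unit: "(\<lambda>n. ennreal (real n powr 0) * f n) \<longlonglongrightarrow> 0" if "f \<longlonglongrightarrow> 0" for f :: "nat \<Rightarrow> ennreal"
      by (rule tendsto_sandwich[OF _ _ tendsto_const that]) (auto intro!: always_eventually simp: powr_zero_eq_one)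
    have "AE \<omega> in M. (\<lambda>n. real n powr 0 * \<bar>L_functional K (emp_cdf X n \<omega>) - L_functional K F\<bar>) \<longlonglongrightarrow> 0"
    proof (rule conclude)
      show "AE \<omega> in M. (\<lambda>n. ennreal (real n powr 0) * (\<integral>\<^sup>+ x. \<bar>emp_cdf X n \<omega> x - F x\<bar> \<partial>N)) \<longlonglongrightarrow> 0"
        using left by eventually_elim (rule unit)
      show "AE \<omega> in M. (\<lambda>n. ennreal (real n powr 0) * (\<integral>\<^sup>+ x. \<bar>emp_cdf (\<lambda>i \<omega>. - X i \<omega>) n \<omega> x - F' x\<bar> \<partial>N')) \<longlonglongrightarrow> 0"
        using right by eventually_elim (rule unit)
    qed
    then show ?thesis
    proof eventually_elim
      case (elim \<omega>)
      have "\<forall>\<^sub>F n in sequentially. real n powr 0 * \<bar>L_functional K (emp_cdf X n \<omega>) - L_functional K F\<bar>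
          = \<bar>L_functional K (emp_cdf X n \<omega>) - L_functional K F\<bar>"
        using eventually_ge_at_top[of 1] by eventually_elim simp
      from tendsto_cong[OF this] elim show ?case by blast
    qed
  qed
  show ?thesis
    unfolding Let_def using indep_part mixing_part by auto
qed

end
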